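(* Let $\Omega\subset\mathbb{R}^n$ be a bounded domain and fix $0<\alpha\le 1$. Consider an arbitrary sequence of first eigenvalues $\lambda_p$ of $\Omega$ with $p\to\infty$ (where $p\ge 2$ and $\alpha p>2n$), and denote the corresponding first eigenfunction by $u_p$. Then there exists a subsequence of the functions $u_p$ converging uniformly in $\Omega$ to a function $u\in C_0(\overline{\Omega})$ which is a viscosity solution in $\Omega$ of the $\infty$-eigenvalue equation $$\max\left\{\mathcal{L}_\infty u(x),\ \mathcal{L}^-_\infty u(x)+\Lambda_\infty^\alpha u(x)\right\}=0 .$$
   Context: First eigenvalues and eigenfunctions for finite $p$: put $s=\alpha-n/p$, and let $W^{s,p}_0(\Omega)$ be the closure of $C_0^\infty(\Omega)$ in the fractional Sobolev norm of $W^{s,p}(\Omega)$, given by $\|u\|^p=\iint \frac{|u(y)-u(x)|^p}{|y-x|^{n+sp}}\,dx\,dy+\int|u|^p\,dx$; functions are extended by zero to $\mathbb{R}^n$. The first eigenvalue $\lambda_p$ is the infimum over $\phi\in C_0^\infty(\Omega)$, $\phi\not\equiv0$, of the Rayleigh quotient $\int_{\mathbb{R}^n}\int_{\mathbb{R}^n}\frac{|\phi(y)-\phi(x)|^p}{|y-x|^{\alpha p}}\,dx\,dy\big/\int_{\mathbb{R}^n}|\phi|^p\,dx$. A first eigenfunction is a non-negative $u_p\in W_0^{s,p}(\Omega)$, $u_p\not\equiv 0$, whose Rayleigh quotient equals $\lambda_p$. Limit equation: $R=\max_{x\in\Omega}\operatorname{dist}(x,\mathbb{R}^n\setminus\Omega)$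 and $\Lambda_\infty^\alpha=R^{-\alpha}$. For a function $u$ on $\mathbb{R}^n$, $$\mathcal{L}^+_\infty u(x)=\sup_{y\in\mathbb{R}^n,\,y\ne x}\frac{u(y)-u(x)}{|y-x|^\alpha},\quad \mathcal{L}^-_\infty u(x)=\inf_{y\in\mathbb{R}^n,\,y\neq x}\frac{u(y)-u(x)}{|y-x|^\alpha},\quad \mathcal{L}_\infty u=\mathcal{L}_\infty^+u+\mathcal{L}_\infty^-u .$$ $C_0(\overline\Omega)$ denotes the continuous functions on $\overline\Omega$ vanishing on $\partial\Omega$, extended by zero to $\mathbb{R}^n$. $C_0(\mathbb{R}^n)$ and $C_0^1(\mathbb{R}^n)$ denote compactly supported continuous, respectively $C^1$, functions. A function $\phi$ touches $u$ from below (above) at $x_0$ if $\phi(x_0)=u(x_0)$ and $\phi\le u$ ($\phi\ge u$) in $\mathbb{R}^n$. A non-negative $u\in C_0(\mathbb{R}^n)$ is a viscosity supersolution of the $\infty$-eigenvalue equation in $\Omega$ if $\mathcal{L}_\infty\phi(x_0)\le0$ and $\mathcal{L}_\infty^-\phi(x_0)+\Lambda_\infty^\alpha\phi(x_0)\le0$ whenever $\phi\in C_0^1(\mathbb{R}^n)$ touches $u$ from below at $x_0\in\Omega$; a viscosity subsolution if $\mathcal{L}_\infty\psi(x_0)\ge0$ or $\mathcal{L}_\infty^-\psi(x_0)+\Lambda_\infty^\alpha\psi(x_0)\ge0$ whenever $\psi\in C_0^1(\mathbb{R}^n)$ touches $u$ from above at $x_0\in\Omega$; a viscosity solution if both.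
   Formalization: The first eigenfunctions are normalised by requiring the L^p norm of u_p over R^n to be 1; without a normalisation the claim fails, since arbitrary multiples such as k times the k-th eigenfunction have no uniformly convergent subsequence. *)

theory Defs
  imports "HOL-Analysis.Analysis"
begin

section \<open>Function spaces\<close>

text \<open>\<open>C_k k f\<close>: \<open>f\<close> is of class \<open>C\<^sup>k\<close> on the whole space. Differentiability at every point together
  with the directional derivatives being of class \<open>C\<^sup>k\<close> is the usual notion of class \<open>C\<^sup>k\<^sup>+\<^sup>1\<close>.\<close>

primrec C_k :: "nat \<Rightarrow> ('a::euclidean_space \<Rightarrow> real) \<Rightarrow> bool" where
  "C_k 0 f \<longleftrightarrow> continuous_on UNIV f"
| "C_k (Suc k) f \<longleftrightarrow>
     (\<forall>x. f differentiable (at x)) \<and> (\<forall>v. C_k k (\<lambda>x. frechet_derivative f (at x) v))"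

definition supp :: "('a::euclidean_space \<Rightarrow> real) \<Rightarrow> 'a set" where
  "supp f = closure {x. f x \<noteq> 0}"

definition Cc :: "('a::euclidean_space \<Rightarrow> real) set" where
  "Cc = {f. continuous_on UNIV f \<and> compact (supp f)}"

definition Cc1 :: "('a::euclidean_space \<Rightarrow> real) set" where
  "Cc1 = {f. C_k 1 f \<and> compact (supp f)}"

definition Cc_infty :: "'a::euclidean_space set \<Rightarrow> ('a \<Rightarrow> real) set" where
  "Cc_infty \<Omega> = {f. (\<forall>k. C_k k f) \<and> compact (supp f) \<and> supp f \<subseteq> \<Omega>}"

text \<open>Continuous functions on \<open>closure \<Omega>\<close> vanishing on the boundary, extended by zero.\<close>

definition C0_closure :: "'a::euclidean_space set \<Rightarrow> ('a \<Rightarrow> real) set" where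
  "C0_closure \<Omega> = {u. continuous_on (closure \<Omega>) u \<and> (\<forall>x\<in>frontier \<Omega>. u x = 0) \<and>
                      (\<forall>x. x \<notin> closure \<Omega> \<longrightarrow> u x = 0)}"

section \<open>First eigenvalues and eigenfunctions for finite \<open>p\<close>\<close>

text \<open>The integrals are \<open>ennreal\<close>-valued, so that a divergent integral is \<open>\<infinity>\<close>. On the diagonal the
  integrand is \<open>0 / 0 = 0\<close>.\<close>

definition frac_energy :: "real \<Rightarrow> real \<Rightarrow> ('a::euclidean_space \<Rightarrow> real) \<Rightarrow> ennreal" where
  "frac_energy \<beta> p u =
     (\<integral>\<^sup>+ x. (\<integral>\<^sup>+ y. ennreal (\<bar>u y - u x\<bar> powr p / norm (y - x) powr \<beta>) \<partial>lebesgue) \<partial>lebesgue)"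

definition Lp_power :: "real \<Rightarrow> ('a::euclidean_space \<Rightarrow> real) \<Rightarrow> ennreal" where
  "Lp_power p u = (\<integral>\<^sup>+ x. ennreal (\<bar>u x\<bar> powr p) \<partial>lebesgue)"

text \<open>The \<open>p\<close>-th power of the norm of \<open>W\<^sup>s\<^sup>,\<^sup>p\<close>, for functions extended by zero.\<close>

definition Wsp_norm_power :: "real \<Rightarrow> real \<Rightarrow> ('a::euclidean_space \<Rightarrow> real) \<Rightarrow> ennreal" where
  "Wsp_norm_power s p u = frac_energy (real DIM('a) + s * p) p u + Lp_power p u"

text \<open>Elements of \<open>W\<^sub>0\<^sup>s\<^sup>,\<^sup>p\<close> are represented by functions, to be read modulo equality almost
  everywhere. A member vanishes almost everywhere outside \<open>\<Omega>\<close>, being a limit of functions that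
  vanish there.\<close>

definition W0sp :: "real \<Rightarrow> real \<Rightarrow> 'a::euclidean_space set \<Rightarrow> ('a \<Rightarrow> real) set" where
  "W0sp s p \<Omega> = {u \<in> borel_measurable lebesgue.
     \<exists>\<phi> :: nat \<Rightarrow> 'a \<Rightarrow> real. (\<forall>j. \<phi> j \<in> Cc_infty \<Omega>) \<and>
       (\<lambda>j. Wsp_norm_power s p (\<lambda>x. \<phi> j x - u x)) \<longlonglongrightarrow> 0}"

definition rayleigh :: "real \<Rightarrow> real \<Rightarrow> ('a::euclidean_space \<Rightarrow> real) \<Rightarrow> ennreal" where
  "rayleigh \<alpha> p u = frac_energy (\<alpha> * p) p u / Lp_power p u"

definition first_eigenvalue :: "real \<Rightarrow> real \<Rightarrow> 'a::euclidean_space set \<Rightarrow> ennreal" where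
  "first_eigenvalue \<alpha> p \<Omega> = (INF \<phi>\<in>{\<phi> \<in> Cc_infty \<Omega>. \<exists>x. \<phi> x \<noteq> 0}. rayleigh \<alpha> p \<phi>)"

definition first_eigenfunction ::
    "real \<Rightarrow> real \<Rightarrow> 'a::euclidean_space set \<Rightarrow> ('a \<Rightarrow> real) \<Rightarrow> bool" where
  "first_eigenfunction \<alpha> p \<Omega> u \<longleftrightarrow>
     u \<in> W0sp (\<alpha> - real DIM('a) / p) p \<Omega> \<and>
     (AE x in lebesgue. 0 \<le> u x) \<and> \<not> (AE x in lebesgue. u x = 0) \<and>
     rayleigh \<alpha> p u = first_eigenvalue \<alpha> p \<Omega>"

section \<open>The \<open>\<infinity>\<close>-eigenvalue equation\<close>

definition inradius :: "'a::euclidean_space set \<Rightarrow> real" where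
  "inradius \<Omega> = (SUP x\<in>\<Omega>. infdist x (- \<Omega>))"

text \<open>The quantity \<open>\<Lambda>\<^sub>\<infinity>\<^sup>\<alpha>\<close>, the power included.\<close>

definition Lambda_infty_pow :: "real \<Rightarrow> 'a::euclidean_space set \<Rightarrow> real" where
  "Lambda_infty_pow \<alpha> \<Omega> = inradius \<Omega> powr (- \<alpha>)"

text \<open>Real-valued supremum and infimum. They are applied below only to compactly supported
  \<open>C\<^sup>1\<close> functions, for which the difference quotients are bounded as \<open>0 < \<alpha> \<le> 1\<close>.\<close>

definition L_plus :: "real \<Rightarrow> ('a::euclidean_space \<Rightarrow> real) \<Rightarrow> 'a \<Rightarrow> real" where
  "L_plus \<alpha> u x = (SUP y\<in>{y. y \<noteq> x}. (u y - u x) / norm (y - x) powr \<alpha>)"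

definition L_minus :: "real \<Rightarrow> ('a::euclidean_space \<Rightarrow> real) \<Rightarrow> 'a \<Rightarrow> real" where
  "L_minus \<alpha> u x = (INF y\<in>{y. y \<noteq> x}. (u y - u x) / norm (y - x) powr \<alpha>)"

definition L_infty :: "real \<Rightarrow> ('a::euclidean_space \<Rightarrow> real) \<Rightarrow> 'a \<Rightarrow> real" where
  "L_infty \<alpha> u x = L_plus \<alpha> u x + L_minus \<alpha> u x"

definition touches_below :: "('a \<Rightarrow> real) \<Rightarrow> ('a \<Rightarrow> real) \<Rightarrow> 'a \<Rightarrow> bool" where
  "touches_below \<phi> u x0 \<longleftrightarrow> \<phi> x0 = u x0 \<and> (\<forall>x. \<phi> x \<le> u x)"

definition touches_above :: "('a \<Rightarrow> real) \<Rightarrow> ('a \<Rightarrow> real) \<Rightarrow> 'a \<Rightarrow> bool" where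
  "touches_above \<psi> u x0 \<longleftrightarrow> \<psi> x0 = u x0 \<and> (\<forall>x. \<psi> x \<ge> u x)"

definition viscosity_supersolution ::
    "real \<Rightarrow> 'a::euclidean_space set \<Rightarrow> ('a \<Rightarrow> real) \<Rightarrow> bool" where
  "viscosity_supersolution \<alpha> \<Omega> u \<longleftrightarrow>
     u \<in> Cc \<and> (\<forall>x. 0 \<le> u x) \<and>
     (\<forall>x0\<in>\<Omega>. \<forall>\<phi>\<in>Cc1. touches_below \<phi> u x0 \<longrightarrow>
        L_infty \<alpha> \<phi> x0 \<le> 0 \<and> L_minus \<alpha> \<phi> x0 + Lambda_infty_pow \<alpha> \<Omega> * \<phi> x0 \<le> 0)"

definition viscosity_subsolution ::
    "real \<Rightarrow> 'a::euclidean_space set \<Rightarrow> ('a \<Rightarrow> real) \<Rightarrow> bool" where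
  "viscosity_subsolution \<alpha> \<Omega> u \<longleftrightarrow>
     u \<in> Cc \<and> (\<forall>x. 0 \<le> u x) \<and>
     (\<forall>x0\<in>\<Omega>. \<forall>\<psi>\<in>Cc1. touches_above \<psi> u x0 \<longrightarrow>
        L_infty \<alpha> \<psi> x0 \<ge> 0 \<or> L_minus \<alpha> \<psi> x0 + Lambda_infty_pow \<alpha> \<Omega> * \<psi> x0 \<ge> 0)"

definition viscosity_solution ::
    "real \<Rightarrow> 'a::euclidean_space set \<Rightarrow> ('a \<Rightarrow> real) \<Rightarrow> bool" where
  "viscosity_solution \<alpha> \<Omega> u \<longleftrightarrow>
     viscosity_supersolution \<alpha> \<Omega> u \<and> viscosity_subsolution \<alpha> \<Omega> u"

text \<open>The continuous representative of an almost-everywhere class.\<close>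

definition continuous_rep :: "('a::euclidean_space \<Rightarrow> real) \<Rightarrow> ('a \<Rightarrow> real) \<Rightarrow> bool" where
  "continuous_rep v u \<longleftrightarrow> continuous_on UNIV v \<and> (AE x in lebesgue. v x = u x)"

end

theory Submission
  imports Defs "HOL-Complex_Analysis.Great_Picard"
begin

text \<open>Mollification and truncation do not increase the Gagliardo energy, so \<open>\<lambda>\<^sub>p\<close> also bounds the
  Rayleigh quotient from below on all non-negative continuous functions vanishing off \<open>\<Omega>\<close>. The
  competitor \<open>(\<rho> - \<bar>x - x\<^sub>0\<bar>)\<^sub>+\<^sup>\<alpha>\<close> on an almost maximal ball gives \<open>limsup \<lambda>\<^sub>p\<^sup>1\<^sup>/\<^sup>p \<le> \<Lambda>\<^sub>\<infinity>\<^sup>\<alpha>\<close>; a Morrey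
  inequality with constants uniform in \<open>p\<close> makes the \<open>u\<^sub>p\<close> equicontinuous, and a limit \<open>u\<close> reaches
  the value 1, so that the quotient \<open>\<bar>u y - u x\<bar> / \<bar>y - x\<bar>\<^sup>\<alpha>\<close> between such a point and its nearest
  boundary point forces \<open>liminf \<lambda>\<^sub>p\<^sup>1\<^sup>/\<^sup>p \<ge> \<Lambda>\<^sub>\<infinity>\<^sup>\<alpha>\<close>.

  For the viscosity inequalities no equation for finite \<open>p\<close> is used pointwise. If \<open>\<phi>\<close> touches \<open>u\<close> from
  below at \<open>x\<^sub>0\<close>, let \<open>\<Phi>\<close> be \<open>\<phi>\<close> lowered away from \<open>x\<^sub>0\<close> and raised by a small constant, and
  \<open>\<eta> = (\<Phi> - u\<^sub>p)\<^sub>+\<close>, which lives near \<open>x\<^sub>0\<close>. Minimality of \<open>u\<^sub>p\<close> against \<open>max u\<^sub>p \<Phi>\<close> and convexity give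
  \<open>\<lambda>\<^sub>p \<integral> u\<^sub>p\<^sup>p\<^sup>-\<^sup>1 \<eta> \<le> \<integral>\<integral> \<bar>\<Phi> y - \<Phi> x\<bar>\<^sup>p\<^sup>-\<^sup>2 (\<Phi> y - \<Phi> x) (\<eta> y - \<eta> x) / \<bar>y - x\<bar>\<^sup>\<alpha>\<^sup>p\<close>. The positive part of the
  right-hand side is of order \<open>(- L\<^sup>- \<phi> x\<^sub>0)\<^sup>p\<close>, its negative part of order \<open>(L\<^sup>+ \<phi> x\<^sub>0)\<^sup>p\<close> and the left-hand
  side of order \<open>(\<Lambda>\<^sub>\<infinity>\<^sup>\<alpha> u x\<^sub>0)\<^sup>p\<close>; comparing exponential rates as \<open>p \<rightarrow> \<infinity>\<close> gives both supersolution
  inequalities. The competitor \<open>min\<close> gives the subsolution property in the same way. Working with the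
  double integral avoids the principal value that the pointwise operator would need for \<open>\<alpha> = 1\<close>.\<close>

section \<open>Smooth approximation and the energy of competitors\<close>

text \<open>Only exponential rates in p survive the limit, so constants may be generous but must be
  free of p. Two places threaten this. In the double integrals the p-th power of a sharp base alone
  is not integrable over the whole space; hence a fixed number m of factors, with \<alpha> m = n + 1
  for n the dimension, is set aside for decay at infinity, and the remaining powers carry the sharp
  base. On the diagonal the flux leaves |\<eta> y - \<eta> x| / |y - x|^\<alpha>, and boundedness of
  \<eta> alone would not make this integrable when \<alpha> = n = 1; a Hoelder bound with exponent
  \<alpha>/2, uniform in p, does. The Morrey exponent is \<alpha> - 2n/p, which is at least
  \<alpha>/2 exactly when 4n \<le> \<alpha> p; this is the threshold that recurs below. Energies are
  \<open>ennreal\<close>-valued and a priori possibly infinite, so inequalities are arranged with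
  sums of nonnegative terms on both sides, and the eigenvalue is shown to be finite before it is
  cancelled.\<close>

lemma C_k_of_closed_class:
  fixes S :: "('a::euclidean_space \<Rightarrow> real) set"
  assumes S: "\<And>f. f \<in> S \<Longrightarrow> \<exists>D. (\<forall>x. (f has_derivative D x) (at x)) \<and> (\<forall>v. (\<lambda>x. D x v) \<in> S)"
    and "f \<in> S"
  shows "C_k k f"
  using \<open>f \<in> S\<close>
proof (induction k arbitrary: f)
  case 0
  then obtain D where "\<forall>x. (f has_derivative D x) (at x)" using S by blast
  then show ?case by (auto intro!: continuous_at_imp_continuous_on has_derivative_continuous)
next
  case (Suc k)
  then obtain D where D: "\<forall>x. (f has_derivative D x) (at x)" "\<forall>v. (\<lambda>x. D x v) \<in> S"
    using S by blast
  have "frechet_derivative f (at x) = D x" for x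
    using D(1) frechet_derivative_at by metis
  then show ?case using D Suc.IH by (auto simp: differentiable_def)
qed

text \<open>The flat function e^(-1/t) together with all factors t^(-m): differentiation maps the
  family into its own linear span, which the bare exponential does not allow.\<close>

definition flat :: "nat \<Rightarrow> real \<Rightarrow> real" where
  "flat m t = (if t > 0 then exp (- (1 / t)) / t ^ m else 0)"

lemma flat_nonneg: "0 \<le> flat m t"
  by (simp add: flat_def)

lemma power_div_fact_le_exp:
  fixes x :: real
  assumes "0 \<le> x"
  shows "x ^ n / fact n \<le> exp x"
proof -
  have "(\<Sum>k\<in>{n}. x ^ k /\<^sub>R fact k) \<le> (\<Sum>k. x ^ k /\<^sub>R fact k)"
    by (rule sum_le_suminf) (use assms summable_exp in auto)
  then show ?thesis by (simp add: exp_def divide_inverse mult.commute)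
qed

text \<open>Keep the single term of order m + 1 in the series of e^(1/t). A linear bound for every m
  suffices at the origin, because dividing by t only raises m by one.\<close>

lemma flat_le_linear:
  assumes "0 < t"
  shows "flat m t \<le> fact (Suc m) * t"
proof -
  have "(1 / t) ^ Suc m / fact (Suc m) \<le> exp (1 / t)"
    using assms by (intro power_div_fact_le_exp) auto
  then have "1 \<le> exp (1 / t) * (fact (Suc m) * t ^ Suc m)"
    using assms by (simp add: field_simps del: fact_Suc)
  then have "exp (- (1 / t)) \<le> fact (Suc m) * t ^ Suc m"
    by (simp add: exp_minus field_simps del: fact_Suc)
  then show ?thesis using assms by (simp add: flat_def field_simps del: fact_Suc)
qed

lemma flat_has_derivative:
  "(flat m has_real_derivative flat (m + 2) t - real m * flat (Suc m) t) (at t)"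
proof -
  consider "t < 0" | "t = 0" | "t > 0" by linarith
  then show ?thesis
  proof cases
    case 1
    have "((\<lambda>_. 0) has_real_derivative 0) (at t)" by simp
    then have "(flat m has_real_derivative 0) (at t)"
      by (rule has_field_derivative_transform_within_open[of _ _ _ "{..<0}"]) (use 1
          in \<open>auto simp: flat_def\<close>)
    then show ?thesis using 1 by (simp add: flat_def)
  next
    case 2
    have "((\<lambda>h. flat m h / h) \<longlongrightarrow> 0) (at 0)"
    proof (rule Lim_null_comparison)
      show "\<forall>\<^sub>F h in at 0. norm (flat m h / h) \<le> fact (Suc (Suc m)) * \<bar>h\<bar>"
      proof (intro always_eventually allI)
        fix h :: real
        have "norm (flat m h / h) = (if h > 0 then flat (Suc m) h else 0)"
          by (auto simp: flat_def divide_simps)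
        then show "norm (flat m h / h) \<le> fact (Suc (Suc m)) * \<bar>h\<bar>"
          using flat_le_linear[of h "Suc m"]
          by (cases "h > 0") (auto simp del: fact_Suc simp: mult_nonneg_nonpos not_less)
      qed
      show "((\<lambda>h::real. fact (Suc (Suc m)) * \<bar>h\<bar>) \<longlongrightarrow> 0) (at 0)"
        by (intro tendsto_eq_intros | simp)+
    qed
    then have "(flat m has_real_derivative 0) (at 0)"
      by (simp add: has_field_derivative_iff flat_def)
    then show ?thesis using 2 by (simp add: flat_def)
  next
    case 3
    have "((\<lambda>t. exp (- (1 / t)) / t ^ m) has_real_derivative
         flat (m + 2) t - real m * flat (Suc m) t) (at t)"
      using 3
      apply (auto intro!: derivative_eq_intros simp: flat_def)
      apply (cases m)
       apply (auto simp: field_simps power2_eq_square)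
      done
    then show ?thesis
      by (rule has_field_derivative_transform_within_open[of _ _ _ "{0<..}"]) (use 3
          in \<open>auto simp: flat_def\<close>)
  qed
qed

text \<open>An algebra containing the radial bump of squared radius s, with generators chosen so
  that each directional derivative of a generator is again a member. Since \<open>C_k\<close> peels
  off one directional derivative at a time, this closure gives smoothness of every order without a
  formula for higher derivatives.\<close>

inductive_set bump_algebra :: "real \<Rightarrow> ('a::euclidean_space \<Rightarrow> real) set" for s where
  const: "(\<lambda>x. c) \<in> bump_algebra s"
| inner: "(\<lambda>x. x \<bullet> v) \<in> bump_algebra s"
| flat: "(\<lambda>x. flat m (s - x \<bullet> x)) \<in> bump_algebra s"
| add: "f \<in> bump_algebra s \<Longrightarrow> g \<in> bump_algebra s \<Longrightarrow> (\<lambda>x. f x + g x) \<in> bump_algebra s"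
| mult: "f \<in> bump_algebra s \<Longrightarrow> g \<in> bump_algebra s \<Longrightarrow> (\<lambda>x. f x * g x) \<in> bump_algebra s"

lemma bump_algebra_closed_derivative:
  assumes "f \<in> bump_algebra s"
  shows "\<exists>D. (\<forall>x. (f has_derivative D x) (at x)) \<and> (\<forall>v. (\<lambda>x. D x v) \<in> bump_algebra s)"
  using assms
proof induction
  case (const c)
  have "((\<lambda>x. c) has_derivative (\<lambda>v. 0)) (at x)" for x :: 'a by simp
  then show ?case using bump_algebra.const[of 0 s] by (intro exI[of _ "\<lambda>x v. 0"]) auto
next
  case (inner v)
  have "((\<lambda>x. x \<bullet> v) has_derivative (\<lambda>h. h \<bullet> v)) (at x)" for x :: 'a
    by (auto intro!: derivative_eq_intros)
  then show ?case using bump_algebra.const by (intro exI[of _ "\<lambda>x h. h \<bullet> v"]) auto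
next
  case (flat m)
  let ?D = "\<lambda>x h. (flat (m + 2) (s - x \<bullet> x) + (- real m) * flat (Suc m) (s - x \<bullet> x)) * ((-2) * (x \<bullet> h))"
  have "((\<lambda>x. flat m (s - x \<bullet> x)) has_derivative ?D x) (at x)" for x :: 'a
    apply (rule has_derivative_eq_rhs)
    apply (rule DERIV_compose_FDERIV[OF flat_has_derivative])
    apply (auto intro!: derivative_eq_intros simp: inner_commute algebra_simps)
    done
  moreover have "(\<lambda>x. ?D x h) \<in> bump_algebra s" for h
    by (intro bump_algebra.intros)
  ultimately show ?case by (intro exI[of _ ?D]) blast
next
  case (add f g)
  then obtain D E where D: "\<forall>x. (f has_derivative D x) (at x)" "\<forall>v. (\<lambda>x. D x v) \<in> bump_algebra s"
    and E: "\<forall>x. (g has_derivative E x) (at x)" "\<forall>v. (\<lambda>x. E x v) \<in> bump_algebra s" by blast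
  then show ?case
    by (intro exI[of _ "\<lambda>x h. D x h + E x h"]) (auto intro!: has_derivative_add bump_algebra.intros)
next
  case (mult f g)
  then obtain D E where D: "\<forall>x. (f has_derivative D x) (at x)" "\<forall>v. (\<lambda>x. D x v) \<in> bump_algebra s"
    and E: "\<forall>x. (g has_derivative E x) (at x)" "\<forall>v. (\<lambda>x. E x v) \<in> bump_algebra s" by blast
  then show ?case using mult.hyps
    by (intro exI[of _ "\<lambda>x h. f x * E x h + D x h * g x"]) (auto intro!: has_derivative_mult
        bump_algebra.intros)
qed

lemma linear_eq_sum_Basis:
  fixes f :: "'a::euclidean_space \<Rightarrow> real"
  assumes "linear f"
  shows "f v = (\<Sum>i\<in>Basis. (v \<bullet> i) * f i)"
proof -
  interpret linear f by (rule assms)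
  have "f v = f (\<Sum>i\<in>Basis. (v \<bullet> i) *\<^sub>R i)" by (simp add: euclidean_representation)
  then show ?thesis by (simp add: sum scaleR)
qed

lemma convolution_has_derivative:
  fixes f :: "'a::euclidean_space \<Rightarrow> real" and w :: "'a \<Rightarrow> real"
  assumes f: "\<And>x. (f has_derivative D x) (at x)"
    and D: "\<And>v. continuous_on UNIV (\<lambda>x. D x v)"
    and w: "continuous_on UNIV w"
  shows "((\<lambda>x. integral (cbox a b) (\<lambda>y. f (x - y) * w y)) has_derivative
          (\<lambda>v. integral (cbox a b) (\<lambda>y. D (x - y) v * w y))) (at x)"
proof -
  have cf: "continuous_on UNIV f"
    using f by (auto intro!: continuous_at_imp_continuous_on has_derivative_continuous)
  \<comment> \<open>\<open>leibniz_rule\<close> wants the derivative as a continuous map into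
    bounded linear functions, while only each directional derivative is assumed continuous; summing
    over the basis rebuilds the former from finitely many of the latter.\<close>
  define L where "L x t = w t *\<^sub>R (\<Sum>i\<in>Basis. D (x - t) i *\<^sub>R blinfun_inner_left i)" for x t :: 'a
  have L: "blinfun_apply (L x t) v = D (x - t) v * w t" for x t v
  proof -
    have "D (x - t) v = (\<Sum>i\<in>Basis. (v \<bullet> i) * D (x - t) i)"
      by (rule linear_eq_sum_Basis[OF has_derivative_linear[OF f]])
    then show ?thesis
      by (simp add: L_def blinfun.sum_left blinfun.scaleR_left inner_commute mult.commute)
  qed
  have contL: "continuous_on (UNIV \<times> cbox a b) (\<lambda>(x, t). L x t)"
  proof -
    have "continuous_on UNIV (\<lambda>z::'a\<times>'a. w (snd z))"
        "\<And>i. continuous_on UNIV (\<lambda>z::'a\<times>'a. D (fst z - snd z) i)"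
      by (rule continuous_on_compose2[OF w] continuous_on_compose2[OF D]; auto intro!: continuous_intros)+
    then have "continuous_on UNIV (\<lambda>z::'a\<times>'a. L (fst z) (snd z))"
      unfolding L_def by (intro continuous_intros)
    then show ?thesis by (auto simp: case_prod_beta intro: continuous_on_subset)
  qed
  have int1: "(\<lambda>y. f (x - y) * w y) integrable_on cbox a b" for x
    by (intro integrable_continuous continuous_intros continuous_on_compose2[OF cf]
        continuous_on_subset[OF w]) auto
  have "((\<lambda>x. integral (cbox a b) (\<lambda>y. f (x - y) * w y)) has_derivative integral (cbox a b) (L x)) (at x
      within UNIV)"
  proof (rule leibniz_rule[OF _ int1 contL])
    fix x t
    have "((\<lambda>x. f (x - t) * w t) has_derivative (\<lambda>v. D (x - t) v * w t)) (at x)"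
      by (intro has_derivative_mult_left has_derivative_compose[OF _ f, of "\<lambda>x. x - t" "\<lambda>v. v", simplified])
         (auto intro!: derivative_eq_intros)
    moreover have "blinfun_apply (L x t) = (\<lambda>v. D (x - t) v * w t)" using L by blast
    ultimately show "((\<lambda>x. f (x - t) * w t) has_derivative blinfun_apply (L x t)) (at x within UNIV)"
      by simp
  qed auto
  moreover have "blinfun_apply (integral (cbox a b) (L x))
      = (\<lambda>v. integral (cbox a b) (\<lambda>y. D (x - y) v * w y))"
  proof
    fix v
    have "continuous_on (cbox a b) (L x)"
      using continuous_on_compose2[OF contL, of "cbox a b" "\<lambda>t. (x, t)"]
      by (simp add: continuous_on_Pair image_subset_iff)
    then have "L x integrable_on cbox a b" by (rule integrable_continuous)
    then show "blinfun_apply (integral (cbox a b) (L x)) v = integral (cbox a b) (\<lambda>y. D (x - y) v * w y)"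
      using blinfun_apply_integral[of "L x" "cbox a b" v] by (simp add: L)
  qed
  ultimately show ?thesis by simp
qed


section \<open>Convexity of powers, averaging and mollification\<close>

lemma integrable_continuous_compact_support:
  fixes f :: "'a::euclidean_space \<Rightarrow> real"
  assumes "continuous_on UNIV f" "compact K" "\<And>x. x \<notin> K \<Longrightarrow> f x = 0"
  shows "integrable lborel f"
proof -
  have "integrable lborel (\<lambda>x. indicator K x *\<^sub>R f x)"
    by (intro borel_integrable_compact continuous_on_subset[OF assms(1)]) (use assms in auto)
  moreover have "(\<lambda>x. indicator K x *\<^sub>R f x) = f"
    using assms(3) by (auto simp: indicator_def fun_eq_iff)
  ultimately show ?thesis by simp
qed

lemma lborel_distr_reflect:
  fixes x :: "'a::euclidean_space"
  shows "distr lborel borel (\<lambda>y. x - y) = lborel"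
  using lborel_affine[of "-1" x] by (simp add: density_1)

lemma lborel_distr_translate:
  fixes x :: "'a::euclidean_space"
  shows "distr lborel borel (\<lambda>y. y - x) = lborel"
  using lborel_affine[of 1 "-x"] by (simp add: density_1)

lemma nn_integral_lborel_translate:
  fixes f :: "'a::euclidean_space \<Rightarrow> ennreal"
  assumes [measurable]: "f \<in> borel_measurable borel"
  shows "(\<integral>\<^sup>+ y. f (y - x) \<partial>lborel) = (\<integral>\<^sup>+ y. f y \<partial>lborel)"
  by (subst (2) lborel_distr_translate[of x, symmetric]) (simp add: nn_integral_distr)

lemma integral_lborel_reflect:
  fixes f :: "'a::euclidean_space \<Rightarrow> real"
  assumes [measurable]: "f \<in> borel_measurable borel"
  shows "(\<integral> y. f (x - y) \<partial>lborel) = (\<integral> y. f y \<partial>lborel)"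
  by (subst (2) lborel_distr_reflect[of x, symmetric]) (simp add: integral_distr)

lemma frac_energy_lborel:
  "frac_energy \<beta> p u =
     (\<integral>\<^sup>+ x. (\<integral>\<^sup>+ y. ennreal (\<bar>u y - u x\<bar> powr p / norm (y - x) powr \<beta>) \<partial>lborel) \<partial>lborel)"
  by (simp add: frac_energy_def nn_integral_completion)

lemma Lp_power_lborel: "Lp_power p u = (\<integral>\<^sup>+ x. ennreal (\<bar>u x\<bar> powr p) \<partial>lborel)"
  by (simp add: Lp_power_def nn_integral_completion)

text \<open>For r = p - 1 this is |t|^(p-2) t, the derivative of |t|^p / p.\<close>

definition signed_powr :: "real \<Rightarrow> real \<Rightarrow> real" where
  "signed_powr r t = sgn t * \<bar>t\<bar> powr r"

text \<open>The graph of |.|^p lies above its tangent at b. Young's inequality with exponents p and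
  p / (p - 1) gives this without differentiation and covers b = 0. It is the one convexity fact
  behind Jensen's inequality and behind all comparisons with competitors.\<close>

lemma powr_tangent:
  fixes a b p :: real
  assumes "1 < p"
  shows "\<bar>b\<bar> powr p + p * (signed_powr (p - 1) b * (a - b)) \<le> \<bar>a\<bar> powr p"
proof -
  have "\<bar>a\<bar> * \<bar>b\<bar> powr (p - 1) \<le> \<bar>a\<bar> powr p / p + (\<bar>b\<bar> powr (p - 1)) powr (p / (p - 1)) / (p / (p - 1))"
    by (rule Youngs_inequality) (use assms in \<open>auto simp: field_simps\<close>)
  also have "(\<bar>b\<bar> powr (p - 1)) powr (p / (p - 1)) = \<bar>b\<bar> powr p"
    using assms by (simp add: powr_powr)
  finally have "p * (\<bar>a\<bar> * \<bar>b\<bar> powr (p - 1)) \<le> \<bar>a\<bar> powr p + (p - 1) * \<bar>b\<bar> powr p"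
    using assms by (simp add: field_simps)
  moreover have "signed_powr (p - 1) b * a \<le> \<bar>a\<bar> * \<bar>b\<bar> powr (p - 1)"
  proof -
    have "sgn b * a \<le> \<bar>a\<bar>" by (auto simp: sgn_real_def)
    then show ?thesis
      using mult_right_mono[of "sgn b * a" "\<bar>a\<bar>" "\<bar>b\<bar> powr (p - 1)"]
          by (simp add: signed_powr_def algebra_simps)
  qed
  moreover have "signed_powr (p - 1) b * b = \<bar>b\<bar> powr p"
  proof (cases "b = 0")
    case False
    have "\<bar>b\<bar> powr p = \<bar>b\<bar> powr (p - 1) * \<bar>b\<bar> powr 1" by (simp only: powr_add[symmetric]) simp
    then have "\<bar>b\<bar> powr p = \<bar>b\<bar> powr (p - 1) * (sgn b * b)" using False by (auto simp: sgn_real_def)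
    then show ?thesis by (simp add: signed_powr_def)
  qed (simp add: signed_powr_def)
  ultimately have "p * (signed_powr (p - 1) b * a) \<le> \<bar>a\<bar> powr p + (p - 1) * \<bar>b\<bar> powr p"
     "signed_powr (p - 1) b * b = \<bar>b\<bar> powr p"
    using assms by (auto intro: order_trans[OF mult_left_mono])
  then show ?thesis by (simp add: algebra_simps)
qed

text \<open>Integrate the tangent inequality at the mean \<open>m\<close> against the density
  \<open>\<eta>\<close>; the linear term drops out because \<open>m\<close> is the mean.\<close>

lemma Jensen_powr:
  fixes \<eta> a :: "'a::euclidean_space \<Rightarrow> real"
  assumes "1 < p" and \<eta>: "continuous_on UNIV \<eta>" "compact K" "\<And>z. z \<notin> K \<Longrightarrow> \<eta> z = 0" "\<And>z. 0 \<le> \<eta> z"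
    "(\<integral> z. \<eta> z \<partial>lborel) = 1"
    and a: "continuous_on UNIV a"
  shows "ennreal (\<bar>\<integral> z. \<eta> z * a z \<partial>lborel\<bar> powr p) \<le> (\<integral>\<^sup>+ z. ennreal (\<eta> z * \<bar>a z\<bar> powr p) \<partial>lborel)"
proof -
  define m where "m = (\<integral> z. \<eta> z * a z \<partial>lborel)"
  define c where "c = p * signed_powr (p - 1) m"
  have I: "integrable lborel \<eta>" "integrable lborel (\<lambda>z. \<eta> z * a z)" "integrable lborel (\<lambda>z. \<eta> z * \<bar>a z\<bar>
      powr p)"
    by (rule integrable_continuous_compact_support[OF _ \<eta>(2)];
        use \<open>1 < p\<close> \<eta> a in \<open>auto intro!: continuous_intros continuous_on_powr'\<close>)+
  have "\<bar>m\<bar> powr p = (\<bar>m\<bar> powr p - c * m) * (\<integral> z. \<eta> z \<partial>lborel) + c * (\<integral> z. \<eta> z * a z \<partial>lborel)"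
    by (simp add: \<eta>(5) m_def)
  also have "\<dots> = (\<integral> z. (\<bar>m\<bar> powr p - c * m) * \<eta> z + c * (\<eta> z * a z) \<partial>lborel)"
    using I by simp
  also have "\<dots> \<le> (\<integral> z. \<eta> z * \<bar>a z\<bar> powr p \<partial>lborel)"
  proof (rule integral_mono)
    fix z
    have "\<eta> z * (\<bar>m\<bar> powr p + p * (signed_powr (p - 1) m * (a z - m))) \<le> \<eta> z * \<bar>a z\<bar> powr p"
      by (rule mult_left_mono[OF powr_tangent[OF \<open>1 < p\<close>] \<eta>(4)])
    then show "(\<bar>m\<bar> powr p - c * m) * \<eta> z + c * (\<eta> z * a z) \<le> \<eta> z * \<bar>a z\<bar> powr p"
      by (simp add: c_def algebra_simps)
  qed (use I in auto)
  finally have "\<bar>m\<bar> powr p \<le> (\<integral> z. \<eta> z * \<bar>a z\<bar> powr p \<partial>lborel)" .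
  then show ?thesis
    using I(3) \<eta>(4) by (subst nn_integral_eq_integral) (auto simp: m_def intro: ennreal_leI)
qed

text \<open>Every translate of \<open>w\<close> has the same energy, since the kernel depends on y -
  x only. Jensen's inequality inside the integrand and Fubini then bound the energy of the average
  by the average of these equal energies.\<close>

lemma frac_energy_average_le:
  fixes \<eta> w :: "'a::euclidean_space \<Rightarrow> real"
  assumes "1 < p" and \<eta>: "continuous_on UNIV \<eta>" "compact K" "\<And>z. z \<notin> K \<Longrightarrow> \<eta> z = 0" "\<And>z. 0 \<le> \<eta> z"
    "(\<integral> z. \<eta> z \<partial>lborel) = 1"
    and w: "continuous_on UNIV w"
    and W: "\<And>x. W x = (\<integral> z. \<eta> z * w (x - z) \<partial>lborel)"
  shows "frac_energy \<beta> p W \<le> frac_energy \<beta> p w"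
proof -
  have [measurable]: "\<eta> \<in> borel_measurable borel" "w \<in> borel_measurable borel"
    using \<eta>(1) w by (auto intro: borel_measurable_continuous_onI)
  define G where "G x y = ennreal (\<bar>w y - w x\<bar> powr p / norm (y - x) powr \<beta>)" for x y
  have [measurable]: "case_prod G \<in> borel_measurable (borel \<Otimes>\<^sub>M borel)"
    unfolding G_def case_prod_beta by measurable
  have sh: "continuous_on UNIV (\<lambda>z. w (x - z))" for x
    by (intro continuous_on_compose2[OF w] continuous_intros) auto
  have int: "integrable lborel (\<lambda>z. \<eta> z * w (x - z))" for x
    by (rule integrable_continuous_compact_support[OF _ \<eta>(2)]) (use \<eta> sh
        in \<open>auto intro!: continuous_intros\<close>)
  have bound: "ennreal (\<bar>W y - W x\<bar> powr p / norm (y - x) powr \<beta>)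
      \<le> (\<integral>\<^sup>+ z. ennreal (\<eta> z) * G (x - z) (y - z) \<partial>lborel)" for x y
  proof -
    have "W y - W x = (\<integral> z. \<eta> z * (w (y - z) - w (x - z)) \<partial>lborel)"
      using int by (simp add: W algebra_simps)
    then have "ennreal (\<bar>W y - W x\<bar> powr p) \<le> (\<integral>\<^sup>+ z. ennreal (\<eta> z * \<bar>w (y - z) - w (x - z)\<bar> powr p)
        \<partial>lborel)"
      using Jensen_powr[OF \<open>1 < p\<close> \<eta>, of "\<lambda>z. w (y - z) - w (x - z)"] continuous_on_diff[OF sh sh] by auto
    then have "ennreal (\<bar>W y - W x\<bar> powr p) * ennreal (1 / norm (y - x) powr \<beta>) \<le>
        (\<integral>\<^sup>+ z. ennreal (\<eta> z * \<bar>w (y - z) - w (x - z)\<bar> powr p) \<partial>lborel) * ennreal (1 / norm (y - x) powr \<beta>)"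
      by (rule mult_right_mono) simp
    also have "\<dots> = (\<integral>\<^sup>+ z. ennreal (\<eta> z * \<bar>w (y - z) - w (x - z)\<bar> powr p) * ennreal (1 / norm (y - x)
        powr \<beta>) \<partial>lborel)"
      by (rule nn_integral_multc[symmetric]) measurable
    also have "\<dots> = (\<integral>\<^sup>+ z. ennreal (\<eta> z) * G (x - z) (y - z) \<partial>lborel)"
      using \<eta>(4) by (intro nn_integral_cong) (simp add: G_def flip: ennreal_mult)
    finally show ?thesis by (simp flip: ennreal_mult)
  qed
  have "frac_energy \<beta> p W \<le> (\<integral>\<^sup>+ x. (\<integral>\<^sup>+ y. (\<integral>\<^sup>+ z. ennreal (\<eta> z) * G (x - z) (y - z) \<partial>lborel) \<partial>lborel)
      \<partial>lborel)"
    unfolding frac_energy_lborel by (intro nn_integral_mono bound)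
  also have "\<dots> = (\<integral>\<^sup>+ x. (\<integral>\<^sup>+ z. (\<integral>\<^sup>+ y. ennreal (\<eta> z) * G (x - z) (y - z) \<partial>lborel) \<partial>lborel) \<partial>lborel)"
    by (intro nn_integral_cong lborel_pair.Fubini') measurable
  also have "\<dots> = (\<integral>\<^sup>+ z. (\<integral>\<^sup>+ x. (\<integral>\<^sup>+ y. ennreal (\<eta> z) * G (x - z) (y - z) \<partial>lborel) \<partial>lborel) \<partial>lborel)"
    by (intro lborel_pair.Fubini') measurable
  also have "\<dots> = (\<integral>\<^sup>+ z. ennreal (\<eta> z) * frac_energy \<beta> p w \<partial>lborel)"
  proof (intro nn_integral_cong)
    fix z
    have "(\<integral>\<^sup>+ x. (\<integral>\<^sup>+ y. ennreal (\<eta> z) * G (x - z) (y - z) \<partial>lborel) \<partial>lborel)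
        = (\<integral>\<^sup>+ x. ennreal (\<eta> z) * (\<integral>\<^sup>+ y. G (x - z) (y - z) \<partial>lborel) \<partial>lborel)"
      by (intro nn_integral_cong nn_integral_cmult) measurable
    also have "\<dots> = ennreal (\<eta> z) * (\<integral>\<^sup>+ x. (\<integral>\<^sup>+ y. G (x - z) (y - z) \<partial>lborel) \<partial>lborel)"
      by (intro nn_integral_cmult) measurable
    also have "(\<integral>\<^sup>+ x. (\<integral>\<^sup>+ y. G (x - z) (y - z) \<partial>lborel) \<partial>lborel)
        = (\<integral>\<^sup>+ x. (\<integral>\<^sup>+ y. G (x - z) y \<partial>lborel) \<partial>lborel)"
      by (intro nn_integral_cong nn_integral_lborel_translate) measurable
    also have "\<dots> = (\<integral>\<^sup>+ x. (\<integral>\<^sup>+ y. G x y \<partial>lborel) \<partial>lborel)"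
      by (intro nn_integral_lborel_translate) measurable
    finally show "(\<integral>\<^sup>+ x. (\<integral>\<^sup>+ y. ennreal (\<eta> z) * G (x - z) (y - z) \<partial>lborel) \<partial>lborel)
        = ennreal (\<eta> z) * frac_energy \<beta> p w"
      by (simp add: G_def frac_energy_lborel)
  qed
  also have "\<dots> = (\<integral>\<^sup>+ z. ennreal (\<eta> z) \<partial>lborel) * frac_energy \<beta> p w"
    by (intro nn_integral_multc) measurable
  also have "(\<integral>\<^sup>+ z. ennreal (\<eta> z) \<partial>lborel) = 1"
    using \<eta>(4,5) integrable_continuous_compact_support[OF \<eta>(1-3)] by (subst nn_integral_eq_integral) auto
  finally show ?thesis by simp
qed


lemma uniform_modulus_compact_support:
  fixes w :: "'a::euclidean_space \<Rightarrow> real"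
  assumes w: "continuous_on UNIV w" and S: "compact S" "\<And>x. x \<notin> S \<Longrightarrow> w x = 0" and "0 < e"
  obtains d where "0 < d" "\<And>x y. norm (x - y) < d \<Longrightarrow> \<bar>w x - w y\<bar> < e"
proof -
  define K where "K = (\<Union>x\<in>S. \<Union>y\<in>cball 0 1. {x + y})"
  have "compact K" unfolding K_def by (intro compact_sums' S compact_cball)
  then have "uniformly_continuous_on K w"
    by (intro compact_uniformly_continuous continuous_on_subset[OF w]) auto
  then obtain d where d: "d > 0" "\<And>x y. x \<in> K \<Longrightarrow> y \<in> K \<Longrightarrow> dist y x < d \<Longrightarrow> dist (w y) (w x) < e"
    using \<open>0 < e\<close> unfolding uniformly_continuous_on_def by metis
  have K: "z \<in> K" if "x \<in> S" "norm (z - x) \<le> 1" for x z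
    unfolding K_def using that by (intro UN_I[of x] UN_I[of "z - x"]) auto
  show ?thesis
  proof (rule that[of "min d 1"])
    fix x y :: 'a assume xy: "norm (x - y) < min d 1"
    show "\<bar>w x - w y\<bar> < e"
    proof (cases "x \<in> S \<or> y \<in> S")
      case True
      then have "x \<in> K \<and> y \<in> K"
        using K[of x x] K[of x y] K[of y x] K[of y y] xy by (auto simp: norm_minus_commute)
      then show ?thesis using d(2)[of y x] xy by (auto simp: dist_norm)
    next
      case False
      then show ?thesis using S(2) \<open>0 < e\<close> by auto
    qed
  qed (use d in auto)
qed

lemma mollification:
  fixes w :: "'a::euclidean_space \<Rightarrow> real"
  assumes "open \<Omega>" "1 < p" "0 < e"
    and w: "continuous_on UNIV w" and S: "compact S" "S \<subseteq> \<Omega>" "\<And>x. x \<notin> S \<Longrightarrow> w x = 0"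
  obtains W where "W \<in> Cc_infty \<Omega>" "\<And>x. \<bar>W x - w x\<bar> \<le> e" "frac_energy \<beta> p W \<le> frac_energy \<beta> p w"
proof -
  obtain d1 where d1: "0 < d1" "\<And>x y. norm (x - y) < d1 \<Longrightarrow> \<bar>w x - w y\<bar> < e"
    using uniform_modulus_compact_support[OF w S(1,3) \<open>0 < e\<close>] by metis
  obtain d2 where d2: "0 < d2" "(\<Union>x\<in>S. ball x d2) \<subseteq> \<Omega>"
    using compact_subset_open_imp_ball_epsilon_subset[OF S(1) \<open>open \<Omega>\<close> S(2)] by metis
  \<comment> \<open>Below \<open>d1\<close> for the uniform error, below \<open>d2\<close> so that
    the thickened support stays in \<open>\<Omega>\<close>.\<close>
  define d where "d = min d1 d2 / 2"
  have d: "0 < d" "d < d1" "d < d2" using d1(1) d2(1) by (auto simp: d_def)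
  define h where "h = (\<lambda>x::'a. flat 0 (d\<^sup>2 - x \<bullet> x))"
  have h_alg: "h \<in> bump_algebra (d\<^sup>2)" unfolding h_def by (rule bump_algebra.flat)
  have cont_alg: "continuous_on UNIV f" if "f \<in> bump_algebra s" for f :: "'a \<Rightarrow> real" and s
    using C_k_of_closed_class[OF bump_algebra_closed_derivative that, of 0] by simp
  have h0: "h z = 0" if "z \<notin> cball 0 d" for z
  proof -
    have "d\<^sup>2 < (norm z)\<^sup>2" using that d by (intro power_strict_mono) auto
    then show ?thesis by (simp add: h_def flat_def power2_norm_eq_inner)
  qed
  have hint: "integrable lborel h"
    by (rule integrable_continuous_compact_support[OF cont_alg[OF h_alg] compact_cball h0])
  define I where "I = (\<integral> z. h z \<partial>lborel)"
  have hnn: "0 \<le> h z" for z by (simp add: h_def flat_nonneg)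
  have "I \<noteq> 0"
  proof
    assume "I = 0"
    then have "AE z in lborel. h z = 0"
      using integral_nonneg_eq_0_iff_AE[OF hint] hnn by (auto simp: I_def)
    then have "{z. h z \<noteq> 0} \<in> null_sets lborel"
      using AE_iff_null_sets[of "{z. h z \<noteq> 0}" lborel] borel_measurable_continuous_onI[OF cont_alg[OF
          h_alg]] by simp
    moreover have "ball 0 d \<subseteq> {z. h z \<noteq> 0}"
    proof
      fix z :: 'a assume "z \<in> ball 0 d"
      then have "(norm z)\<^sup>2 < d\<^sup>2" by (intro power_strict_mono) auto
      then show "z \<in> {z. h z \<noteq> 0}" by (simp add: h_def flat_def power2_norm_eq_inner)
    qed
    ultimately have "ball (0::'a) d \<in> null_sets lborel"
      using null_sets_subset[of "{z. h z \<noteq> 0}" lborel "ball 0 d"] by simp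
    then have "measure lborel (ball (0::'a) d) = 0" by (rule measure_eq_0_null_sets)
    then show False using d(1) by simp
  qed
  moreover have "0 \<le> I" unfolding I_def by (intro Bochner_Integration.integral_nonneg hnn)
  ultimately have "0 < I" by simp
  define \<eta> where "\<eta> = (\<lambda>z. (1 / I) * h z)"
  have \<eta>_alg: "\<eta> \<in> bump_algebra (d\<^sup>2)" unfolding \<eta>_def by (intro bump_algebra.mult bump_algebra.const h_alg)
  have \<eta>: "continuous_on UNIV \<eta>" "compact (cball (0::'a) d)" "\<And>z. z \<notin> cball 0 d \<Longrightarrow> \<eta> z = 0"
      "\<And>z. 0 \<le> \<eta> z" "(\<integral> z. \<eta> z \<partial>lborel) = 1"
    using cont_alg[OF \<eta>_alg] h0 hnn \<open>0 < I\<close> by (auto simp: \<eta>_def I_def[symmetric])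
  define W where "W x = (\<integral> z. \<eta> z * w (x - z) \<partial>lborel)" for x
  obtain a where a: "S \<subseteq> cbox (-a) a"
    using bounded_subset_cbox_symmetric[OF compact_imp_bounded[OF S(1)]] by metis
  have [measurable]: "\<eta> \<in> borel_measurable borel" "w \<in> borel_measurable borel"
    using \<eta>(1) w by (auto intro: borel_measurable_continuous_onI)
  \<comment> \<open>The convolution is rewritten with x in the smooth factor and over one box
    containing the support of \<open>w\<close>, so that derivatives fall on \<open>\<eta>\<close>
    and the domain of integration does not move with x.\<close>
  have W_conv: "W x = integral (cbox (-a) a) (\<lambda>y. \<eta> (x - y) * w y)" for x
  proof -
    have "integral (cbox (-a) a) (\<lambda>y. \<eta> (x - y) * w y) = integral UNIV (\<lambda>y. if y \<in> cbox (-a) a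
        then \<eta> (x - y) * w y else 0)"
      by (rule Henstock_Kurzweil_Integration.integral_restrict_UNIV[symmetric])
    also have "(\<lambda>y. if y \<in> cbox (-a) a then \<eta> (x - y) * w y else 0) = (\<lambda>y. \<eta> (x - y) * w y)"
      using a S(3) by (auto simp: fun_eq_iff)
    also have "integral UNIV \<dots> = (\<integral> y. \<eta> (x - y) * w y \<partial>lborel)"
      by (intro integral_lborel integrable_continuous_compact_support[OF _ S(1)] continuous_intros
          continuous_on_compose2[OF \<eta>(1)] w) (auto simp: S(3))
    also have "\<dots> = W x"
      using integral_lborel_reflect[of "\<lambda>z. \<eta> z * w (x - z)" x] by (simp add: W_def)
    finally show ?thesis ..
  qed
  \<comment> \<open>Convolutions of \<open>w\<close> with members of the bump algebra: a directional
    derivative just differentiates the smooth factor, so this class is closed as well, and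
    \<open>W\<close> belongs to it.\<close>
  define C where "C = {g. \<exists>f\<in>bump_algebra (d\<^sup>2). g = (\<lambda>x. integral (cbox (-a) a) (\<lambda>y. f (x - y) * w y))}"
  have C_closed: "\<exists>D. (\<forall>x. (g has_derivative D x) (at x)) \<and> (\<forall>v. (\<lambda>x. D x v) \<in> C)" if gC: "g \<in> C" for g
  proof -
    obtain f where f: "f \<in> bump_algebra (d\<^sup>2)" "g = (\<lambda>x. integral (cbox (-a) a) (\<lambda>y. f (x - y) * w y))"
      using gC unfolding C_def by blast
    obtain D where D: "\<And>x. (f has_derivative D x) (at x)" "\<And>v. (\<lambda>x. D x v) \<in> bump_algebra (d\<^sup>2)"
      using bump_algebra_closed_derivative[OF f(1)] by blast
    show ?thesis
    proof (intro exI[of _ "\<lambda>x v. integral (cbox (- a) a) (\<lambda>y. D (x - y) v * w y)"] conjI allI)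
      show "(g has_derivative (\<lambda>v. integral (cbox (- a) a) (\<lambda>y. D (x - y) v * w y))) (at x)" for x
        unfolding f(2) by (rule convolution_has_derivative[OF D(1) cont_alg[OF D(2)] w])
      show "(\<lambda>x. integral (cbox (- a) a) (\<lambda>y. D (x - y) v * w y)) \<in> C" for v
        unfolding C_def using D(2)[of v] by (intro CollectI bexI[of _ "\<lambda>x. D x v"]) auto
    qed
  qed
  have "W \<in> C" using \<eta>_alg W_conv unfolding C_def by blast
  then have smooth: "C_k k W" for k
    using C_k_of_closed_class[where S = C, OF C_closed] by blast
  define K where "K = (\<Union>x\<in>S. \<Union>y\<in>cball 0 d. {x + y})"
  have "compact K" unfolding K_def by (intro compact_sums' S compact_cball)
  have "K \<subseteq> \<Omega>"
  proof
    fix z assume "z \<in> K"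
    then obtain x y where "x \<in> S" "norm y \<le> d" "z = x + y" by (auto simp: K_def)
    then have "z \<in> ball x d2" using d by (simp add: dist_norm)
    then show "z \<in> \<Omega>" using d2(2) \<open>x \<in> S\<close> by blast
  qed
  have W0: "W x = 0" if "x \<notin> K" for x
  proof -
    have "\<eta> z * w (x - z) = 0" for z
    proof (rule ccontr)
      assume "\<eta> z * w (x - z) \<noteq> 0"
      then have "z \<in> cball 0 d" "x - z \<in> S" using \<eta>(3) S(3) by fastforce+
      then have "x \<in> K" unfolding K_def by (intro UN_I[of "x - z"] UN_I[of z]) auto
      then show False using that by simp
    qed
    then have "(\<lambda>z. \<eta> z * w (x - z)) = (\<lambda>z. 0)" by blast
    then show ?thesis unfolding W_def by simp
  qed
  have "supp W \<subseteq> K"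
    unfolding supp_def using W0 compact_imp_closed[OF \<open>compact K\<close>] by (intro closure_minimal) auto
  then have "compact (supp W)" "supp W \<subseteq> \<Omega>"
    using \<open>compact K\<close> \<open>K \<subseteq> \<Omega>\<close> by (auto simp: supp_def compact_eq_bounded_closed intro: bounded_subset)
  then have "W \<in> Cc_infty \<Omega>" using smooth by (simp add: Cc_infty_def)
  moreover have "\<bar>W x - w x\<bar> \<le> e" for x
  proof -
    have sh: "continuous_on UNIV (\<lambda>z. w (x - z))"
      by (intro continuous_on_compose2[OF w] continuous_intros) auto
    have int: "integrable lborel (\<lambda>z. \<eta> z * w (x - z))" "integrable lborel \<eta>" "integrable lborel (\<lambda>z. \<eta>
        z * (w (x - z) - w x))"
      by (rule integrable_continuous_compact_support[OF _ \<eta>(2)]; use \<eta> sh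
          in \<open>auto intro!: continuous_intros\<close>)+
    have "W x - w x = (\<integral> z. \<eta> z * w (x - z) \<partial>lborel) - (\<integral> z. \<eta> z * w x \<partial>lborel)"
      using \<eta>(5) by (simp add: W_def)
    also have "\<dots> = (\<integral> z. \<eta> z * (w (x - z) - w x) \<partial>lborel)"
      using int by (simp add: algebra_simps)
    also have "\<bar>\<dots>\<bar> \<le> (\<integral> z. e * \<eta> z \<partial>lborel)"
      unfolding real_norm_def[symmetric]
    proof (rule Bochner_Integration.integral_norm_bound_integral)
      fix z
      show "norm (\<eta> z * (w (x - z) - w x)) \<le> e * \<eta> z"
      proof (cases "z \<in> cball 0 d")
        case True
        then have "\<bar>w (x - z) - w x\<bar> \<le> e" using d1(2)[of "x - z" x] d by auto
        then show ?thesis using \<eta>(4)[of z] by (simp add: abs_mult mult.commute[of e] mult_left_mono)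
      qed (use \<eta>(3) in auto)
    qed (use int in auto)
    finally show ?thesis using \<eta>(5) by simp
  qed
  moreover have "frac_energy \<beta> p W \<le> frac_energy \<beta> p w"
    by (rule frac_energy_average_le[OF \<open>1 < p\<close> \<eta> w W_def])
  ultimately show ?thesis by (rule that)
qed


section \<open>The eigenvalue as a lower bound over continuous competitors\<close>

lemma first_eigenvalue_mult_le:
  assumes "W \<in> Cc_infty \<Omega>"
  shows "first_eigenvalue \<alpha> p \<Omega> * Lp_power p W \<le> frac_energy (\<alpha> * p) p W"
proof (cases "Lp_power p W = 0 \<or> (\<forall>x. W x = 0)")
  case True
  then have "Lp_power p W = 0" by (auto simp: Lp_power_def)
  then show ?thesis by simp
next
  case False
  then have le: "first_eigenvalue \<alpha> p \<Omega> \<le> rayleigh \<alpha> p W"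
    using assms unfolding first_eigenvalue_def by (intro INF_lower) auto
  show ?thesis
  \<comment> \<open>For infinite mass the \<open>ennreal\<close> quotient is 0, which forces the
    eigenvalue to be 0; cancelling the denominator is legal only in the other case.\<close>
  proof (cases "Lp_power p W = \<infinity>")
    case True
    then show ?thesis using le by (simp add: rayleigh_def ennreal_divide_top)
  next
    case fin: False
    have "first_eigenvalue \<alpha> p \<Omega> * Lp_power p W \<le> frac_energy (\<alpha> * p) p W / Lp_power p W * Lp_power p W"
      using le unfolding rayleigh_def by (rule mult_right_mono) simp
    also have "\<dots> = frac_energy (\<alpha> * p) p W"
      using False fin by (simp add: ennreal_divide_times less_top)
    finally show ?thesis .
  qed
qed

lemma frac_energy_mono:
  assumes "\<And>x y. \<bar>f y - f x\<bar> \<le> \<bar>g y - g x\<bar>" "0 \<le> p"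
  shows "frac_energy \<beta> p f \<le> frac_energy \<beta> p g"
  unfolding frac_energy_lborel
  by (intro nn_integral_mono ennreal_leI divide_right_mono powr_mono2 assms) auto

text \<open>Truncating \<open>w\<close> to \<open>(w - e)\<^sup>+\<close> gives compact support in \<open>\<Omega>\<close> whatever its boundary looks like,
  and both truncation and mollification decrease the energy.\<close>

lemma first_eigenvalue_le_continuous:
  fixes w :: "'a::euclidean_space \<Rightarrow> real"
  assumes \<Omega>: "open \<Omega>" "bounded \<Omega>" and "1 < p" "0 \<le> c" "ennreal c \<le> first_eigenvalue \<alpha> p \<Omega>"
    and w: "continuous_on UNIV w" "\<And>x. 0 \<le> w x" "\<And>x. x \<notin> \<Omega> \<Longrightarrow> w x = 0"
  shows "ennreal c * Lp_power p w \<le> frac_energy (\<alpha> * p) p w"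
proof -
  have approx: "\<exists>W. W \<in> Cc_infty \<Omega> \<and> (\<forall>x. \<bar>W x - w x\<bar> \<le> 2 * e) \<and> frac_energy (\<alpha> * p) p W
      \<le> frac_energy (\<alpha> * p) p w"
    if e: "0 < e" for e
  proof -
    define v where "v x = max (w x - e) 0" for x
    have "closed {x. e \<le> w x}" by (intro closed_Collect_le w continuous_intros)
    moreover have sub: "{x. e \<le> w x} \<subseteq> \<Omega>" using w(3) that by force
    ultimately have "compact {x. e \<le> w x}"
      using \<Omega>(2) by (auto simp: compact_eq_bounded_closed intro: bounded_subset)
    moreover have "continuous_on UNIV v" unfolding v_def by (intro continuous_intros w)
    moreover have "v x = 0" if "x \<notin> {x. e \<le> w x}" for x using that by (auto simp: v_def)
    ultimately obtain W where W: "W \<in> Cc_infty \<Omega>" "\<And>x. \<bar>W x - v x\<bar> \<le> e"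
        "frac_energy (\<alpha> * p) p W \<le> frac_energy (\<alpha> * p) p v"
      using mollification[OF \<Omega>(1) \<open>1 < p\<close> e _ _ sub, of v] by metis
    moreover have "frac_energy (\<alpha> * p) p v \<le> frac_energy (\<alpha> * p) p w"
      by (rule frac_energy_mono) (use \<open>1 < p\<close> in \<open>auto simp: v_def\<close>)
    moreover have "\<bar>W x - w x\<bar> \<le> 2 * e" for x
      using W(2)[of x] w(2)[of x] that by (auto simp: v_def max_def split: if_splits)
    ultimately show ?thesis using order_trans by blast
  qed
  have "\<forall>j. \<exists>W. W \<in> Cc_infty \<Omega> \<and> (\<forall>x. \<bar>W x - w x\<bar> \<le> 2 * (1 / real (Suc j))) \<and> frac_energy (\<alpha> * p) p W
      \<le> frac_energy (\<alpha> * p) p w"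
    by (intro allI approx) simp
  then obtain W where W: "\<And>j. W j \<in> Cc_infty \<Omega>" "\<And>j x. \<bar>W j x - w x\<bar> \<le> 2 * (1 / real (Suc j))"
      "\<And>j. frac_energy (\<alpha> * p) p (W j) \<le> frac_energy (\<alpha> * p) p w"
    by metis
  have [measurable]: "W j \<in> borel_measurable borel" for j
  proof -
    have "C_k 0 (W j)" using W(1)[of j] unfolding Cc_infty_def by blast
    then show ?thesis by (auto intro: borel_measurable_continuous_onI)
  qed
  have [measurable]: "w \<in> borel_measurable borel" using w by (auto intro: borel_measurable_continuous_onI)
  have lim: "(\<lambda>j. ennreal (c * \<bar>W j x\<bar> powr p)) \<longlonglongrightarrow> ennreal (c * \<bar>w x\<bar> powr p)" for x
  proof -
    have "(\<lambda>j. W j x - w x) \<longlonglongrightarrow> 0"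
    proof (rule Lim_null_comparison)
      show "\<forall>\<^sub>F j in sequentially. norm (W j x - w x) \<le> 2 * (1 / real (Suc j))" using W(2) by simp
      show "(\<lambda>j. 2 * (1 / real (Suc j))) \<longlonglongrightarrow> 0"
        using LIMSEQ_inverse_real_of_nat by (auto intro!: tendsto_eq_intros simp: divide_inverse simp
            del: of_nat_Suc)
    qed
    then have "(\<lambda>j. W j x) \<longlonglongrightarrow> w x" by (simp add: LIM_zero_iff)
    then show ?thesis
      using \<open>1 < p\<close> by (intro tendsto_ennrealI tendsto_mult tendsto_const tendsto_powr' tendsto_rabs) auto
  qed
  have cLp: "ennreal c * Lp_power p v = (\<integral>\<^sup>+ x. ennreal (c * \<bar>v x\<bar> powr p) \<partial>lborel)"
    if [measurable]: "v \<in> borel_measurable borel" for v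
    using \<open>0 \<le> c\<close> unfolding Lp_power_lborel by (subst nn_integral_cmult[symmetric]) (auto simp:
        ennreal_mult)
  \<comment> \<open>Fatou's lemma is needed for the mass only: each energy is already bounded by the
    energy of \<open>w\<close>, so no convergence of energies enters.\<close>
  have "ennreal c * Lp_power p w = (\<integral>\<^sup>+ x. liminf (\<lambda>j. ennreal (c * \<bar>W j x\<bar> powr p)) \<partial>lborel)"
    by (simp add: cLp lim_imp_Liminf[OF _ lim])
  also have "\<dots> \<le> liminf (\<lambda>j. \<integral>\<^sup>+ x. ennreal (c * \<bar>W j x\<bar> powr p) \<partial>lborel)"
    by (rule nn_integral_liminf) simp
  also have "\<dots> = liminf (\<lambda>j. ennreal c * Lp_power p (W j))"
    by (simp add: cLp)
  also have "\<dots> \<le> frac_energy (\<alpha> * p) p w"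
  proof (rule Liminf_le)
    have "ennreal c * Lp_power p (W j) \<le> frac_energy (\<alpha> * p) p w" for j
      using mult_right_mono[OF assms(5), of "Lp_power p (W j)"] first_eigenvalue_mult_le[OF W(1), of \<alpha> p
          j] W(3)[of j]
      by (meson order_trans zero_le)
    then show "\<forall>\<^sub>F j in sequentially. ennreal c * Lp_power p (W j) \<le> frac_energy (\<alpha> * p) p w" by simp
  qed simp
  finally show ?thesis .
qed

section \<open>A fractional Morrey inequality\<close>

text \<open>Each function exceeds three times its mean bound on at most a third of the ball, so the
  two exceptional sets cannot cover it. Two functions are controlled at once because each new point
  of the chain below has to be good for its own inner integral and also relative to its
  predecessor.\<close>

lemma markov_pick:
  fixes g1 g2 :: "'a::euclidean_space \<Rightarrow> ennreal"
  assumes [measurable]: "g1 \<in> borel_measurable borel" "g2 \<in> borel_measurable borel"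
    and g: "(\<integral>\<^sup>+ z. g1 z \<partial>lborel) \<le> ennreal e1" "(\<integral>\<^sup>+ z. g2 z \<partial>lborel) \<le> ennreal e2"
    and pos: "0 < e1" "0 < e2" "0 < r"
  obtains z where "z \<in> ball x r" "g1 z \<le> ennreal (3 * e1 / measure lborel (ball x r))"
    "g2 z \<le> ennreal (3 * e2 / measure lborel (ball x r))"
proof -
  define v where "v = measure lborel (ball x r)"
  have v: "0 < v" "emeasure lborel (ball x r) = ennreal v"
    using pos emeasure_lborel_ball_finite[of x r] by (auto simp: v_def emeasure_eq_ennreal_measure)
  have [measurable]: "ball x r \<in> sets borel" by simp
  have bad: "emeasure lborel {z \<in> ball x r. \<not> g z \<le> ennreal (3 * e / v)} \<le> ennreal (v / 3)"
    if [measurable]: "g \<in> borel_measurable borel" and g: "(\<integral>\<^sup>+ z. g z \<partial>lborel) \<le> ennreal e" and "0 < e"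
        for g e
  proof -
    have "emeasure lborel {z \<in> ball x r. \<not> g z \<le> ennreal (3 * e / v)} \<le> emeasure lborel {z \<in> ball x r. 1
        \<le> ennreal (v / (3 * e)) * g z}"
    proof (intro emeasure_mono subsetI; clarsimp)
      fix z assume "\<not> g z \<le> ennreal (3 * e / v)"
      then have "ennreal (v / (3 * e)) * ennreal (3 * e / v) \<le> ennreal (v / (3 * e)) * g z"
        by (intro mult_left_mono) auto
      then show "1 \<le> ennreal (v / (3 * e)) * g z"
        using v(1) \<open>0 < e\<close> by (simp flip: ennreal_mult)
    qed
    also have "\<dots> \<le> ennreal (v / (3 * e)) * (\<integral>\<^sup>+ z. g z * indicator (ball x r) z \<partial>lborel)"
      by (rule nn_integral_Markov_inequality) simp_all
    also have "\<dots> \<le> ennreal (v / (3 * e)) * (\<integral>\<^sup>+ z. g z \<partial>lborel)"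
      by (intro mult_left_mono nn_integral_mono) (auto simp: indicator_def)
    also have "\<dots> \<le> ennreal (v / (3 * e)) * ennreal e"
      by (intro mult_left_mono g) auto
    also have "\<dots> = ennreal (v / 3)" using v(1) \<open>0 < e\<close> by (simp flip: ennreal_mult)
    finally show ?thesis .
  qed
  have "\<exists>z\<in>ball x r. g1 z \<le> ennreal (3 * e1 / v) \<and> g2 z \<le> ennreal (3 * e2 / v)"
  proof (rule ccontr)
    assume "\<not> ?thesis"
    then have "ball x r \<subseteq> {z \<in> ball x r. \<not> g1 z \<le> ennreal (3 * e1 / v)} \<union> {z \<in> ball x r. \<not> g2 z
        \<le> ennreal (3 * e2 / v)}"
      by blast
    then have "ennreal v \<le> emeasure lborel ({z \<in> ball x r. \<not> g1 z
        \<le> ennreal (3 * e1 / v)} \<union> {z \<in> ball x r. \<not> g2 z \<le> ennreal (3 * e2 / v)})"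
      unfolding v(2)[symmetric] by (intro emeasure_mono) auto
    also have "\<dots> \<le> emeasure lborel {z \<in> ball x r. \<not> g1 z
        \<le> ennreal (3 * e1 / v)} + emeasure lborel {z \<in> ball x r. \<not> g2 z \<le> ennreal (3 * e2 / v)}"
      by (intro emeasure_subadditive) auto
    also have "\<dots> \<le> ennreal (v / 3) + ennreal (v / 3)"
      using bad[OF assms(1) g(1) pos(1)] bad[OF assms(2) g(2) pos(2)] by (rule add_mono)
    also have "\<dots> = ennreal (2 * v / 3)" using v(1) by (simp flip: ennreal_plus)
    finally show False using v(1) by (simp add: ennreal_le_iff)
  qed
  then show ?thesis using that by (auto simp: v_def)
qed

lemma powr_le_self_ge_1:
  fixes D q :: real
  assumes "1 \<le> D" "q \<le> 1"
  shows "D powr q \<le> D"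
  using powr_mono[of q 1 D] assms by simp

text \<open>Chain of points \<open>z\<^sub>k \<rightarrow> x\<close>, \<open>z\<^sub>k \<in> ball x (r / 2\<^sup>k)\<close>, picked by Markov's inequality instead of
  averaging over balls.\<close>

lemma Morrey_chain:
  fixes f :: "'a::euclidean_space \<Rightarrow> real" and \<alpha> p e r :: real
  defines "n \<equiv> real DIM('a)"
  defines "V \<equiv> unit_ball_vol n"
  defines "F \<equiv> \<lambda>z. \<integral>\<^sup>+ y. ennreal (\<bar>f y - f z\<bar> powr p / norm (y - z) powr (\<alpha> * p)) \<partial>lborel"
  defines "D \<equiv> max 1 (9 * 2 ^ DIM('a) / V\<^sup>2)"
  assumes f: "continuous_on UNIV f" and \<alpha>: "0 < \<alpha>" and p: "1 \<le> p" "4 * n \<le> \<alpha> * p"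
    and e: "0 < e" "frac_energy (\<alpha> * p) p f \<le> ennreal e"
    and z0: "0 < r" "z0 \<in> ball x r" "F z0 \<le> ennreal (3 * e / measure lborel (ball x r))"
  shows "\<bar>f x - f z0\<bar> \<le> 2 powr \<alpha> * D / (1 - 2 powr (- \<alpha> / 2)) * e powr (1 / p) * r powr (\<alpha> - 2 * n / p)"
proof -
  have [measurable]: "f \<in> borel_measurable borel" using f by (auto intro: borel_measurable_continuous_onI)
  have Fm: "F \<in> borel_measurable borel" unfolding F_def by measurable
  have Fint: "(\<integral>\<^sup>+ z. F z \<partial>lborel) \<le> ennreal e" using e(2) by (simp add: F_def frac_energy_lborel)
  define v where "v k = measure lborel (ball x (r / 2 ^ k))" for k
  define \<rho> where "\<rho> k = r / 2 ^ k" for k :: nat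
  have \<rho>: "0 < \<rho> k" "\<rho> (Suc k) = \<rho> k / 2" for k using z0(1) by (auto simp: \<rho>_def)
  have V: "0 < V" by (simp add: V_def n_def)
  have v_eq: "v k = V * \<rho> k ^ DIM('a)" for k
    using \<rho>(1)[of k] unfolding v_def \<rho>_def V_def n_def by (simp add: content_ball)
  have vpos: "0 < v k" for k using V \<rho>(1) by (simp add: v_eq)
  define P where "P k z \<longleftrightarrow> z \<in> ball x (\<rho> k) \<and> F z \<le> ennreal (3 * e / v k) \<and> (k = 0 \<longrightarrow> z = z0)" for k z
  \<comment> \<open>The constant is Markov's bound applied twice: the inner integral at z is at most
    3 e / v k, and this bounds in turn the total mass of the function of y by which the next point
    is chosen.\<close>
  define Q where "Q k z z' \<longleftrightarrow> \<bar>f z' - f z\<bar> powr p / norm (z' - z) powr (\<alpha> * p)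
      \<le> 3 * (3 * e / v k) / v (Suc k)" for k z z'
  have "\<exists>z. \<forall>k. P k (z k) \<and> Q k (z k) (z (Suc k))"
  proof (rule dependent_nat_choice)
    show "\<exists>z. P 0 z" using z0 by (auto simp: P_def v_def \<rho>_def)
    fix z k assume "P k z"
    then have "(\<integral>\<^sup>+ y. ennreal (\<bar>f y - f z\<bar> powr p / norm (y - z) powr (\<alpha> * p)) \<partial>lborel)
        \<le> ennreal (3 * e / v k)"
      by (simp add: P_def F_def)
    then obtain z' where "z' \<in> ball x (\<rho> (Suc k))" "F z' \<le> ennreal (3 * e / v (Suc k))"
      "ennreal (\<bar>f z' - f z\<bar> powr p / norm (z' - z) powr (\<alpha> * p)) \<le> ennreal (3 * (3 * e / v k) / v (Suc k))"
      using markov_pick[OF Fm _ Fint, of "\<lambda>y. ennreal (\<bar>f y - f z\<bar> powr p / norm (y - z) powr (\<alpha> * p))"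
          "3 * e / v k" "\<rho> (Suc k)" x] e(1) vpos[of k] \<rho>(1)[of "Suc k"]
      by (auto simp: v_def \<rho>_def)
    moreover have "0 \<le> 3 * (3 * e / v k) / v (Suc k)"
      using e(1) vpos[of k] vpos[of "Suc k"] by simp
    ultimately show "\<exists>z'. P (Suc k) z' \<and> Q k z z'"
      unfolding P_def Q_def by (intro exI[of _ z']) (simp add: ennreal_le_iff del: ennreal_le_iff2)
  qed
  then obtain z where z: "\<And>k. P k (z k)" "\<And>k. Q k (z k) (z (Suc k))" by blast
  define \<gamma> where "\<gamma> = \<alpha> - 2 * n / p"
  define A where "A = 2 powr \<alpha> * D * e powr (1 / p) * r powr \<gamma>"
  define b where "b = 2 powr (- \<alpha> / 2)"
  have b: "0 < b" "b < 1" using \<alpha> by (auto simp: b_def powr_less_one)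
  \<comment> \<open>The threshold on p enters here: it lets the ratio \<open>b\<close> of the
    geometric series depend on \<alpha> only, so that the sum is uniform in p.\<close>
  have \<gamma>: "\<alpha> / 2 \<le> \<gamma>" using p by (simp add: \<gamma>_def field_simps)
  have D: "1 \<le> D" by (simp add: D_def)
  have "0 \<le> A" using D by (simp add: A_def)
  have step: "\<bar>f (z (Suc k)) - f (z k)\<bar> \<le> A * b ^ k" for k
  proof (cases "z (Suc k) = z k")
    case True
    then show ?thesis using \<open>0 \<le> A\<close> b by simp
  next
    case False
    define d where "d = norm (z (Suc k) - z k)"
    have "dist x (z k) < \<rho> k" "dist x (z (Suc k)) < \<rho> k"
      using z(1)[of k] z(1)[of "Suc k"] \<rho>[of k] by (auto simp: P_def)
    then have d: "0 < d" "d \<le> 2 * \<rho> k"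
      using False dist_triangle[of "z (Suc k)" "z k" x] by (auto simp: d_def dist_norm norm_minus_commute)
    \<comment> \<open>The two ball volumes multiply to V^2 times the power 2n of the radius, divided
      by 2^n. After the p-th root the exponent -2n costs 2n/p in the Hoelder exponent.\<close>
    have "3 * (3 * e / v k) / v (Suc k) = (9 * 2 ^ DIM('a) / V\<^sup>2) * e * \<rho> k powr (- 2 * n)"
      using V \<rho>(1)[of k] by (simp add: v_eq \<rho>(2) powr_minus powr_realpow[symmetric] n_def field_simps
          power2_eq_square flip: powr_add)
    also have "\<dots> \<le> D * e * \<rho> k powr (- 2 * n)"
      using e(1) by (intro mult_right_mono) (auto simp: D_def)
    finally have "\<bar>f (z (Suc k)) - f (z k)\<bar> powr p / d powr (\<alpha> * p) \<le> D * e * \<rho> k powr (- 2 * n)"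
      using z(2)[of k] by (simp add: Q_def d_def)
    then have "\<bar>f (z (Suc k)) - f (z k)\<bar> powr p \<le> d powr (\<alpha> * p) * (D * e * \<rho> k powr (- 2 * n))"
      using d(1) by (simp add: field_simps)
    then have "(\<bar>f (z (Suc k)) - f (z k)\<bar> powr p) powr (1 / p)
        \<le> (d powr (\<alpha> * p) * (D * e * \<rho> k powr (- 2 * n))) powr (1 / p)"
      using p by (intro powr_mono2) auto
    then have "\<bar>f (z (Suc k)) - f (z k)\<bar> \<le> (d powr (\<alpha> * p) * (D * e * \<rho> k powr (- 2 * n))) powr (1 / p)"
      using p by (simp add: powr_powr)
    also have "\<dots> = d powr \<alpha> * (D powr (1 / p) * e powr (1 / p) * \<rho> k powr (- 2 * n / p))"
      using d D e \<rho>(1)[of k] p by (simp add: powr_mult powr_powr)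
    also have "\<dots> \<le> (2 * \<rho> k) powr \<alpha> * (D * e powr (1 / p) * \<rho> k powr (- 2 * n / p))"
    proof (rule mult_mono)
      show "d powr \<alpha> \<le> (2 * \<rho> k) powr \<alpha>" using d \<alpha> by (intro powr_mono2) auto
      \<comment> \<open>\<open>D\<close> is rounded up to at least 1 so that its p-th root is
        bounded by \<open>D\<close> itself; the root of \<open>e\<close> stays exact, since
        \<open>e\<close> will be a p-th power.\<close>
      show "D powr (1 / p) * e powr (1 / p) * \<rho> k powr (- 2 * n / p)
          \<le> D * e powr (1 / p) * \<rho> k powr (- 2 * n / p)"
        using D p by (intro mult_right_mono powr_le_self_ge_1) auto
    qed (use D in auto)
    also have "\<dots> = 2 powr \<alpha> * D * e powr (1 / p) * (\<rho> k powr \<alpha> * \<rho> k powr (- 2 * n / p))"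
      using \<rho>(1)[of k] by (simp add: powr_mult)
    also have "\<rho> k powr \<alpha> * \<rho> k powr (- 2 * n / p) = \<rho> k powr \<gamma>"
      by (simp add: \<gamma>_def flip: powr_add)
    also have "\<rho> k powr \<gamma> = r powr \<gamma> * (2 powr (- \<gamma>)) ^ k"
    proof -
      have "(2 ^ k) powr \<gamma> = (2 powr \<gamma>) ^ k"
        by (simp add: powr_realpow[symmetric] powr_powr mult.commute)
      then show ?thesis using z0(1) by (simp add: \<rho>_def powr_divide powr_minus power_inverse) (simp add:
          divide_inverse)
    qed
    also have "\<dots> \<le> r powr \<gamma> * b ^ k"
      unfolding b_def using \<gamma> by (intro mult_left_mono power_mono powr_mono) auto
    finally show ?thesis using D by (simp add: A_def mult_left_mono mult.assoc)
  qed
  have bound: "\<bar>f (z k) - f z0\<bar> \<le> A / (1 - b)" for k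
  proof -
    have "f (z k) - f z0 = (\<Sum>i<k. f (z (Suc i)) - f (z i))"
      using z(1)[of 0] sum_lessThan_telescope[of "\<lambda>i. f (z i)" k] by (simp add: P_def)
    also have "\<bar>\<dots>\<bar> \<le> (\<Sum>i<k. \<bar>f (z (Suc i)) - f (z i)\<bar>)" by (rule sum_abs)
    also have "\<dots> \<le> (\<Sum>i<k. A * b ^ i)" by (intro sum_mono step)
    also have "\<dots> = A * ((1 - b ^ k) / (1 - b))" using b by (simp add: sum_gp_strict flip: sum_distrib_left)
    also have "\<dots> \<le> A * (1 / (1 - b))" using \<open>0 \<le> A\<close> b by (intro mult_left_mono divide_right_mono) auto
    finally show ?thesis by simp
  qed
  have "z \<longlonglongrightarrow> x"
  proof -
    have "(\<lambda>k. z k - x) \<longlonglongrightarrow> 0"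
    proof (rule Lim_null_comparison)
      show "\<forall>\<^sub>F k in sequentially. norm (z k - x) \<le> r * (1 / 2) ^ k"
        using z(1) by (auto simp: P_def dist_norm norm_minus_commute \<rho>_def power_divide less_imp_le
            intro!: always_eventually)
      show "(\<lambda>k. r * (1 / 2) ^ k) \<longlonglongrightarrow> 0"
        by (intro tendsto_mult_right_zero LIMSEQ_power_zero) auto
    qed
    then show ?thesis by (simp add: LIM_zero_iff)
  qed
  then have "(\<lambda>k. \<bar>f (z k) - f z0\<bar>) \<longlonglongrightarrow> \<bar>f x - f z0\<bar>"
    by (intro tendsto_intros continuous_on_tendsto_compose[OF f]) auto
  then have "\<bar>f x - f z0\<bar> \<le> A / (1 - b)"
    by (rule LIMSEQ_le_const2) (use bound in auto)
  then show ?thesis by (simp add: A_def b_def \<gamma>_def field_simps)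
qed


text \<open>Two chains with a common start: a good point z is picked in the ball around the midpoint
  whose radius is half the distance d, so it lies within d of both points. That ball has 2^n times
  less volume than the balls of radius d which the chain expects, and replacing \<open>e\<close> by
  2^n \<open>e\<close> pays for it. The constant is free of p, which enters through the root of
  \<open>e\<close> and the exponent.\<close>

lemma fractional_Morrey:
  fixes \<alpha> :: real
  assumes \<alpha>: "0 < \<alpha>" "\<alpha> \<le> 1"
  obtains C where "0 < C"
    "\<And>(f :: 'a::euclidean_space \<Rightarrow> real) p e x y.
       continuous_on UNIV f \<Longrightarrow> 4 * real DIM('a) \<le> \<alpha> * p \<Longrightarrow> 0 < e \<Longrightarrow>
       frac_energy (\<alpha> * p) p f \<le> ennreal e \<Longrightarrow>
       \<bar>f x - f y\<bar> \<le> C * e powr (1 / p) * norm (x - y) powr (\<alpha> - 2 * real DIM('a) / p)"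
proof -
  define n where "n = real DIM('a)"
  define N where "N = (2::real) ^ DIM('a)"
  define K where "K = 2 powr \<alpha> * max 1 (9 * N / (unit_ball_vol n)\<^sup>2) / (1 - 2 powr (- \<alpha> / 2))"
  have "(2::real) powr (- \<alpha> / 2) < 1" using \<alpha> by (auto simp: powr_less_one)
  then have K: "0 < K" by (auto simp: K_def intro!: divide_pos_pos)
  have "1 \<le> N" by (simp add: N_def)
  have n: "1 \<le> n" using DIM_positive[where 'a='a] by (simp add: n_def)
  show ?thesis
  proof (rule that[of "2 * (K * N)"])
    show "0 < 2 * (K * N)" using K \<open>1 \<le> N\<close> by simp
    fix f :: "'a \<Rightarrow> real" and p e :: real and x y
    assume f: "continuous_on UNIV f" and p: "4 * real DIM('a) \<le> \<alpha> * p" and "0 < e"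
      and e: "frac_energy (\<alpha> * p) p f \<le> ennreal e"
    have "0 < p"
    proof (rule ccontr)
      assume "\<not> 0 < p"
      then have "\<alpha> * p \<le> 0" using \<alpha> by (simp add: mult_nonneg_nonpos)
      then have "4 * n \<le> 0" using p unfolding n_def by linarith
      then show False using n by simp
    qed
    moreover have "\<alpha> * p \<le> 1 * p" using \<alpha> \<open>0 < p\<close> by (intro mult_right_mono) auto
    ultimately have p1: "1 \<le> p" using p n unfolding n_def by linarith
    show "\<bar>f x - f y\<bar> \<le> 2 * (K * N) * e powr (1 / p) * norm (x - y) powr (\<alpha> - 2 * real DIM('a) / p)"
    proof (cases "x = y")
      case True
      then show ?thesis by simp
    next
      case False
      define d where "d = norm (x - y)"
      have d: "0 < d" using False by (simp add: d_def)
      define F where "F z = (\<integral>\<^sup>+ y. ennreal (\<bar>f y - f z\<bar> powr p / norm (y - z) powr (\<alpha> * p)) \<partial>lborel)" for z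
      have [measurable]: "f \<in> borel_measurable borel" using f
          by (auto intro: borel_measurable_continuous_onI)
      have Fm: "F \<in> borel_measurable borel" unfolding F_def by measurable
      have Fint: "(\<integral>\<^sup>+ z. F z \<partial>lborel) \<le> ennreal e" using e by (simp add: F_def frac_energy_lborel)
      obtain z where z: "z \<in> ball (midpoint x y) (d / 2)" "F z
          \<le> ennreal (3 * e / measure lborel (ball (midpoint x y) (d / 2)))"
        using markov_pick[OF Fm Fm Fint Fint \<open>0 < e\<close> \<open>0 < e\<close>, of "d / 2"] d by auto
      have le: "measure lborel (ball (midpoint x y) (d / 2)) = measure lborel (ball x' d) / N" for x' :: 'a
        using d by (simp add: content_ball N_def power_divide)
      have "\<bar>f x' - f z\<bar> \<le> K * N * e powr (1 / p) * d powr (\<alpha> - 2 * n / p)" if "z \<in> ball x' d" for x'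
      proof -
        have "\<bar>f x' - f z\<bar> \<le> K * (N * e) powr (1 / p) * d powr (\<alpha> - 2 * n / p)"
          unfolding K_def N_def n_def
        proof (rule Morrey_chain[OF f \<alpha>(1) p1 p _ _ d that])
          show "0 < 2 ^ DIM('a) * e" using \<open>0 < e\<close> by simp
          show "frac_energy (\<alpha> * p) p f \<le> ennreal (2 ^ DIM('a) * e)"
            using e \<open>0 < e\<close> \<open>1 \<le> N\<close> by (auto simp: N_def intro!: order_trans[OF e] ennreal_leI)
          show "(\<integral>\<^sup>+ y. ennreal (\<bar>f y - f z\<bar> powr p / norm (y - z) powr (\<alpha> * p)) \<partial>lborel)
              \<le> ennreal (3 * (2 ^ DIM('a) * e) / measure lborel (ball x' d))"
            using z(2) unfolding le[of x'] F_def by (simp add: N_def algebra_simps)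
        qed
        also have "(N * e) powr (1 / p) \<le> N * e powr (1 / p)"
          using \<open>1 \<le> N\<close> \<open>0 < e\<close> p1 by (simp add: powr_mult mult_right_mono powr_le_self_ge_1)
        finally show ?thesis using K by (simp add: mult_left_mono mult_right_mono mult.assoc)
      qed
      moreover have "dist x (midpoint x y) = d / 2" "dist y (midpoint x y) = d / 2"
        by (simp_all add: d_def dist_norm[of x y, symmetric] dist_midpoint)
      then have "z \<in> ball x d" "z \<in> ball y d"
        using z(1) dist_triangle[of x z "midpoint x y"] dist_triangle[of y z "midpoint x y"]
        by (auto simp: dist_commute)
      ultimately have "\<bar>f x - f z\<bar> \<le> K * N * e powr (1 / p) * d powr (\<alpha> - 2 * n / p)"
          "\<bar>f y - f z\<bar> \<le> K * N * e powr (1 / p) * d powr (\<alpha> - 2 * n / p)"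
        by blast+
      then show ?thesis by (simp add: d_def n_def)
    qed
  qed
qed

section \<open>Continuous representatives of Sobolev functions\<close>

lemma frac_energy_cong_AE:
  fixes u v :: "'a::euclidean_space \<Rightarrow> real"
  assumes "AE x in lebesgue. u x = v x"
  shows "frac_energy \<beta> p u = frac_energy \<beta> p v"
  unfolding frac_energy_def
proof (rule nn_integral_cong_AE, use assms in eventually_elim)
  fix x assume "u x = v x"
  then show "(\<integral>\<^sup>+ y. ennreal (\<bar>u y - u x\<bar> powr p / norm (y - x) powr \<beta>) \<partial>lebesgue)
      = (\<integral>\<^sup>+ y. ennreal (\<bar>v y - v x\<bar> powr p / norm (y - x) powr \<beta>) \<partial>lebesgue)"
    by (intro nn_integral_cong_AE) (use assms in eventually_elim, simp)
qed

lemma Lp_power_cong_AE: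
  fixes u v :: "'a::euclidean_space \<Rightarrow> real"
  assumes "AE x in lebesgue. u x = v x"
  shows "Lp_power p u = Lp_power p v"
  unfolding Lp_power_def by (rule nn_integral_cong_AE) (use assms in eventually_elim, simp)

lemma powr_add_le:
  fixes a b p :: real
  assumes "0 \<le> a" "0 \<le> b" "0 \<le> p"
  shows "(a + b) powr p \<le> 2 powr p * (a powr p + b powr p)"
proof -
  have "(a + b) powr p \<le> (2 * max a b) powr p" using assms by (intro powr_mono2) auto
  also have "\<dots> = 2 powr p * max a b powr p" using assms by (simp add: powr_mult)
  also have "\<dots> \<le> 2 powr p * (a powr p + b powr p)" by (intro mult_left_mono) (auto simp: max_def)
  finally show ?thesis .
qed

lemma frac_energy_diff_le:
  fixes f g :: "'a::euclidean_space \<Rightarrow> real"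
  assumes [measurable]: "f \<in> borel_measurable borel" "g \<in> borel_measurable borel" and "0 \<le> p"
  shows "frac_energy \<beta> p (\<lambda>x. f x - g x) \<le> ennreal (2 powr p) * (frac_energy \<beta> p f + frac_energy \<beta> p g)"
proof -
  have "frac_energy \<beta> p (\<lambda>x. f x - g x) \<le> (\<integral>\<^sup>+ x. (\<integral>\<^sup>+ y. ennreal (2 powr p) * (ennreal (\<bar>f y - f x\<bar>
      powr p / norm (y - x) powr \<beta>)
        + ennreal (\<bar>g y - g x\<bar> powr p / norm (y - x) powr \<beta>)) \<partial>lborel) \<partial>lborel)"
    unfolding frac_energy_lborel
  proof (intro nn_integral_mono)
    fix x y
    have "\<bar>f y - g y - (f x - g x)\<bar> powr p \<le> (\<bar>f y - f x\<bar> + \<bar>g y - g x\<bar>) powr p"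
      using \<open>0 \<le> p\<close> by (intro powr_mono2) auto
    also have "\<dots> \<le> 2 powr p * (\<bar>f y - f x\<bar> powr p + \<bar>g y - g x\<bar> powr p)"
      using \<open>0 \<le> p\<close> by (intro powr_add_le) auto
    finally have "\<bar>f y - g y - (f x - g x)\<bar> powr p / norm (y - x) powr \<beta>
        \<le> 2 powr p * (\<bar>f y - f x\<bar> powr p / norm (y - x) powr \<beta> + \<bar>g y - g x\<bar> powr p / norm (y - x) powr \<beta>)"
      by (simp add: divide_right_mono flip: add_divide_distrib)
    then show "ennreal (\<bar>f y - g y - (f x - g x)\<bar> powr p / norm (y - x) powr \<beta>)
        \<le> ennreal (2 powr p) * (ennreal (\<bar>f y - f x\<bar> powr p / norm (y - x) powr \<beta>)
        + ennreal (\<bar>g y - g x\<bar> powr p / norm (y - x) powr \<beta>))"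
      by (simp add: ennreal_leI flip: ennreal_mult ennreal_plus)
  qed
  also have "\<dots> = ennreal (2 powr p) * (frac_energy \<beta> p f + frac_energy \<beta> p g)"
    unfolding frac_energy_lborel by (simp add: nn_integral_cmult nn_integral_add)
  finally show ?thesis .
qed

lemma AE_eq_continuous_imp_nonneg:
  fixes v :: "'a::euclidean_space \<Rightarrow> real"
  assumes "continuous_on UNIV v" "AE x in lebesgue. 0 \<le> v x"
  shows "0 \<le> v x"
proof (rule ccontr)
  assume "\<not> 0 \<le> v x"
  have "open {x. v x < 0}" by (intro open_Collect_less assms continuous_intros)
  moreover have "{x. v x < 0} \<in> null_sets lebesgue"
    using assms(2) \<open>open {x. v x < 0}\<close> AE_iff_null_sets[of "{x. v x < 0}" lebesgue] by (simp add: not_less)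
  then have "negligible {x. v x < 0}" by (simp add: negligible_iff_null_sets)
  ultimately show False using open_not_negligible[of "{x. v x < 0}"] \<open>\<not> 0 \<le> v x\<close> by (auto simp: not_le)
qed


text \<open>Applied to differences of the approximating test functions, the Morrey inequality turns
  convergence in energy into a uniform Cauchy property; a point outside the bounded set
  \<open>\<Omega>\<close>, where all of them vanish, fixes the additive constant. The uniform limit
  then vanishes at every point off \<open>\<Omega>\<close>, not merely at almost every one.\<close>

lemma W0sp_continuous_representative:
  fixes u :: "'a::euclidean_space \<Rightarrow> real"
  assumes \<alpha>: "0 < \<alpha>" "\<alpha> \<le> 1" and p: "0 < p" "4 * real DIM('a) \<le> \<alpha> * p" and "bounded \<Omega>"
    and u: "u \<in> W0sp (\<alpha> - real DIM('a) / p) p \<Omega>"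
  obtains v where "continuous_on UNIV v" "AE x in lebesgue. v x = u x" "\<And>x. x \<notin> \<Omega> \<Longrightarrow> v x = 0"
proof -
  \<comment> \<open>With s = \<alpha> - n/p the kernel exponent n + s p of the Sobolev norm becomes
    the exponent \<alpha> p of the Rayleigh quotient.\<close>
  have exponent: "real DIM('a) + (\<alpha> - real DIM('a) / p) * p = \<alpha> * p"
    using p by (simp add: algebra_simps)
  obtain \<phi> where \<phi>: "\<And>j. \<phi> j \<in> Cc_infty \<Omega>"
      "(\<lambda>j. Wsp_norm_power (\<alpha> - real DIM('a) / p) p (\<lambda>x. \<phi> j x - u x)) \<longlonglongrightarrow> 0"
    and "u \<in> borel_measurable lebesgue"
    using u by (auto simp: W0sp_def)
  \<comment> \<open>\<open>u\<close> is only Lebesgue measurable; a Borel version makes the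
    two-variable integrands jointly measurable.\<close>
  then obtain g where [measurable]: "g \<in> borel_measurable lborel" and "AE x in lborel. u x = g x"
    using completion_ex_borel_measurable_real by blast
  then have ug: "AE x in lebesgue. u x = g x" by (simp add: AE_completion_iff AE_completion)
  define E where "E j = frac_energy (\<alpha> * p) p (\<lambda>x. \<phi> j x - g x)" for j
  define L where "L j = Lp_power p (\<lambda>x. \<phi> j x - g x)" for j
  have "Wsp_norm_power (\<alpha> - real DIM('a) / p) p (\<lambda>x. \<phi> j x - u x) = E j + L j" for j
  proof -
    have ae: "AE x in lebesgue. \<phi> j x - u x = \<phi> j x - g x" using ug by eventually_elim simp
    show ?thesis
      unfolding Wsp_norm_power_def E_def L_def exponent
      using frac_energy_cong_AE[OF ae] Lp_power_cong_AE[OF ae] by simp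
  qed
  then have EL: "(\<lambda>j. E j + L j) \<longlonglongrightarrow> 0" using \<phi>(2) by simp
  have E: "E \<longlonglongrightarrow> 0" and L: "L \<longlonglongrightarrow> 0"
    by (rule tendsto_sandwich[OF _ _ tendsto_const EL]; simp add: always_eventually)+
  have cont: "continuous_on UNIV (\<phi> j)" for j
  proof -
    have "C_k 0 (\<phi> j)" using \<phi>(1)[of j] unfolding Cc_infty_def by blast
    then show ?thesis by simp
  qed
  then have [measurable]: "\<phi> j \<in> borel_measurable borel" for j
      by (auto intro: borel_measurable_continuous_onI)
  have [measurable]: "g \<in> borel_measurable borel" by simp
  have out: "\<phi> j x = 0" if "x \<notin> \<Omega>" for j x
  proof -
    have "{x. \<phi> j x \<noteq> 0} \<subseteq> \<Omega>" using \<phi>(1)[of j] closure_subset by (fastforce simp: Cc_infty_def supp_def)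
    then show ?thesis using that by auto
  qed
  obtain C where C: "0 < C" "\<And>(f :: 'a \<Rightarrow> real) p e x y.
       continuous_on UNIV f \<Longrightarrow> 4 * real DIM('a) \<le> \<alpha> * p \<Longrightarrow> 0 < e \<Longrightarrow>
       frac_energy (\<alpha> * p) p f \<le> ennreal e \<Longrightarrow>
       \<bar>f x - f y\<bar> \<le> C * e powr (1 / p) * norm (x - y) powr (\<alpha> - 2 * real DIM('a) / p)"
    using fractional_Morrey[OF \<alpha>, where 'a='a] by blast
  define \<gamma> where "\<gamma> = \<alpha> - 2 * real DIM('a) / p"
  have "0 \<le> \<gamma>" using p by (simp add: \<gamma>_def field_simps)
  have "\<Omega> \<noteq> UNIV" using \<open>bounded \<Omega>\<close> not_bounded_UNIV by metis
  then obtain y0 where y0: "y0 \<notin> \<Omega>" by blast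
  obtain B where B: "0 < B" "\<And>x. x \<in> \<Omega> \<Longrightarrow> norm (x - y0) \<le> B"
    using bounded_subset_ballD[OF \<open>bounded \<Omega>\<close>, of y0] by (force simp: dist_norm norm_minus_commute)
  have "uniformly_Cauchy_on UNIV \<phi>"
  proof (rule uniformly_Cauchy_onI)
    fix e :: real assume "0 < e"
    \<comment> \<open>Solves C * \<delta>^(1/p) * B^\<gamma> = e / 2.\<close>
    define \<delta> where "\<delta> = (e / (2 * C * B powr \<gamma>)) powr p"
    have \<delta>: "0 < \<delta>" using \<open>0 < e\<close> C B by (simp add: \<delta>_def)
    have "0 < \<delta> / (2 * 2 powr p)" using \<delta> by simp
    then have "\<forall>\<^sub>F j in sequentially. E j < ennreal (\<delta> / (2 * 2 powr p))"
      by (intro order_tendstoD[OF E]) (simp add: ennreal_less_zero_iff)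
    then obtain M where M: "\<And>j. M \<le> j \<Longrightarrow> E j < ennreal (\<delta> / (2 * 2 powr p))"
      by (auto simp: eventually_sequentially)
    have "dist (\<phi> i x) (\<phi> j x) < e" if "M \<le> i" "M \<le> j" for i j x
    proof (cases "x \<in> \<Omega>")
      case False
      then show ?thesis using out \<open>0 < e\<close> by simp
    next
      case True
      have "frac_energy (\<alpha> * p) p (\<lambda>x. \<phi> i x - \<phi> j x)
          = frac_energy (\<alpha> * p) p (\<lambda>x. (\<phi> i x - g x) - (\<phi> j x - g x))"
        by simp
      also have "\<dots> \<le> ennreal (2 powr p) * (E i + E j)"
        unfolding E_def using p by (intro frac_energy_diff_le) auto
      also have "\<dots> \<le> ennreal (2 powr p) * (ennreal (\<delta> / (2 * 2 powr p)) + ennreal (\<delta> / (2 * 2 powr p)))"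
        using M that by (intro mult_left_mono add_mono less_imp_le) auto
      also have "\<dots> = ennreal \<delta>"
        using \<delta> by (simp flip: ennreal_plus ennreal_mult)
      finally have "\<bar>(\<phi> i x - \<phi> j x) - (\<phi> i y0 - \<phi> j y0)\<bar> \<le> C * \<delta> powr (1 / p) * norm (x - y0) powr \<gamma>"
        unfolding \<gamma>_def by (intro C(2) p \<delta> continuous_intros cont)
      also have "\<dots> \<le> C * \<delta> powr (1 / p) * B powr \<gamma>"
        using C(1) B(2)[OF True] \<open>0 \<le> \<gamma>\<close> by (intro mult_left_mono powr_mono2) auto
      also have "\<dots> = e / 2"
        using p C(1) B(1) \<open>0 < e\<close> by (simp add: \<delta>_def powr_powr)
      finally show ?thesis using out[OF y0] \<open>0 < e\<close> by (simp add: dist_real_def)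
    qed
    then show "\<exists>M. \<forall>x\<in>UNIV. \<forall>m\<ge>M. \<forall>n\<ge>M. dist (\<phi> m x) (\<phi> n x) < e" by blast
  qed
  then obtain v where v: "uniform_limit UNIV \<phi> v sequentially"
    using Cauchy_uniformly_convergent unfolding uniformly_convergent_on_def by blast
  have cv: "continuous_on UNIV v"
    by (rule uniform_limit_theorem[OF _ v]) (auto simp: cont)
  then have [measurable]: "v \<in> borel_measurable borel" by (auto intro: borel_measurable_continuous_onI)
  have lim: "(\<lambda>j. \<phi> j x) \<longlonglongrightarrow> v x" for x
    by (rule tendsto_uniform_limitI[OF v]) simp
  \<comment> \<open>Fatou's lemma identifies the uniform limit with the limit in the p-norm.\<close>
  have "(\<integral>\<^sup>+ x. ennreal (\<bar>v x - g x\<bar> powr p) \<partial>lborel)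
      = (\<integral>\<^sup>+ x. liminf (\<lambda>j. ennreal (\<bar>\<phi> j x - g x\<bar> powr p)) \<partial>lborel)"
  proof (rule nn_integral_cong)
    fix x
    have "(\<lambda>j. ennreal (\<bar>\<phi> j x - g x\<bar> powr p)) \<longlonglongrightarrow> ennreal (\<bar>v x - g x\<bar> powr p)"
      using p by (intro tendsto_ennrealI tendsto_powr' tendsto_rabs tendsto_diff lim tendsto_const) auto
    then show "ennreal (\<bar>v x - g x\<bar> powr p) = liminf (\<lambda>j. ennreal (\<bar>\<phi> j x - g x\<bar> powr p))"
      by (intro lim_imp_Liminf[symmetric]) auto
  qed
  also have "\<dots> \<le> liminf (\<lambda>j. \<integral>\<^sup>+ x. ennreal (\<bar>\<phi> j x - g x\<bar> powr p) \<partial>lborel)"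
    by (rule nn_integral_liminf) simp
  also have "\<dots> = 0"
    using lim_imp_Liminf[OF _ L] by (simp add: L_def[abs_def] Lp_power_lborel)
  finally have "AE x in lborel. v x = g x"
    using p by (simp add: nn_integral_0_iff_AE)
  then have "AE x in lebesgue. v x = g x" by (rule AE_completion)
  with ug have "AE x in lebesgue. v x = u x" by eventually_elim simp
  moreover have "v x = 0" if "x \<notin> \<Omega>" for x
    using lim[of x] out[OF that] LIMSEQ_unique[of "\<lambda>j. \<phi> j x" "v x" 0] by simp
  ultimately show ?thesis using that cv by blast
qed

section \<open>Asymptotics of the first eigenvalues and compactness\<close>

text \<open>Common majorant for the singular kernels: a governs the diagonal and b infinity. As a
  function of |z| it is integrable in dimension n when a < n < b.\<close>

definition radial_weight :: "real \<Rightarrow> real \<Rightarrow> real \<Rightarrow> real" where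
  "radial_weight a b t = (if t \<le> 1 then t powr (- a) else t powr (- b))"

lemma radial_weight_nonneg [simp]: "0 \<le> radial_weight a b t"
  by (simp add: radial_weight_def)

lemma radial_weight_measurable [measurable]: "radial_weight a b \<in> borel_measurable borel"
  unfolding radial_weight_def by measurable

text \<open>Dyadic balls in place of polar coordinates: the weight is at most a sum of indicators of
  balls of radii 2^(-k) and 2^(k+1), each multiplied by the size of the weight on the k-th shell.
  The integrals form geometric series with ratios 2^(a-n) and 2^(n-b).\<close>

lemma integral_radial_weight_finite:
  fixes a b :: real
  assumes a: "0 \<le> a" "a < real DIM('a::euclidean_space)" and b: "real DIM('a) < b"
  shows "(\<integral>\<^sup>+ z. ennreal (radial_weight a b (norm (z::'a))) \<partial>lborel) < \<infinity>"
proof -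
  define n where "n = real DIM('a)"
  define V where "V = unit_ball_vol n"
  have V: "0 \<le> V" by (simp add: V_def n_def)
  have [measurable]: "cball (0::'a) r \<in> sets borel" for r by simp
  define A where "A k = (2::real) powr (real (Suc k) * a)" for k
  define B where "B k = (2::real) powr (- (real k * b))" for k
  define h where "h k z = ennreal (A k) * indicator (cball 0 ((1/2) ^ k)) z + ennreal (B k) * indicator
      (cball 0 (2 ^ Suc k)) z"
    for k and z :: 'a
  have near: "t powr (- a) \<le> A k" if "(1/2) ^ Suc k < t" "0 < t" for t k
  proof -
    have "t powr (- a) \<le> ((1/2) ^ Suc k) powr (- a)"
      using that a by (intro powr_mono2') auto
    also have "((1/2::real) ^ Suc k) = 2 powr (- real (Suc k))"
      by (simp only: powr_minus powr_realpow power_one_over zero_less_numeral inverse_eq_divide)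
    also have "(2 powr (- real (Suc k))) powr (- a) = A k"
        by (simp only: powr_powr A_def) (simp add: algebra_simps)
    finally show ?thesis .
  qed
  have far: "t powr (- b) \<le> B k" if "2 ^ k \<le> t" for t k
  proof -
    have "t powr (- b) \<le> (2 ^ k) powr (- b)" using that a b by (intro powr_mono2') auto
    also have "(2 ^ k) powr (- b) = B k" by (simp add: B_def powr_realpow[symmetric] powr_powr)
    finally show ?thesis .
  qed
  have pointwise: "ennreal (radial_weight a b (norm z)) \<le> (\<Sum>k. h k z)" for z
  proof (cases "z = 0")
    case True
    then show ?thesis by (simp add: radial_weight_def)
  next
    case False
    define t where "t = norm z"
    have t: "0 < t" using False by (simp add: t_def)
    have "\<exists>k. ennreal (radial_weight a b t) \<le> h k z"
    proof (cases "t \<le> 1")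
      case True
      \<comment> \<open>The least m with 2^(-m) < t is positive since t \<le> 1, and its predecessor
        indexes the shell containing t.\<close>
      obtain m where m: "(1/2) ^ m < t" "\<And>i. i < m \<Longrightarrow> \<not> (1/2) ^ i < t"
        using real_arch_pow_inv[OF t, of "1/2"] exists_least_iff[of "\<lambda>m. (1/2) ^ m < t"] by auto
      then obtain k where k: "m = Suc k" using True by (cases m) auto
      have "t \<le> (1/2) ^ k" using m(2)[of k] k by simp
      then have "z \<in> cball 0 ((1/2) ^ k)" by (simp add: t_def)
      moreover have "radial_weight a b t \<le> A k" using near[of k t] m(1) k t True
          by (simp add: radial_weight_def)
      ultimately have "ennreal (radial_weight a b t) \<le> h k z"
        unfolding h_def by (intro order_trans[OF _ add_increasing2[OF _ order_refl]]) (auto intro: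
            ennreal_leI)
      then show ?thesis ..
    next
      case False
      obtain m where m: "t < 2 ^ m" "\<And>i. i < m \<Longrightarrow> \<not> t < 2 ^ i"
        using real_arch_pow[of 2 t] exists_least_iff[of "\<lambda>m. t < 2 ^ m"] by auto
      then obtain k where k: "m = Suc k" using False by (cases m) auto
      have "2 ^ k \<le> t" using m(2)[of k] k by simp
      then have "radial_weight a b t \<le> B k" using far[of k t] False by (simp add: radial_weight_def)
      moreover have "z \<in> cball 0 (2 ^ Suc k)" using m(1) k by (simp add: t_def)
      ultimately have "ennreal (radial_weight a b t) \<le> h k z"
        unfolding h_def by (intro order_trans[OF _ add_increasing[OF _ order_refl]]) (auto intro:
            ennreal_leI)
      then show ?thesis ..
    qed
    then obtain k where "ennreal (radial_weight a b t) \<le> h k z" ..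
    also have "h k z = (\<Sum>i\<in>{k}. h i z)" by simp
    also have "\<dots> \<le> (\<Sum>k. h k z)" by (rule sum_le_suminf) auto
    finally show ?thesis by (simp add: t_def)
  qed
  have hint: "(\<integral>\<^sup>+ z. h k z \<partial>lborel) = ennreal (2 powr a * V * (2 powr (a - n)) ^ k + 2 powr n * V * (2
      powr (n - b)) ^ k)" for k
  proof -
    have "(\<integral>\<^sup>+ z. h k z \<partial>lborel) = ennreal (A k) * ennreal (V * ((1/2) ^ k) ^ DIM('a)) + ennreal (B k) *
        ennreal (V * (2 ^ Suc k) ^ DIM('a))"
      unfolding h_def by (simp add: nn_integral_add nn_integral_cmult emeasure_cball V_def n_def del:
          power_Suc)
    also have "\<dots> = ennreal (A k * (V * ((1/2) ^ k) ^ DIM('a)) + B k * (V * (2 ^ Suc k) ^ DIM('a)))"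
      using V by (simp add: A_def B_def flip: ennreal_mult ennreal_plus del: power_Suc)
    also have "A k * (V * ((1/2) ^ k) ^ DIM('a)) = 2 powr a * V * (2 powr (a - n)) ^ k"
    proof -
      have "((1/2::real) ^ k) ^ DIM('a) = 2 powr (- (real k * n))"
        by (simp add: powr_minus powr_realpow[symmetric] powr_powr n_def power_one_over inverse_eq_divide)
      moreover have "(2 powr (a - n)) ^ k = 2 powr (real k * (a - n))"
        by (simp add: powr_realpow[symmetric] powr_powr mult.commute)
      moreover have "2 powr (real (Suc k) * a) * 2 powr (- (real k * n))
          = (2::real) powr a * 2 powr (real k * (a - n))"
        unfolding powr_add[symmetric] by (simp add: algebra_simps)
      ultimately show ?thesis by (simp add: A_def)
    qed
    also have "B k * (V * (2 ^ Suc k) ^ DIM('a)) = 2 powr n * V * (2 powr (n - b)) ^ k"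
    proof -
      have "((2::real) ^ Suc k) ^ DIM('a) = 2 powr (real (Suc k) * n)"
        by (simp only: powr_realpow[symmetric] powr_powr n_def zero_less_numeral zero_less_power
            powr_gt_zero)
      moreover have "(2 powr (n - b)) ^ k = 2 powr (real k * (n - b))"
        by (simp add: powr_realpow[symmetric] powr_powr mult.commute)
      moreover have "2 powr (- (real k * b)) * 2 powr (real (Suc k) * n)
          = (2::real) powr n * 2 powr (real k * (n - b))"
        unfolding powr_add[symmetric] by (simp add: algebra_simps)
      ultimately show ?thesis by (simp add: B_def)
    qed
    finally show ?thesis .
  qed
  have "(\<integral>\<^sup>+ z. ennreal (radial_weight a b (norm (z::'a))) \<partial>lborel) \<le> (\<integral>\<^sup>+ z. (\<Sum>k. h k z) \<partial>lborel)"
    by (intro nn_integral_mono pointwise)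
  also have "\<dots> = (\<Sum>k. \<integral>\<^sup>+ z. h k z \<partial>lborel)"
    unfolding h_def by (rule nn_integral_suminf) measurable
  also have "\<dots> = (\<Sum>k. ennreal (2 powr a * V * (2 powr (a - n)) ^ k + 2 powr n * V * (2 powr (n - b)) ^ k))"
    by (simp add: hint)
  also have "\<dots> < \<infinity>"
  proof -
    have "(2::real) powr (a - n) < 1" "(2::real) powr (n - b) < 1"
      using a b by (auto simp: n_def powr_less_one)
    then have "summable (\<lambda>k. 2 powr a * V * (2 powr (a - n)) ^ k + 2 powr n * V * (2 powr (n - b)) ^ k)"
      by (intro summable_add summable_mult summable_geometric) auto
    then show ?thesis
      using V by (subst suminf_ennreal2) auto
  qed
  finally show ?thesis .
qed

lemma nn_integral_lborel_reflect:
  fixes f :: "'a::euclidean_space \<Rightarrow> ennreal"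
  assumes [measurable]: "f \<in> borel_measurable borel"
  shows "(\<integral>\<^sup>+ y. f (x - y) \<partial>lborel) = (\<integral>\<^sup>+ y. f y \<partial>lborel)"
  by (subst (2) lborel_distr_reflect[of x, symmetric]) (simp add: nn_integral_distr)

text \<open>Only pairs with an end in \<open>B\<close> contribute. For the indicator of x,
  translation invariance makes the inner integral independent of x; the indicator of y is reduced to
  this by Fubini and a reflection. Hence the factor 2.\<close>

lemma double_integral_localized_le:
  fixes F :: "'a::euclidean_space \<Rightarrow> 'a \<Rightarrow> ennreal" and g :: "'a \<Rightarrow> ennreal"
  assumes [measurable]: "g \<in> borel_measurable borel" "B \<in> sets borel"
    and F: "\<And>x y. F x y \<le> c * ((indicator B x + indicator B y) * g (y - x))"
  shows "(\<integral>\<^sup>+ x. (\<integral>\<^sup>+ y. F x y \<partial>lborel) \<partial>lborel) \<le> c * (2 * emeasure lborel B * (\<integral>\<^sup>+ z. g z \<partial>lborel))"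
proof -
  define G where "G = (\<integral>\<^sup>+ z. g z \<partial>lborel)"
  have "(\<integral>\<^sup>+ x. (\<integral>\<^sup>+ y. F x y \<partial>lborel) \<partial>lborel)
      \<le> (\<integral>\<^sup>+ x. (\<integral>\<^sup>+ y. c * (indicator B x * g (y - x) + indicator B y * g (y - x)) \<partial>lborel) \<partial>lborel)"
    using F by (intro nn_integral_mono) (simp add: distrib_right)
  also have "\<dots> = c * ((\<integral>\<^sup>+ x. (\<integral>\<^sup>+ y. indicator B x * g (y - x) \<partial>lborel) \<partial>lborel)
      + (\<integral>\<^sup>+ x. (\<integral>\<^sup>+ y. indicator B y * g (y - x) \<partial>lborel) \<partial>lborel))"
    by (simp add: nn_integral_cmult nn_integral_add)
  also have "(\<integral>\<^sup>+ x. (\<integral>\<^sup>+ y. indicator B x * g (y - x) \<partial>lborel) \<partial>lborel) = emeasure lborel B * G"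
    by (simp add: nn_integral_cmult nn_integral_multc nn_integral_lborel_translate G_def)
  also have "(\<integral>\<^sup>+ x. (\<integral>\<^sup>+ y. indicator B y * g (y - x) \<partial>lborel) \<partial>lborel)
      = (\<integral>\<^sup>+ y. (\<integral>\<^sup>+ x. indicator B y * g (y - x) \<partial>lborel) \<partial>lborel)"
    by (rule lborel_pair.Fubini') measurable
  also have "\<dots> = emeasure lborel B * G"
    by (simp add: nn_integral_cmult nn_integral_multc nn_integral_lborel_reflect G_def)
  finally show ?thesis by (simp add: G_def mult.assoc mult_2 distrib_right)
qed

lemma double_integral_balls_ge:
  fixes F :: "'a::euclidean_space \<Rightarrow> 'a \<Rightarrow> ennreal"
  assumes "\<And>x y. x \<in> ball a r \<Longrightarrow> y \<in> ball b r \<Longrightarrow> c \<le> F x y"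
  shows "c * (emeasure lborel (ball a r) * emeasure lborel (ball b r))
      \<le> (\<integral>\<^sup>+ x. (\<integral>\<^sup>+ y. F x y \<partial>lborel) \<partial>lborel)"
proof -
  have [measurable]: "ball a r \<in> sets borel" "ball b r \<in> sets borel" by auto
  have "c * (emeasure lborel (ball a r) * emeasure lborel (ball b r))
      = (\<integral>\<^sup>+ x. (\<integral>\<^sup>+ y. c * (indicator (ball a r) x * indicator (ball b r) y) \<partial>lborel) \<partial>lborel)"
    by (simp add: nn_integral_cmult nn_integral_multc)
  also have "\<dots> \<le> (\<integral>\<^sup>+ x. (\<integral>\<^sup>+ y. F x y \<partial>lborel) \<partial>lborel)"
    using assms by (intro nn_integral_mono) (auto simp: indicator_def)
  finally show ?thesis .
qed

lemma eventually_powr_gt: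
  fixes \<tau> K :: real
  assumes "1 < \<tau>"
  shows "\<forall>\<^sub>F p in at_top. K < \<tau> powr p"
proof -
  have "LIM p at_top. exp (ln \<tau> * p) :> at_top"
    using assms by (intro filterlim_compose[OF exp_at_top] filterlim_tendsto_pos_mult_at_top[OF
        tendsto_const _ filterlim_ident]) auto
  then have "LIM p at_top. \<tau> powr p :> at_top"
    using assms by (simp add: powr_def mult.commute)
  then show ?thesis by (simp add: filterlim_at_top_dense)
qed

text \<open>Multiplicative constants cannot compete with a strict inequality between the bases. This
  is why the estimates below are sharp in the base only.\<close>

lemma eventually_mult_powr_less:
  fixes a b c K :: real
  assumes "0 < a" "a < b" "0 < c"
  shows "\<forall>\<^sub>F p in at_top. K * a powr p < c * b powr p"
  using eventually_powr_gt[of "b / a" "K / c"]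
proof (rule eventually_mono)
  show "1 < b / a" using assms by simp
  fix p assume "K / c < (b / a) powr p"
  then show "K * a powr p < c * b powr p"
    using assms by (simp add: powr_divide field_simps)
qed


section \<open>The upper bound for the eigenvalues\<close>

lemma powr_subadditive:
  fixes a b \<alpha> :: real
  assumes "0 \<le> a" "0 \<le> b" "0 < \<alpha>" "\<alpha> \<le> 1"
  shows "(a + b) powr \<alpha> \<le> a powr \<alpha> + b powr \<alpha>"
proof (cases "a = 0 \<or> b = 0")
  case False
  then have "0 < a" "0 < b" using assms by auto
  have split: "x powr \<alpha> = x * x powr (\<alpha> - 1)" if "0 < x" for x :: real
    using that powr_add[of x 1 "\<alpha> - 1"] by simp
  have "(a + b) powr \<alpha> = a * (a + b) powr (\<alpha> - 1) + b * (a + b) powr (\<alpha> - 1)"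
    using split[of "a + b"] \<open>0 < a\<close> \<open>0 < b\<close> by (simp add: distrib_right)
  also have "\<dots> \<le> a * a powr (\<alpha> - 1) + b * b powr (\<alpha> - 1)"
    using assms \<open>0 < a\<close> \<open>0 < b\<close> by (intro add_mono mult_left_mono powr_mono2') auto
  finally show ?thesis using split \<open>0 < a\<close> \<open>0 < b\<close> by simp
qed (use assms in auto)

lemma powr_diff_le:
  fixes a b \<alpha> :: real
  assumes "0 \<le> a" "0 \<le> b" "0 < \<alpha>" "\<alpha> \<le> 1"
  shows "\<bar>a powr \<alpha> - b powr \<alpha>\<bar> \<le> \<bar>a - b\<bar> powr \<alpha>"
proof -
  have "\<bar>a powr \<alpha> - b powr \<alpha>\<bar> \<le> \<bar>a - b\<bar> powr \<alpha>" if "0 \<le> b" "b \<le> a" for a b :: real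
    using powr_subadditive[of b "a - b" \<alpha>] that assms powr_mono2[of \<alpha> b a] by auto
  from this[of b a] this[of a b] assms show ?thesis
    by (cases "b \<le> a") (auto simp: abs_minus_commute)
qed

text \<open>Hoelder quotients of \<open>w\<close> are at most 1, so lowering the power from p to the
  fixed m only increases the integrand, and one bound serves all p \<ge> m. Far from the diagonal
  the boundedness of \<open>w\<close> yields decay with exponent \<alpha> m, integrable once
  \<alpha> m exceeds the dimension.\<close>

lemma frac_energy_Hoelder_le:
  fixes w :: "'a::euclidean_space \<Rightarrow> real"
  assumes \<alpha>: "0 < \<alpha>" and m: "m \<le> p" "0 \<le> m"
    and w: "\<And>x y. \<bar>w y - w x\<bar> \<le> norm (y - x) powr \<alpha>" "\<And>x y. \<bar>w y - w x\<bar> \<le> H" "\<And>x. x \<notin> B \<Longrightarrow> w x = 0"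
    and B: "B \<in> sets borel"
  shows "frac_energy (\<alpha> * p) p w \<le> ennreal (max 1 (H powr m)) *
    (2 * emeasure lborel B * (\<integral>\<^sup>+ z. ennreal (radial_weight 0 (\<alpha> * m) (norm (z::'a))) \<partial>lborel))"
  unfolding frac_energy_lborel
proof (rule double_integral_localized_le[OF _ B])
  fix x y :: 'a
  define t where "t = norm (y - x)"
  define d where "d = \<bar>w y - w x\<bar>"
  show "ennreal (\<bar>w y - w x\<bar> powr p / norm (y - x) powr (\<alpha> * p)) \<le> ennreal (max 1 (H powr m)) *
      ((indicator B x + indicator B y) * ennreal (radial_weight 0 (\<alpha> * m) (norm (y - x))))"
  proof (cases "d = 0 \<or> t = 0")
    case True
    then show ?thesis by (auto simp: d_def t_def)
  next
    case False
    then have t: "0 < t" and d: "0 < d" by (auto simp: d_def t_def)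
    have dt: "d / t powr \<alpha> \<le> 1" using w(1)[of y x] t by (simp add: d_def t_def)
    have "d powr p / t powr (\<alpha> * p) = (d / t powr \<alpha>) powr p"
      using t d by (simp add: powr_divide powr_powr)
    also have "\<dots> \<le> (d / t powr \<alpha>) powr m" using dt d t m by (intro powr_mono') auto
    also have "\<dots> \<le> max 1 (H powr m) * radial_weight 0 (\<alpha> * m) t"
    proof (cases "t \<le> 1")
      case True
      have "(d / t powr \<alpha>) powr m \<le> 1" using dt d t m by (intro powr_le1) auto
      then show ?thesis using True t by (simp add: radial_weight_def)
    next
      case False
      have "(d / t powr \<alpha>) powr m = d powr m * t powr (- (\<alpha> * m))"
        using t d by (simp add: powr_divide powr_powr powr_minus) (simp add: divide_inverse)
      also have "\<dots> \<le> max 1 (H powr m) * t powr (- (\<alpha> * m))"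
        using w(2)[of y x] d m by (intro mult_right_mono) (auto simp: d_def max.coboundedI2 powr_mono2)
      finally show ?thesis using False by (simp add: radial_weight_def)
    qed
    finally have "ennreal (d powr p / t powr (\<alpha> * p))
        \<le> ennreal (max 1 (H powr m)) * (1 * ennreal (radial_weight 0 (\<alpha> * m) t))"
      by (simp add: ennreal_leI flip: ennreal_mult)
    also have "\<dots> \<le> ennreal (max 1 (H powr m)) * ((indicator B x + indicator B y) * ennreal
        (radial_weight 0 (\<alpha> * m) t))"
    proof (intro mult_left_mono mult_right_mono)
      have "x \<in> B \<or> y \<in> B"
      proof (rule ccontr)
        assume "\<not> (x \<in> B \<or> y \<in> B)"
        then show False using d w(3)[of x] w(3)[of y] by (simp add: d_def)
      qed
      then show "(1::ennreal) \<le> indicator B x + indicator B y" by (auto simp: indicator_def)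
    qed auto
    finally show ?thesis by (simp add: t_def d_def)
  qed
qed measurable

lemma infdist_bdd_above:
  fixes \<Omega> :: "'a::euclidean_space set"
  assumes "bounded \<Omega>"
  shows "bdd_above ((\<lambda>x. infdist x (- \<Omega>)) ` \<Omega>)"
proof -
  have "\<Omega> \<noteq> UNIV" using assms not_bounded_UNIV by metis
  then obtain y where y: "y \<in> - \<Omega>" by blast
  obtain B where "\<Omega> \<subseteq> ball y B" using bounded_subset_ballD[OF assms, of y] by blast
  then have "\<And>x. x \<in> \<Omega> \<Longrightarrow> dist x y \<le> B" by (auto simp: dist_commute less_imp_le subset_iff)
  then show ?thesis using infdist_le[OF y] by (intro bdd_aboveI2[of _ _ B]) (meson order_trans)
qed

lemma inradius_pos:
  fixes \<Omega> :: "'a::euclidean_space set"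
  assumes "open \<Omega>" "bounded \<Omega>" "\<Omega> \<noteq> {}"
  shows "0 < inradius \<Omega>"
proof -
  obtain x where x: "x \<in> \<Omega>" using assms by blast
  have "- \<Omega> \<noteq> {}" using assms(2) not_bounded_UNIV by (metis Compl_empty_eq double_complement)
  then have "0 < infdist x (- \<Omega>)"
    using x assms(1) infdist_pos_not_in_closed[of "- \<Omega>" x] by (simp add: closed_def)
  also have "\<dots> \<le> inradius \<Omega>"
    unfolding inradius_def by (intro cSUP_upper x infdist_bdd_above assms)
  finally show ?thesis .
qed

text \<open>The energy of the competitor stays below one constant for all large p, its Hoelder
  quotients being at most 1, while its p-th mass is at least a constant times \<sigma>^(\<alpha> p).
  The Rayleigh quotient therefore has rate at most \<sigma>^(-\<alpha>), and \<sigma> can be so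
  close to the inradius that this is below L.\<close>

lemma first_eigenvalue_upper_bound:
  fixes \<Omega> :: "'a::euclidean_space set"
  assumes \<Omega>: "open \<Omega>" "bounded \<Omega>" "\<Omega> \<noteq> {}" and \<alpha>: "0 < \<alpha>" "\<alpha> \<le> 1"
    and L: "Lambda_infty_pow \<alpha> \<Omega> < L"
  shows "\<forall>\<^sub>F p in at_top. first_eigenvalue \<alpha> p \<Omega> \<le> ennreal (L powr p)"
proof -
  define R where "R = inradius \<Omega>"
  have R: "0 < R" unfolding R_def by (rule inradius_pos[OF \<Omega>])
  have LR: "R powr (- \<alpha>) < L" using L by (simp add: Lambda_infty_pow_def R_def)
  then have "0 < L" using R by (metis order_less_trans powr_gt_zero less_irrefl)
  \<comment> \<open>The radius at which L s^\<alpha> = 1. By the choice of L it is below the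
    inradius, which leaves room for \<open>\<sigma>\<close> < \<open>\<rho>\<close>: the competitor
    lives in a ball of radius \<open>\<rho>\<close> and is at least \<sigma>^\<alpha> on the
    concentric ball of radius \<open>\<rho> - \<sigma>\<close>.\<close>
  define s0 where "s0 = max (L powr (- (1 / \<alpha>))) 0"
  have "s0 < R"
  proof -
    have "L powr (- (1 / \<alpha>)) < (R powr (- \<alpha>)) powr (- (1 / \<alpha>))"
      using LR \<alpha> R by (intro powr_less_mono2_neg) auto
    also have "\<dots> = R" using R \<alpha> by (simp add: powr_powr)
    finally show ?thesis using R by (simp add: s0_def)
  qed
  then obtain \<sigma> \<rho> where s: "s0 < \<sigma>" "\<sigma> < \<rho>" "\<rho> < R" by (meson dense)
  have \<sigma>: "0 < \<sigma>" using s(1) unfolding s0_def by linarith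
  have "1 < L * \<sigma> powr \<alpha>"
  proof -
    have "(L powr (- (1 / \<alpha>))) powr \<alpha> < \<sigma> powr \<alpha>"
      using s \<alpha> by (intro powr_less_mono2) (auto simp: s0_def)
    moreover have "(L powr (- (1 / \<alpha>))) powr \<alpha> = 1 / L"
      using \<open>0 < L\<close> \<alpha> by (subst powr_powr) (simp add: powr_minus inverse_eq_divide)
    ultimately have "1 / L < \<sigma> powr \<alpha>" by simp
    then show ?thesis using \<open>0 < L\<close> by (simp add: field_simps)
  qed
  obtain x0 where x0: "x0 \<in> \<Omega>" "\<rho> < infdist x0 (- \<Omega>)"
    using s(3) less_cSUP_iff[OF \<Omega>(3) infdist_bdd_above[OF \<Omega>(2)]] by (auto simp: R_def inradius_def)
  have sub: "ball x0 \<rho> \<subseteq> \<Omega>"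
  proof
    fix y assume "y \<in> ball x0 \<rho>"
    then show "y \<in> \<Omega>" using x0(2) infdist_le[of y "- \<Omega>" x0] by (cases "y \<in> \<Omega>") auto
  qed
  define w where "w x = (max 0 (\<rho> - dist x0 x)) powr \<alpha>" for x
  have cw: "continuous_on UNIV w" unfolding w_def using \<alpha>
      by (auto intro!: continuous_intros continuous_on_powr')
  have [measurable]: "w \<in> borel_measurable borel" using cw by (auto intro: borel_measurable_continuous_onI)
  have w0: "w x = 0" if "x \<notin> ball x0 \<rho>" for x using that by (auto simp: w_def max_def)
  then have w_off: "w x = 0" if "x \<notin> \<Omega>" for x using that sub by blast
  have w1: "\<bar>w y - w x\<bar> \<le> norm (y - x) powr \<alpha>" for x y
  proof -
    have "\<bar>w y - w x\<bar> \<le> \<bar>max 0 (\<rho> - dist x0 y) - max 0 (\<rho> - dist x0 x)\<bar> powr \<alpha>"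
      unfolding w_def using \<alpha> by (intro powr_diff_le) auto
    also have "\<dots> \<le> norm (y - x) powr \<alpha>"
      using \<alpha> dist_triangle[of x0 y x] dist_triangle[of x0 x y]
      by (intro powr_mono2) (auto simp: dist_norm[of y x, symmetric] dist_commute max_def)
    finally show ?thesis .
  qed
  have w2: "0 \<le> w x" "w x \<le> \<rho> powr \<alpha>" for x
    using \<alpha> s \<sigma> by (auto simp: w_def intro!: powr_mono2)
  define m where "m = (real DIM('a) + 1) / \<alpha>"
  have m: "0 \<le> m" "\<alpha> * m = real DIM('a) + 1" using \<alpha> by (auto simp: m_def)
  define C where "C = ennreal (max 1 ((\<rho> powr \<alpha>) powr m)) *
    (2 * emeasure lborel (ball x0 \<rho>) * (\<integral>\<^sup>+ z. ennreal (radial_weight 0 (\<alpha> * m) (norm (z::'a))) \<partial>lborel))"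
  have energy: "frac_energy (\<alpha> * p) p w \<le> C" if "m \<le> p" for p
  proof -
    have "\<bar>w y - w x\<bar> \<le> \<rho> powr \<alpha>" for x y using w2[of x] w2[of y] by linarith
    then show ?thesis unfolding C_def using m that \<alpha> w0 w1 by (intro frac_energy_Hoelder_le) auto
  qed
  have "C < \<infinity>"
    unfolding C_def using emeasure_lborel_ball_finite[of x0 \<rho>] integral_radial_weight_finite[of 0
        "\<alpha> * m", where 'a='a] m
    by (auto simp: ennreal_mult_less_top)
  then obtain c where c: "C = ennreal c" "0 \<le> c" by (cases C) auto
  define v where "v = measure lborel (ball x0 (\<rho> - \<sigma>))"
  have v: "0 < v" "emeasure lborel (ball x0 (\<rho> - \<sigma>)) = ennreal v"
    using s emeasure_lborel_ball_finite[of x0 "\<rho> - \<sigma>"] by (auto simp: v_def emeasure_eq_ennreal_measure)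
  have Lp: "ennreal (\<sigma> powr (\<alpha> * p) * v) \<le> Lp_power p w" if "0 \<le> p" for p
  proof -
    have "ennreal (\<sigma> powr (\<alpha> * p) * v) = (\<integral>\<^sup>+ x. ennreal (\<sigma> powr (\<alpha> * p)) * indicator (ball x0 (\<rho> - \<sigma>))
        x \<partial>lborel)"
      using v by (simp add: nn_integral_cmult_indicator ennreal_mult)
    also have "\<dots> \<le> Lp_power p w"
      unfolding Lp_power_lborel
    proof (intro nn_integral_mono)
      fix x
      have "\<sigma> powr (\<alpha> * p) \<le> \<bar>w x\<bar> powr p" if "x \<in> ball x0 (\<rho> - \<sigma>)"
      proof -
        have "\<sigma> powr \<alpha> \<le> w x" unfolding w_def using that \<sigma> \<alpha> by (intro powr_mono2) auto
        then have "(\<sigma> powr \<alpha>) powr p \<le> \<bar>w x\<bar> powr p" using \<open>0 \<le> p\<close> by (intro powr_mono2) auto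
        then show ?thesis by (simp add: powr_powr)
      qed
      then show "ennreal (\<sigma> powr (\<alpha> * p)) * indicator (ball x0 (\<rho> - \<sigma>)) x \<le> ennreal (\<bar>w x\<bar> powr p)"
        by (auto simp: indicator_def ennreal_leI)
    qed
    finally show ?thesis .
  qed
  have "\<forall>\<^sub>F p in at_top. c / v < (L * \<sigma> powr \<alpha>) powr p" by (rule eventually_powr_gt) fact
  then show ?thesis using eventually_gt_at_top[of 1] eventually_ge_at_top[of m]
  proof eventually_elim
    fix p :: real assume p: "c / v < (L * \<sigma> powr \<alpha>) powr p" "1 < p" "m \<le> p"
    show "first_eigenvalue \<alpha> p \<Omega> \<le> ennreal (L powr p)"
    proof (rule ccontr)
      \<comment> \<open>Arguing by contradiction supplies the real lower bound L^p for an eigenvalue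
        that is not yet known to be finite.\<close>
      assume "\<not> first_eigenvalue \<alpha> p \<Omega> \<le> ennreal (L powr p)"
      then have "ennreal (L powr p) * Lp_power p w \<le> frac_energy (\<alpha> * p) p w"
        using w_off w2 p by (intro first_eigenvalue_le_continuous[OF \<Omega>(1,2) _ _ _ cw]) auto
      also have "\<dots> \<le> ennreal c" using energy[OF p(3)] c by simp
      finally have "ennreal (L powr p) * ennreal (\<sigma> powr (\<alpha> * p) * v) \<le> ennreal c"
        using Lp[of p] p by (meson mult_left_mono order_trans zero_le less_imp_le zero_less_one)
      then have "L powr p * (\<sigma> powr (\<alpha> * p) * v) \<le> c"
        using c v by (simp add: ennreal_le_iff flip: ennreal_mult)
      moreover have "(L * \<sigma> powr \<alpha>) powr p = L powr p * \<sigma> powr (\<alpha> * p)"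
        using \<open>0 < L\<close> \<sigma> by (simp add: powr_mult powr_powr)
      ultimately show False using p(1) v(1) by (simp add: field_simps)
    qed
  qed
qed


section \<open>Compactness of the eigenfunctions and the lower bound for the eigenvalues\<close>

lemma eigenfunction_representative:
  fixes \<Omega> :: "'a::euclidean_space set"
  assumes "bounded \<Omega>" and \<alpha>: "0 < \<alpha>" "\<alpha> \<le> 1" and p: "0 < p" "4 * real DIM('a) \<le> \<alpha> * p"
    and u: "first_eigenfunction \<alpha> p \<Omega> u" "Lp_power p u = 1"
  obtains v where "continuous_rep v u" "\<And>x. x \<notin> \<Omega> \<Longrightarrow> v x = 0" "\<And>x. 0 \<le> v x" "Lp_power p v = 1"
    "frac_energy (\<alpha> * p) p v = first_eigenvalue \<alpha> p \<Omega>"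
proof -
  have u': "u \<in> W0sp (\<alpha> - real DIM('a) / p) p \<Omega>" "AE x in lebesgue. 0 \<le> u x"
      "rayleigh \<alpha> p u = first_eigenvalue \<alpha> p \<Omega>"
    using u(1) by (auto simp: first_eigenfunction_def)
  obtain v where v: "continuous_on UNIV v" "AE x in lebesgue. v x = u x" "\<And>x. x \<notin> \<Omega> \<Longrightarrow> v x = 0"
    using W0sp_continuous_representative[OF \<alpha> p \<open>bounded \<Omega>\<close> u'(1)] by metis
  have "AE x in lebesgue. 0 \<le> v x" using v(2) u'(2) by eventually_elim simp
  then have "\<And>x. 0 \<le> v x" by (rule AE_eq_continuous_imp_nonneg[OF v(1)])
  moreover have "Lp_power p v = 1" using Lp_power_cong_AE[OF v(2)] u(2) by simp
  moreover have "frac_energy (\<alpha> * p) p v = first_eigenvalue \<alpha> p \<Omega>"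
    using frac_energy_cong_AE[OF v(2)] u'(3) u(2) by (simp add: rayleigh_def divide_ennreal_def)
  ultimately show ?thesis using v by (intro that) (auto simp: continuous_rep_def)
qed

text \<open>An energy bound L^p has p-th root L, so the Morrey constant no longer depends on p. The
  exponent still varies, but only between \<alpha>/2 and \<alpha>: at distances up to 1 the weakest
  exponent bounds all others, and for the sup bound, taken against a zero outside
  \<open>\<Omega>\<close>, the largest one does once the radius is rounded up to at least 1.\<close>

lemma equi_Hoelder:
  fixes \<Omega> :: "'a::euclidean_space set"
  assumes "bounded \<Omega>" and \<alpha>: "0 < \<alpha>" "\<alpha> \<le> 1" and "0 < L"
  obtains N where "0 < N" "\<And>(v :: 'a \<Rightarrow> real) p x y. continuous_on UNIV v \<Longrightarrow> (\<And>x. x \<notin> \<Omega> \<Longrightarrow> v x = 0) \<Longrightarrow> 0 < p \<Longrightarrow>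
     4 * real DIM('a) \<le> \<alpha> * p \<Longrightarrow> frac_energy (\<alpha> * p) p v \<le> ennreal (L powr p) \<Longrightarrow>
     \<bar>v x\<bar> \<le> N \<and> (norm (x - y) \<le> 1 \<longrightarrow> \<bar>v x - v y\<bar> \<le> N * norm (x - y) powr (\<alpha> / 2))"
proof -
  obtain C where C: "0 < C" "\<And>(f :: 'a \<Rightarrow> real) p e x y.
       continuous_on UNIV f \<Longrightarrow> 4 * real DIM('a) \<le> \<alpha> * p \<Longrightarrow> 0 < e \<Longrightarrow>
       frac_energy (\<alpha> * p) p f \<le> ennreal e \<Longrightarrow>
       \<bar>f x - f y\<bar> \<le> C * e powr (1 / p) * norm (x - y) powr (\<alpha> - 2 * real DIM('a) / p)"
    using fractional_Morrey[OF \<alpha>, where 'a='a] by blast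
  have "\<Omega> \<noteq> UNIV" using \<open>bounded \<Omega>\<close> not_bounded_UNIV by metis
  then obtain y0 where y0: "y0 \<notin> \<Omega>" by blast
  obtain B where B: "\<Omega> \<subseteq> ball y0 B" using bounded_subset_ballD[OF \<open>bounded \<Omega>\<close>, of y0] by blast
  define B' where "B' = max 1 B"
  show ?thesis
  proof (rule that[of "C * L * B' powr \<alpha>"])
    show "0 < C * L * B' powr \<alpha>" using C(1) \<open>0 < L\<close> by (simp add: B'_def)
    fix v :: "'a \<Rightarrow> real" and p x y
    assume v: "continuous_on UNIV v" "\<And>x. x \<notin> \<Omega> \<Longrightarrow> v x = 0" and p: "0 < p" "4 * real DIM('a) \<le> \<alpha> * p"
      and E: "frac_energy (\<alpha> * p) p v \<le> ennreal (L powr p)"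
    define \<gamma> where "\<gamma> = \<alpha> - 2 * real DIM('a) / p"
    have \<gamma>: "\<alpha> / 2 \<le> \<gamma>" "\<gamma> \<le> \<alpha>" using p by (simp_all add: \<gamma>_def field_simps)
    have M: "\<bar>v x - v y\<bar> \<le> C * L * norm (x - y) powr \<gamma>" for x y
      using C(2)[OF v(1) p(2) _ E, of x y] p \<open>0 < L\<close> by (simp add: powr_powr \<gamma>_def)
    have B1: "1 \<le> B' powr \<alpha>" using \<alpha> by (intro ge_one_powr_ge_zero) (auto simp: B'_def)
    have "\<bar>v x\<bar> \<le> C * L * B' powr \<alpha>"
    proof (cases "x \<in> \<Omega>")
      case True
      have "\<bar>v x\<bar> \<le> C * L * norm (x - y0) powr \<gamma>" using M[of x y0] v(2)[OF y0] by simp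
      also have "norm (x - y0) powr \<gamma> \<le> B' powr \<gamma>"
        using B True \<gamma> \<alpha> by (intro powr_mono2) (auto simp: B'_def dist_norm norm_minus_commute
            subset_iff less_imp_le le_max_iff_disj)
      also have "B' powr \<gamma> \<le> B' powr \<alpha>" using \<gamma> by (intro powr_mono) (auto simp: B'_def)
      finally show ?thesis using C(1) \<open>0 < L\<close> by simp
    next
      case False
      then show ?thesis using v(2) C(1) \<open>0 < L\<close> by simp
    qed
    moreover have "\<bar>v x - v y\<bar> \<le> C * L * B' powr \<alpha> * norm (x - y) powr (\<alpha> / 2)" if "norm (x - y) \<le> 1"
    proof -
      have "\<bar>v x - v y\<bar> \<le> C * L * norm (x - y) powr \<gamma>" by (rule M)
      also have "norm (x - y) powr \<gamma> \<le> norm (x - y) powr (\<alpha> / 2)"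
        using \<gamma> that by (cases "x = y") (auto intro!: powr_mono')
      also have "C * L * norm (x - y) powr (\<alpha> / 2) \<le> C * L * B' powr \<alpha> * norm (x - y) powr (\<alpha> / 2)"
        using mult_left_mono[OF B1, of "C * L * norm (x - y) powr (\<alpha> / 2)"] C(1) \<open>0 < L\<close>
            by (simp add: mult_ac)
      finally show ?thesis using C(1) \<open>0 < L\<close> by simp
    qed
    ultimately show "\<bar>v x\<bar> \<le> C * L * B' powr \<alpha> \<and> (norm (x - y) \<le> 1 \<longrightarrow> \<bar>v x - v y\<bar>
        \<le> C * L * B' powr \<alpha> * norm (x - y) powr (\<alpha> / 2))"
      by blast
  qed
qed

lemma equi_Hoelder_convergent_subsequence:
  fixes v :: "nat \<Rightarrow> 'a::euclidean_space \<Rightarrow> real"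
  assumes "bounded \<Omega>" "0 < \<alpha>" "0 < N" and off: "\<And>k x. x \<notin> \<Omega> \<Longrightarrow> v k x = 0"
    and bound: "\<And>k x. \<bar>v k x\<bar> \<le> N"
    and Hoelder: "\<And>k x y. norm (x - y) \<le> 1 \<Longrightarrow> \<bar>v k x - v k y\<bar> \<le> N * norm (x - y) powr (\<alpha> / 2)"
  obtains r :: "nat \<Rightarrow> nat" and U where "strict_mono r" "uniform_limit UNIV (\<lambda>k. v (r k)) U sequentially"
proof -
  have equi: "\<exists>d>0. \<forall>n y. y \<in> closure \<Omega> \<and> norm (x - y) < d \<longrightarrow> norm (v n x - v n y) < e" if "0 < e" for x e
  proof -
    define d where "d = min 1 ((e / (2 * N)) powr (2 / \<alpha>))"
    have "0 < d" using that assms by (simp add: d_def)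
    moreover have "norm (v n x - v n y) < e" if "norm (x - y) < d" for n y
    proof -
      have "\<bar>v n x - v n y\<bar> \<le> N * norm (x - y) powr (\<alpha> / 2)" using that by (intro Hoelder) (simp add: d_def)
      also have "\<dots> \<le> N * ((e / (2 * N)) powr (2 / \<alpha>)) powr (\<alpha> / 2)"
        using that assms(2,3) by (intro mult_left_mono powr_mono2) (auto simp: d_def)
      also have "\<dots> = e / 2" using assms(2,3) \<open>0 < e\<close> by (simp add: powr_powr)
      finally show ?thesis using \<open>0 < e\<close> by simp
    qed
    ultimately show ?thesis by blast
  qed
  obtain g and r :: "nat \<Rightarrow> nat" where r: "strict_mono r"
    and g: "\<And>e. 0 < e \<Longrightarrow> \<exists>M. \<forall>n x. M \<le> n \<and> x \<in> closure \<Omega> \<longrightarrow> norm (v (r n) x - g x) < e"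
    by (rule Arzela_Ascoli[of "closure \<Omega>" v N])
       (use \<open>bounded \<Omega>\<close> bound equi in \<open>auto simp: compact_closure\<close>)
  \<comment> \<open>The theorem of Arzela and Ascoli gives the limit on the closure only; outside it
    every \<open>v k\<close> is zero.\<close>
  define U where "U x = (if x \<in> closure \<Omega> then g x else 0)" for x
  have "uniform_limit UNIV (\<lambda>k. v (r k)) U sequentially"
  proof (rule uniform_limitI)
    fix e :: real assume "0 < e"
    then obtain M where M: "\<And>n x. M \<le> n \<Longrightarrow> x \<in> closure \<Omega> \<Longrightarrow> norm (v (r n) x - g x) < e" using g by blast
    have "dist (v (r n) x) (U x) < e" if "M \<le> n" for n x
    proof (cases "x \<in> closure \<Omega>")
      case True
      then show ?thesis using M[OF that True] by (simp add: U_def dist_real_def)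
    next
      case False
      then have "x \<notin> \<Omega>" using closure_subset[of \<Omega>] by blast
      then show ?thesis using False off \<open>0 < e\<close> by (simp add: U_def)
    qed
    then show "\<forall>\<^sub>F n in sequentially. \<forall>x\<in>UNIV. dist (v (r n) x) (U x) < e"
      by (auto simp: eventually_sequentially)
  qed
  then show ?thesis using that r by blast
qed

lemma uniform_limit_abs_lt:
  fixes v :: "nat \<Rightarrow> 'a \<Rightarrow> real"
  assumes "uniform_limit UNIV v U sequentially" "0 < e"
  shows "\<forall>\<^sub>F k in sequentially. \<forall>x. \<bar>v k x - U x\<bar> < e"
  using uniform_limitD[OF assms] by (simp add: dist_real_def)

text \<open>Otherwise \<open>\<parallel>v\<^sub>k\<parallel>\<^sub>p\<close> would decay geometrically in \<open>p\<close>.\<close>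

lemma limit_attains_one:
  fixes v :: "nat \<Rightarrow> 'a::euclidean_space \<Rightarrow> real"
  assumes \<Omega>: "bounded \<Omega>" "open \<Omega>" and lim: "uniform_limit UNIV v U sequentially"
      and U: "continuous_on UNIV U" "\<And>x. x \<notin> \<Omega> \<Longrightarrow> U x = 0"
    and v: "\<And>k x. x \<notin> \<Omega> \<Longrightarrow> v k x = 0" "\<And>k x. 0 \<le> v k x" "\<And>k. Lp_power (p k) (v k) = 1"
    and p: "filterlim p at_top sequentially"
  obtains x where "x \<in> \<Omega>" "1 \<le> U x"
proof -
  have "\<exists>x. 1 \<le> U x"
  proof (rule ccontr)
    assume "\<nexists>x. 1 \<le> U x"
    then have lt: "U x < 1" for x by (meson not_le)
    have "\<exists>s. 0 < s \<and> s < 1 \<and> (\<forall>x. U x \<le> s)"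
    proof (cases "\<Omega> = {}")
      case True
      then show ?thesis using U by (intro exI[of _ "1/2"]) auto
    next
      case False
      have "compact (closure \<Omega>)" "closure \<Omega> \<noteq> {}" "continuous_on (closure \<Omega>) U"
        using \<Omega> False continuous_on_subset[OF U(1)] by (simp_all add: compact_closure)
      then obtain z where z: "\<forall>x\<in>closure \<Omega>. U x \<le> U z"
        using continuous_attains_sup by metis
      have "U x \<le> max (1/2) (U z)" for x
        using z U(2)[of x] closure_subset[of \<Omega>] by (cases "x \<in> \<Omega>") (auto simp: le_max_iff_disj)
      then show ?thesis using lt by (intro exI[of _ "max (1/2) (U z)"]) auto
    qed
    then obtain s where s: "0 < s" "s < 1" "\<And>x. U x \<le> s" by blast
    \<comment> \<open>The margin \<open>s' - s\<close> absorbs the uniform error and still leaves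
      \<open>s'\<close> below 1.\<close>
    define s' where "s' = (s + 1) / 2"
    have s': "0 < s'" "s' < 1" "s < s'" using s by (auto simp: s'_def)
    have fin: "emeasure lborel \<Omega> < \<infinity>" using emeasure_bounded_finite[OF \<Omega>(1)] by simp
    define m where "m = measure lborel \<Omega>"
    have m: "emeasure lborel \<Omega> = ennreal m" using fin by (simp add: m_def emeasure_eq_ennreal_measure)
    have "\<forall>\<^sub>F q in at_top. m * s' powr q < 1 * 1 powr q"
      using s' by (intro eventually_mult_powr_less) auto
    then have "\<forall>\<^sub>F k in sequentially. m * s' powr p k < 1" using p by (auto simp: filterlim_iff)
    moreover have "\<forall>\<^sub>F k in sequentially. \<forall>x. \<bar>v k x - U x\<bar> < s' - s"
      using s' by (intro uniform_limit_abs_lt[OF lim]) auto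
    moreover have "\<forall>\<^sub>F k in sequentially. 0 < p k" using p by (auto simp: filterlim_at_top_dense)
    ultimately have "\<forall>\<^sub>F k in sequentially. False"
    proof eventually_elim
      fix k assume k: "m * s' powr p k < 1" "\<forall>x. \<bar>v k x - U x\<bar> < s' - s" "0 < p k"
      have "Lp_power (p k) (v k) \<le> (\<integral>\<^sup>+ x. ennreal (s' powr p k) * indicator \<Omega> x \<partial>lborel)"
        unfolding Lp_power_lborel
      proof (intro nn_integral_mono)
        fix x
        have "v k x \<le> s'" using k(2)[rule_format, of x] s(3)[of x] by linarith
        then have "\<bar>v k x\<bar> powr p k \<le> s' powr p k" using v(2) k(3) by (intro powr_mono2) auto
        then show "ennreal (\<bar>v k x\<bar> powr p k) \<le> ennreal (s' powr p k) * indicator \<Omega> x"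
          using v(1)[of x k] k(3) by (auto simp: indicator_def ennreal_leI)
      qed
      also have "\<dots> = ennreal (m * s' powr p k)"
        using \<Omega>(2) m s' by (subst nn_integral_cmult_indicator) (simp_all add: mult.commute ennreal_mult'')
      also have "\<dots> < 1" using k(1) by (simp add: ennreal_less_one_iff)
      finally show False using v(3)[of k] by simp
    qed
    then show False by simp
  qed
  then show ?thesis using U(2) that by force
qed

text \<open>The strict inequality at (x, y) is open in both points and stable under uniform
  convergence. So on a product of small balls the quotients of \<open>v k\<close> are at least some
  L' > L, and the fixed volume of that product is negligible against the growth of (L' /
  L)^p.\<close>

lemma eventually_energy_ge:
  fixes v :: "nat \<Rightarrow> 'a::euclidean_space \<Rightarrow> real"
  assumes lim: "uniform_limit UNIV v U sequentially" and U: "continuous_on UNIV U"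
    and p: "filterlim p at_top sequentially" and "0 < \<alpha>" "0 < L" and xy: "L * norm (y - x) powr \<alpha>
        < U x - U y"
  shows "\<forall>\<^sub>F k in sequentially. ennreal (L powr p k) \<le> frac_energy (\<alpha> * p k) (p k) (v k)"
proof -
  have "x \<noteq> y" using xy by auto
  define t where "t = norm (y - x) powr \<alpha>"
  have t: "0 < t" using \<open>x \<noteq> y\<close> by (simp add: t_def)
  \<comment> \<open>The mean of L and of the quotient of \<open>U\<close> between the two
    points.\<close>
  define L' where "L' = L + (U x - U y - L * t) / (2 * t)"
  have "L' * t = (U x - U y + L * t) / 2" using t by (simp add: L'_def field_simps)
  then have L': "L < L'" "L' * t < U x - U y"
    using xy t by (auto simp: L'_def t_def[symmetric])
  define \<Phi> where "\<Phi> z = U (fst z) - U (snd z) - L' * norm (snd z - fst z) powr \<alpha>" for z :: "'a \<times> 'a"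
  \<comment> \<open>Four of these make up the gap at (x, y): more than two remain on the balls, and
    the uniform errors at two points use up at most two.\<close>
  define \<epsilon> where "\<epsilon> = (U x - U y - L' * t) / 4"
  have \<epsilon>: "0 < \<epsilon>" using L' by (simp add: \<epsilon>_def)
  have "continuous_on UNIV \<Phi>"
    unfolding \<Phi>_def using \<open>0 < \<alpha>\<close> by (auto intro!: continuous_intros continuous_on_compose2[OF U]
        continuous_on_powr')
  then have "open {z. \<epsilon> * 2 < \<Phi> z}" by (intro open_Collect_less continuous_intros)
  moreover have "(x, y) \<in> {z. \<epsilon> * 2 < \<Phi> z}" using \<epsilon> by (simp add: \<Phi>_def \<epsilon>_def t_def field_simps)
  ultimately obtain A B where AB: "open A" "open B" "(x, y) \<in> A \<times> B" "A \<times> B \<subseteq> {z. \<epsilon> * 2 < \<Phi> z}"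
    by (rule open_prod_elim) 
  obtain r1 r2 where r12: "0 < r1" "ball x r1 \<subseteq> A" "0 < r2" "ball y r2 \<subseteq> B"
    using AB open_contains_ball by (metis mem_Sigma_iff)
  define r where "r = min r1 r2"
  have r: "0 < r" using r12 by (simp add: r_def)
  have near: "\<epsilon> * 2 < U x' - U y' - L' * norm (y' - x') powr \<alpha>" if "x' \<in> ball x r" "y' \<in> ball y r" for x' y'
  proof -
    have "(x', y') \<in> A \<times> B" using that r12 by (auto simp: r_def)
    then show ?thesis using AB(4) by (auto simp: \<Phi>_def)
  qed
  define m where "m = measure lborel (ball x r) * measure lborel (ball y r)"
  have m: "0 < m" "emeasure lborel (ball x r) * emeasure lborel (ball y r) = ennreal m"
    using r emeasure_lborel_ball_finite[of x r] emeasure_lborel_ball_finite[of y r]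
    by (auto simp: m_def emeasure_eq_ennreal_measure ennreal_mult)
  have "\<forall>\<^sub>F q in at_top. 1 * L powr q < m * L' powr q"
    using L' \<open>0 < L\<close> m by (intro eventually_mult_powr_less) auto
  then have "\<forall>\<^sub>F k in sequentially. L powr p k < m * L' powr p k" using p by (auto simp: filterlim_iff)
  moreover have "\<forall>\<^sub>F k in sequentially. \<forall>x. \<bar>v k x - U x\<bar> < \<epsilon>"
    using \<epsilon> by (intro uniform_limit_abs_lt[OF lim]) auto
  moreover have "\<forall>\<^sub>F k in sequentially. 0 < p k" using p by (auto simp: filterlim_at_top_dense)
  ultimately show ?thesis
  proof eventually_elim
    fix k assume k: "L powr p k < m * L' powr p k" "\<forall>x. \<bar>v k x - U x\<bar> < \<epsilon>" "0 < p k"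
    have "ennreal (L powr p k) \<le> ennreal (L' powr p k) * ennreal m"
      using k(1) m by (simp add: ennreal_leI mult.commute flip: ennreal_mult)
    also have "\<dots> \<le> frac_energy (\<alpha> * p k) (p k) (v k)"
      unfolding frac_energy_lborel m(2)[symmetric]
    proof (rule double_integral_balls_ge)
      fix x' y' assume xy': "x' \<in> ball x r" "y' \<in> ball y r"
      define d where "d = norm (y' - x')"
      have *: "L' * d powr \<alpha> \<le> \<bar>v k y' - v k x'\<bar>"
        using near[OF xy'] k(2)[rule_format, of x'] k(2)[rule_format, of y'] L' \<open>0 < L\<close>
            by (auto simp: d_def)
      have "0 < d"
      proof (rule ccontr)
        assume "\<not> 0 < d"
        then have "x' = y'" by (simp add: d_def)
        then show False using near[OF xy'] \<epsilon> by simp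
      qed
      then have "L' \<le> \<bar>v k y' - v k x'\<bar> / d powr \<alpha>" using * by (simp add: field_simps)
      then have "L' powr p k \<le> (\<bar>v k y' - v k x'\<bar> / d powr \<alpha>) powr p k"
        using L' \<open>0 < L\<close> k(3) by (intro powr_mono2) auto
      also have "\<dots> = \<bar>v k y' - v k x'\<bar> powr p k / d powr (\<alpha> * p k)"
        using \<open>0 < d\<close> by (simp add: powr_divide powr_powr)
      finally show "ennreal (L' powr p k) \<le> ennreal (\<bar>v k y' - v k x'\<bar> powr p k / norm (y' - x') powr (\<alpha>
          * p k))"
        by (simp add: d_def ennreal_leI)
    qed
    finally show "ennreal (L powr p k) \<le> frac_energy (\<alpha> * p k) (p k) (v k)" .
  qed
qed

lemma eventually_energy_ge_Lambda:
  fixes v :: "nat \<Rightarrow> 'a::euclidean_space \<Rightarrow> real"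
  assumes \<Omega>: "bounded \<Omega>" "open \<Omega>" "\<Omega> \<noteq> {}" and \<alpha>: "0 < \<alpha>" and lim: "uniform_limit UNIV v U sequentially"
    and U: "continuous_on UNIV U" "\<And>x. x \<notin> \<Omega> \<Longrightarrow> U x = 0"
    and p: "filterlim p at_top sequentially" and x: "x \<in> \<Omega>" "1 \<le> U x"
    and L: "0 < L" "L < Lambda_infty_pow \<alpha> \<Omega>"
  shows "\<forall>\<^sub>F k in sequentially. ennreal (L powr p k) \<le> frac_energy (\<alpha> * p k) (p k) (v k)"
proof -
  have "- \<Omega> \<noteq> {}" using \<Omega>(1) not_bounded_UNIV by (metis Compl_empty_eq double_complement)
  then obtain y where y: "y \<in> - \<Omega>" "infdist x (- \<Omega>) = dist x y"
    using infdist_attains_inf[of "- \<Omega>" x] \<Omega>(2) by (auto simp: closed_def)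
  have "norm (y - x) \<le> inradius \<Omega>"
    using cSUP_upper[OF x(1) infdist_bdd_above[OF \<Omega>(1)]] y(2)
        by (simp add: inradius_def dist_norm norm_minus_commute)
  then have "norm (y - x) powr \<alpha> \<le> inradius \<Omega> powr \<alpha>" using \<alpha> by (intro powr_mono2) auto
  then have "L * norm (y - x) powr \<alpha> \<le> L * inradius \<Omega> powr \<alpha>" using L by simp
  also have "\<dots> < Lambda_infty_pow \<alpha> \<Omega> * inradius \<Omega> powr \<alpha>"
    using L inradius_pos[OF \<Omega>(2,1,3)] by simp
  also have "\<dots> = 1" using inradius_pos[OF \<Omega>(2,1,3)] by (simp add: Lambda_infty_pow_def flip: powr_add)
  also have "1 \<le> U x - U y" using x U(2) y by simp
  finally show ?thesis by (intro eventually_energy_ge[OF lim U(1) p \<alpha> L(1)])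
qed

section \<open>The nonlocal flux\<close>

lemma signed_powr_mono:
  assumes "0 < r" "s \<le> t"
  shows "signed_powr r s \<le> signed_powr r t"
proof -
  consider "0 \<le> s" | "s < 0" "0 \<le> t" | "t < 0" using assms by linarith
  then show ?thesis
  proof cases
    case 1
    then show ?thesis using assms powr_mono2[of r s t] by (auto simp: signed_powr_def sgn_real_def)
  next
    case 2
    then show ?thesis by (auto simp: signed_powr_def sgn_real_def intro: order_trans[of _ 0])
  next
    case 3
    then show ?thesis using assms powr_mono2[of r "-t" "-s"] by (auto simp: signed_powr_def sgn_real_def)
  qed
qed

lemma signed_powr_measurable [measurable]: "signed_powr r \<in> borel_measurable borel"
  unfolding signed_powr_def by measurable

text \<open>Up to the factor p, the derivative of the energy density at \<open>\<Phi>\<close> in the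
  direction \<open>\<eta>\<close>.\<close>

definition flux :: "real \<Rightarrow> real \<Rightarrow> ('a::euclidean_space \<Rightarrow> real) \<Rightarrow> ('a \<Rightarrow> real) \<Rightarrow> 'a \<Rightarrow> 'a \<Rightarrow> real" where
  "flux \<alpha> p \<Phi> \<eta> x y = signed_powr (p - 1) (\<Phi> y - \<Phi> x) * (\<eta> y - \<eta> x) / norm (y - x) powr (\<alpha> * p)"

text \<open>The positive and the negative part of the flux are integrated separately in
  \<open>ennreal\<close>. Their difference is never formed, so they can be compared before anything
  is known about convergence.\<close>

definition flux_pos :: "real \<Rightarrow> real \<Rightarrow> ('a::euclidean_space \<Rightarrow> real) \<Rightarrow> ('a \<Rightarrow> real) \<Rightarrow> ennreal" where
  "flux_pos \<alpha> p \<Phi> \<eta> = (\<integral>\<^sup>+ x. (\<integral>\<^sup>+ y. ennreal (flux \<alpha> p \<Phi> \<eta> x y) \<partial>lborel) \<partial>lborel)"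

definition flux_neg :: "real \<Rightarrow> real \<Rightarrow> ('a::euclidean_space \<Rightarrow> real) \<Rightarrow> ('a \<Rightarrow> real) \<Rightarrow> ennreal" where
  "flux_neg \<alpha> p \<Phi> \<eta> = (\<integral>\<^sup>+ x. (\<integral>\<^sup>+ y. ennreal (- flux \<alpha> p \<Phi> \<eta> x y) \<partial>lborel) \<partial>lborel)"

text \<open>Convexity of \<open>\<bar>\<cdot>\<bar>\<^sup>p\<close> at the competitor \<open>max U \<Phi>\<close>; the monotonicity of \<open>signed_powr\<close> replaces
  the competitor by the test function inside the flux.\<close>

lemma energy_density_max_le:
  fixes U \<Phi> :: "'a \<Rightarrow> real"
  assumes "1 < p" and \<eta>: "\<And>x. \<eta> x = max (\<Phi> x - U x) 0" and W: "\<And>x. W x = max (U x) (\<Phi> x)"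
  shows "\<bar>W y - W x\<bar> powr p \<le> \<bar>U y - U x\<bar> powr p + p * (signed_powr (p - 1) (\<Phi> y - \<Phi> x) * (\<eta> y - \<eta> x))"
proof -
  have 1: "\<bar>W y - W x\<bar> powr p + p * (signed_powr (p - 1) (W y - W x) * ((U y - U x) - (W y - W x)))
      \<le> \<bar>U y - U x\<bar> powr p"
    by (rule powr_tangent[OF \<open>1 < p\<close>])
  have 2: "(U y - U x) - (W y - W x) = - (\<eta> y - \<eta> x)"
    by (auto simp: \<eta> W max_def)
  have "signed_powr (p - 1) (W y - W x) * (\<eta> y - \<eta> x) \<le> signed_powr (p - 1) (\<Phi> y - \<Phi> x) * (\<eta> y - \<eta> x)"
  proof (cases "\<eta> x \<le> \<eta> y")
    case True
    have "signed_powr (p - 1) (W y - W x) \<le> signed_powr (p - 1) (\<Phi> y - \<Phi> x) \<or> \<eta> y = \<eta> x"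
    proof (cases "\<eta> y = \<eta> x")
      case False
      \<comment> \<open>\<open>\<eta> y\<close> is positive here, so \<open>W y = \<Phi> y\<close>,
        whereas \<open>W x\<close> is at least \<open>\<Phi> x\<close>. The case of decreasing
        \<open>\<eta>\<close> is the mirror image.\<close>
      then have "W y - W x \<le> \<Phi> y - \<Phi> x" using True by (auto simp: \<eta> W max_def split: if_splits)
      then show ?thesis using \<open>1 < p\<close> by (simp add: signed_powr_mono)
    qed auto
    then show ?thesis using True by (auto intro: mult_right_mono)
  next
    case False
    then have "\<Phi> y - \<Phi> x \<le> W y - W x" by (auto simp: \<eta> W max_def split: if_splits)
    then show ?thesis using False \<open>1 < p\<close> by (intro mult_right_mono_neg signed_powr_mono) auto
  qed
  then have "p * (signed_powr (p - 1) (W y - W x) * (\<eta> y - \<eta> x))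
      \<le> p * (signed_powr (p - 1) (\<Phi> y - \<Phi> x) * (\<eta> y - \<eta> x))"
    using \<open>1 < p\<close> by simp
  then show ?thesis using 1 unfolding 2 by (simp add: algebra_simps)
qed

text \<open>The pointwise convexity inequality is integrated with the negative part of the flux
  moved to the left, so that both sides are sums of nonnegative terms.\<close>

lemma frac_energy_max_le:
  fixes U \<Phi> :: "'a::euclidean_space \<Rightarrow> real"
  assumes "1 < p" and cont: "continuous_on UNIV U" "continuous_on UNIV \<Phi>"
    and \<eta>: "\<And>x. \<eta> x = max (\<Phi> x - U x) 0" and W: "\<And>x. W x = max (U x) (\<Phi> x)"
  shows "frac_energy (\<alpha> * p) p W + ennreal p * flux_neg \<alpha> p \<Phi> \<eta>
      \<le> frac_energy (\<alpha> * p) p U + ennreal p * flux_pos \<alpha> p \<Phi> \<eta>"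
proof -
  have [measurable]: "U \<in> borel_measurable borel" "\<Phi> \<in> borel_measurable borel"
    using cont by (auto intro: borel_measurable_continuous_onI)
  have [measurable]: "\<eta> \<in> borel_measurable borel" "W \<in> borel_measurable borel"
    unfolding \<eta>[abs_def] W[abs_def] by measurable
  have [measurable]: "case_prod (flux \<alpha> p \<Phi> \<eta>) \<in> borel_measurable (borel \<Otimes>\<^sub>M borel)"
    unfolding flux_def case_prod_beta by measurable
  have "frac_energy (\<alpha> * p) p W + ennreal p * flux_neg \<alpha> p \<Phi> \<eta>
      = (\<integral>\<^sup>+ x. (\<integral>\<^sup>+ y. ennreal (\<bar>W y - W x\<bar> powr p / norm (y - x) powr (\<alpha> * p)) + ennreal p * ennreal
          (- flux \<alpha> p \<Phi> \<eta> x y) \<partial>lborel) \<partial>lborel)"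
    unfolding frac_energy_lborel flux_neg_def by (simp add: nn_integral_add nn_integral_cmult)
  also have "\<dots> \<le> (\<integral>\<^sup>+ x. (\<integral>\<^sup>+ y. ennreal (\<bar>U y - U x\<bar> powr p / norm (y - x) powr (\<alpha> * p)) + ennreal p *
      ennreal (flux \<alpha> p \<Phi> \<eta> x y) \<partial>lborel) \<partial>lborel)"
  proof (intro nn_integral_mono)
    fix x y :: 'a
    define k where "k = norm (y - x) powr (\<alpha> * p)"
    define a where "a = \<bar>W y - W x\<bar> powr p / k"
    define b where "b = \<bar>U y - U x\<bar> powr p / k"
    define c where "c = flux \<alpha> p \<Phi> \<eta> x y"
    have "0 \<le> a" "0 \<le> b" by (auto simp: a_def b_def k_def)
    have "\<bar>W y - W x\<bar> powr p \<le> \<bar>U y - U x\<bar> powr p + p * (signed_powr (p - 1) (\<Phi> y - \<Phi> x) * (\<eta> y - \<eta> x))"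
      by (rule energy_density_max_le[OF \<open>1 < p\<close> \<eta> W])
    from divide_right_mono[OF this, of k] have "a \<le> b + p * c"
      by (simp add: a_def b_def c_def flux_def k_def add_divide_distrib)
    have "ennreal a + ennreal p * ennreal (- c) \<le> ennreal b + ennreal p * ennreal c"
    proof (cases "0 \<le> c")
      case True
      have "ennreal a \<le> ennreal (b + p * c)" using \<open>a \<le> b + p * c\<close> by (rule ennreal_leI)
      then show ?thesis using True \<open>0 \<le> b\<close> \<open>1 < p\<close> by (simp add: ennreal_neg ennreal_mult)
    next
      case False
      have "0 \<le> p * - c" using False \<open>1 < p\<close> by (intro mult_nonneg_nonneg) auto
      have "ennreal a + ennreal p * ennreal (- c) = ennreal (a + p * - c)"
        using False \<open>0 \<le> a\<close> \<open>1 < p\<close> \<open>0 \<le> p * - c\<close> by (simp only: ennreal_plus ennreal_mult)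
      also have "\<dots> \<le> ennreal b" using \<open>a \<le> b + p * c\<close> by (intro ennreal_leI) simp
      finally show ?thesis using False by (simp add: ennreal_neg)
    qed
    then show "ennreal (\<bar>W y - W x\<bar> powr p / norm (y - x) powr (\<alpha> * p)) + ennreal p * ennreal (- flux \<alpha>
        p \<Phi> \<eta> x y)
        \<le> ennreal (\<bar>U y - U x\<bar> powr p / norm (y - x) powr (\<alpha> * p)) + ennreal p * ennreal (flux \<alpha> p \<Phi> \<eta> x y)"
      by (simp add: a_def b_def c_def k_def)
  qed
  also have "\<dots> = frac_energy (\<alpha> * p) p U + ennreal p * flux_pos \<alpha> p \<Phi> \<eta>"
    unfolding frac_energy_lborel flux_pos_def by (simp add: nn_integral_add nn_integral_cmult)
  finally show ?thesis .
qed

lemma ennreal_mult_left_le_cancel: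
  fixes x y :: ennreal
  assumes "0 < p" "ennreal p * x \<le> ennreal p * y"
  shows "x \<le> y"
proof -
  have "ennreal (1 / p) * (ennreal p * x) \<le> ennreal (1 / p) * (ennreal p * y)"
    using assms(2) by (rule mult_left_mono) simp
  then show ?thesis using assms(1) by (simp add: mult.assoc[symmetric] ennreal_mult[symmetric])
qed

text \<open>The competitor \<open>max v \<Phi>\<close> is admissible because
  \<open>\<Phi> \<le> 0\<close> off \<open>\<Omega>\<close>. By the tangent inequality at
  \<open>v\<close> its p-th mass exceeds 1 by at least p times the weighted integral, and by
  convexity its energy exceeds the eigenvalue by at most p times the net flux. Finiteness of the
  eigenvalue lets its two copies cancel, and then p divides out.\<close>

lemma supersolution_flux_inequality:
  fixes v \<Phi> :: "'a::euclidean_space \<Rightarrow> real"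
  assumes \<Omega>: "open \<Omega>" "bounded \<Omega>" and "1 < p" "0 \<le> l" and l: "first_eigenvalue \<alpha> p \<Omega> = ennreal l"
    and v: "continuous_on UNIV v" "\<And>x. x \<notin> \<Omega> \<Longrightarrow> v x = 0" "\<And>x. 0 \<le> v x" "Lp_power p v = 1"
      "frac_energy (\<alpha> * p) p v = first_eigenvalue \<alpha> p \<Omega>"
    and \<Phi>: "continuous_on UNIV \<Phi>" "\<And>x. x \<notin> \<Omega> \<Longrightarrow> \<Phi> x \<le> 0"
    and \<eta>: "\<And>x. \<eta> x = max (\<Phi> x - v x) 0"
  shows "ennreal l * (\<integral>\<^sup>+ x. ennreal (v x powr (p - 1) * \<eta> x) \<partial>lborel) + flux_neg \<alpha> p \<Phi> \<eta>
      \<le> flux_pos \<alpha> p \<Phi> \<eta>"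
proof -
  define X where "X = (\<integral>\<^sup>+ x. ennreal (v x powr (p - 1) * \<eta> x) \<partial>lborel)"
  define W where "W x = max (v x) (\<Phi> x)" for x
  have [measurable]: "v \<in> borel_measurable borel" "\<Phi> \<in> borel_measurable borel"
    using v \<Phi> by (auto intro: borel_measurable_continuous_onI)
  have [measurable]: "\<eta> \<in> borel_measurable borel" unfolding \<eta>[abs_def] by measurable
  have "1 + ennreal p * X = (\<integral>\<^sup>+ x. ennreal (\<bar>v x\<bar> powr p) + ennreal p * ennreal (v x powr (p - 1) * \<eta>
      x) \<partial>lborel)"
    using v(4) unfolding X_def Lp_power_lborel by (simp add: nn_integral_add nn_integral_cmult)
  also have "\<dots> \<le> Lp_power p W"
    unfolding Lp_power_lborel
  proof (intro nn_integral_mono)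
    fix x
    have "\<bar>v x\<bar> powr p + p * (v x powr (p - 1) * \<eta> x) \<le> \<bar>W x\<bar> powr p"
    proof (cases "v x = 0")
      case True
      then show ?thesis using \<open>1 < p\<close> by simp
    next
      case False
      then have "signed_powr (p - 1) (v x) = v x powr (p - 1)" using v(3)[of x]
          by (simp add: signed_powr_def)
      moreover have "W x - v x = \<eta> x" by (auto simp: W_def \<eta> max_def)
      ultimately show ?thesis using powr_tangent[OF \<open>1 < p\<close>, of "v x" "W x"] by simp
    qed
    then have "ennreal (\<bar>v x\<bar> powr p + p * (v x powr (p - 1) * \<eta> x)) \<le> ennreal (\<bar>W x\<bar> powr p)"
        by (rule ennreal_leI)
    then show "ennreal (\<bar>v x\<bar> powr p) + ennreal p * ennreal (v x powr (p - 1) * \<eta> x)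
        \<le> ennreal (\<bar>W x\<bar> powr p)"
      using \<open>1 < p\<close> by (simp add: \<eta> ennreal_mult)
  qed
  finally have "ennreal l * (1 + ennreal p * X) \<le> ennreal l * Lp_power p W" by (intro mult_left_mono) auto
  also have "\<dots> \<le> frac_energy (\<alpha> * p) p W"
  proof (rule first_eigenvalue_le_continuous[OF \<Omega> \<open>1 < p\<close> \<open>0 \<le> l\<close>])
    show "continuous_on UNIV W" unfolding W_def by (intro continuous_intros v \<Phi>)
    show "0 \<le> W x" for x using v(3)[of x] by (simp add: W_def le_max_iff_disj)
    show "W x = 0" if "x \<notin> \<Omega>" for x using v(2)[OF that] \<Phi>(2)[OF that] by (simp add: W_def)
  qed (simp add: l)
  finally have "ennreal l * (1 + ennreal p * X) + ennreal p * flux_neg \<alpha> p \<Phi> \<eta>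
      \<le> frac_energy (\<alpha> * p) p W + ennreal p * flux_neg \<alpha> p \<Phi> \<eta>"
    by (rule add_right_mono)
  also have "\<dots> \<le> frac_energy (\<alpha> * p) p v + ennreal p * flux_pos \<alpha> p \<Phi> \<eta>"
    by (rule frac_energy_max_le[OF \<open>1 < p\<close> v(1) \<Phi>(1) \<eta>]) (simp add: W_def)
  finally have "ennreal l + ennreal p * (ennreal l * X + flux_neg \<alpha> p \<Phi> \<eta>)
      \<le> ennreal l + ennreal p * flux_pos \<alpha> p \<Phi> \<eta>"
    by (simp add: v(5) l distrib_left mult_ac add_ac)
  then have "ennreal p * (ennreal l * X + flux_neg \<alpha> p \<Phi> \<eta>) \<le> ennreal p * flux_pos \<alpha> p \<Phi> \<eta>"
    by (simp add: ennreal_add_left_cancel_le)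
  then show ?thesis unfolding X_def by (rule ennreal_mult_left_le_cancel[rotated]) (use \<open>1 < p\<close> in simp)
qed

text \<open>Energies do not see the sign, so the comparison for maxima is applied to
  \<open>- v\<close> and \<open>\<Phi>\<close>, whose maximum is minus the competitor
  \<open>min v (- \<Phi>)\<close>; \<open>\<Phi> \<le> 0\<close> keeps the latter nonnegative.
  Passing to a minimum loses mass instead of gaining it, which puts the weighted integral on the
  right.\<close>

lemma subsolution_flux_inequality:
  fixes v \<Phi> :: "'a::euclidean_space \<Rightarrow> real"
  assumes \<Omega>: "open \<Omega>" "bounded \<Omega>" and "1 < p" "0 \<le> l" and l: "first_eigenvalue \<alpha> p \<Omega> = ennreal l"
    and v: "continuous_on UNIV v" "\<And>x. x \<notin> \<Omega> \<Longrightarrow> v x = 0" "\<And>x. 0 \<le> v x" "Lp_power p v = 1"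
      "frac_energy (\<alpha> * p) p v = first_eigenvalue \<alpha> p \<Omega>"
    and \<Phi>: "continuous_on UNIV \<Phi>" "\<And>x. \<Phi> x \<le> 0"
    and \<eta>: "\<And>x. \<eta> x = max (\<Phi> x - (- v x)) 0"
  shows "flux_neg \<alpha> p \<Phi> \<eta> \<le> flux_pos \<alpha> p \<Phi> \<eta> + ennreal l * (\<integral>\<^sup>+ x. ennreal (v x powr (p - 1) * \<eta> x)
      \<partial>lborel)"
proof -
  define X where "X = (\<integral>\<^sup>+ x. ennreal (v x powr (p - 1) * \<eta> x) \<partial>lborel)"
  define w where "w x = min (v x) (- \<Phi> x)" for x
  have [measurable]: "v \<in> borel_measurable borel" "\<Phi> \<in> borel_measurable borel"
    using v \<Phi> by (auto intro: borel_measurable_continuous_onI)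
  have [measurable]: "\<eta> \<in> borel_measurable borel" "w \<in> borel_measurable borel"
    unfolding \<eta>[abs_def] w_def[abs_def] by measurable
  have minus: "frac_energy \<beta> p (\<lambda>x. - f x) = frac_energy \<beta> p f" for \<beta> and f :: "'a \<Rightarrow> real"
    by (simp add: frac_energy_def abs_minus_commute)
  have "Lp_power p v \<le> (\<integral>\<^sup>+ x. ennreal (\<bar>w x\<bar> powr p) + ennreal p * ennreal (v x powr (p - 1) * \<eta> x)
      \<partial>lborel)"
    unfolding Lp_power_lborel
  proof (intro nn_integral_mono)
    fix x
    have "\<bar>v x\<bar> powr p \<le> \<bar>w x\<bar> powr p + p * (v x powr (p - 1) * \<eta> x)"
    proof (cases "v x = 0")
      case True
      then show ?thesis using \<open>1 < p\<close> by simp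
    next
      case False
      then have "signed_powr (p - 1) (v x) = v x powr (p - 1)" using v(3)[of x]
          by (simp add: signed_powr_def)
      moreover have "w x - v x = - \<eta> x" by (auto simp: w_def \<eta> max_def)
      ultimately show ?thesis using powr_tangent[OF \<open>1 < p\<close>, of "v x" "w x"] by simp
    qed
    then have "ennreal (\<bar>v x\<bar> powr p) \<le> ennreal (\<bar>w x\<bar> powr p + p * (v x powr (p - 1) * \<eta> x))"
        by (rule ennreal_leI)
    then show "ennreal (\<bar>v x\<bar> powr p) \<le> ennreal (\<bar>w x\<bar> powr p) + ennreal p * ennreal (v x powr (p - 1) *
        \<eta> x)"
      using \<open>1 < p\<close> by (simp add: \<eta> ennreal_mult)
  qed
  also have "\<dots> = Lp_power p w + ennreal p * X"
    unfolding X_def Lp_power_lborel by (simp add: nn_integral_add nn_integral_cmult)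
  finally have "ennreal l * 1 \<le> ennreal l * (Lp_power p w + ennreal p * X)"
    unfolding v(4) by (rule mult_left_mono) auto
  also have "\<dots> = ennreal l * Lp_power p w + ennreal l * (ennreal p * X)" by (rule distrib_left)
  also have "\<dots> \<le> frac_energy (\<alpha> * p) p w + ennreal l * (ennreal p * X)"
  proof (rule add_right_mono, rule first_eigenvalue_le_continuous[OF \<Omega> \<open>1 < p\<close> \<open>0 \<le> l\<close>])
    show "continuous_on UNIV w" unfolding w_def by (intro continuous_intros v \<Phi>)
    show "0 \<le> w x" for x using v(3)[of x] \<Phi>(2)[of x] by (simp add: w_def)
    show "w x = 0" if "x \<notin> \<Omega>" for x using v(2)[OF that] \<Phi>(2)[of x] by (simp add: w_def)
  qed (simp add: l)
  finally have 1: "ennreal l \<le> frac_energy (\<alpha> * p) p w + ennreal l * (ennreal p * X)" by simp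
  have "frac_energy (\<alpha> * p) p (\<lambda>x. - w x) + ennreal p * flux_neg \<alpha> p \<Phi> \<eta>
      \<le> frac_energy (\<alpha> * p) p (\<lambda>x. - v x) + ennreal p * flux_pos \<alpha> p \<Phi> \<eta>"
    by (rule frac_energy_max_le[OF \<open>1 < p\<close> _ \<Phi>(1) \<eta>]) (auto simp: w_def min_def max_def intro!:
        continuous_intros v)
  then have 2: "frac_energy (\<alpha> * p) p w + ennreal p * flux_neg \<alpha> p \<Phi> \<eta>
      \<le> ennreal l + ennreal p * flux_pos \<alpha> p \<Phi> \<eta>"
    by (simp only: minus v(5) l)
  have "ennreal l + ennreal p * flux_neg \<alpha> p \<Phi> \<eta> \<le> (frac_energy (\<alpha> * p) p w + ennreal p * flux_neg \<alpha> p \<Phi>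
      \<eta>) + ennreal l * (ennreal p * X)"
    using add_right_mono[OF 1, of "ennreal p * flux_neg \<alpha> p \<Phi> \<eta>"] by (simp add: add_ac)
  also have "\<dots> \<le> (ennreal l + ennreal p * flux_pos \<alpha> p \<Phi> \<eta>) + ennreal l * (ennreal p * X)"
    using 2 by (rule add_right_mono)
  finally have "ennreal l + ennreal p * flux_neg \<alpha> p \<Phi> \<eta>
      \<le> ennreal l + ennreal p * (flux_pos \<alpha> p \<Phi> \<eta> + ennreal l * X)"
    by (simp add: distrib_left mult_ac add_ac)
  then have "ennreal p * flux_neg \<alpha> p \<Phi> \<eta> \<le> ennreal p * (flux_pos \<alpha> p \<Phi> \<eta> + ennreal l * X)"
    by (simp add: ennreal_add_left_cancel_le)
  then show ?thesis unfolding X_def by (rule ennreal_mult_left_le_cancel[rotated]) (use \<open>1 < p\<close> in simp)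
qed

text \<open>The flux is positive only if both increments have the same sign. Then the end where
  \<open>\<Phi>\<close> is larger has \<open>\<eta>\<close> > 0 and so lies in \<open>B\<close>,
  where the one-sided bound limits the quotient by \<open>M\<close>. Of its p - 1 factors all but m
  are estimated by \<open>M\<close>; the others and the increment of \<open>\<eta>\<close> must
  produce an integrable weight: near the diagonal the Hoelder bound on \<open>\<eta>\<close> leaves
  the exponent \<alpha>/2, far away boundedness of \<open>\<Phi>\<close> and \<open>\<eta>\<close>
  gives the decay \<alpha> m + \<alpha>.\<close>

lemma flux_pos_le:
  fixes \<Phi> \<eta> :: "'a::euclidean_space \<Rightarrow> real"
  assumes "0 < \<alpha>" and m: "0 \<le> m" "m \<le> p - 1" and "0 < M" and B: "B \<in> sets borel"
    and \<Phi>: "\<And>x y. \<bar>\<Phi> y - \<Phi> x\<bar> \<le> H" "\<And>x y. \<bar>\<Phi> y - \<Phi> x\<bar> \<le> Q * norm (y - x) powr \<alpha>"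
      "\<And>x y. x \<in> B \<Longrightarrow> \<Phi> x - \<Phi> y \<le> M * norm (y - x) powr \<alpha>"
    and \<eta>: "\<And>x. 0 \<le> \<eta> x" "\<And>x. x \<notin> B \<Longrightarrow> \<eta> x = 0" "\<And>x y. \<bar>\<eta> y - \<eta> x\<bar> \<le> N"
      "\<And>x y. norm (y - x) \<le> 1 \<Longrightarrow> \<bar>\<eta> y - \<eta> x\<bar> \<le> N * norm (y - x) powr (\<alpha> / 2)"
  shows "flux_pos \<alpha> p \<Phi> \<eta> \<le> ennreal (M powr (p - 1 - m) * (N * max (Q powr m) (H powr m))) *
    (2 * emeasure lborel B * (\<integral>\<^sup>+ z. ennreal (radial_weight (\<alpha> / 2) (\<alpha> * m + \<alpha>) (norm (z::'a))) \<partial>lborel))"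
  unfolding flux_pos_def
proof (rule double_integral_localized_le[OF _ B])
  fix x y :: 'a
  define t where "t = norm (y - x)"
  define K where "K = N * max (Q powr m) (H powr m)"
  define a where "a = radial_weight (\<alpha> / 2) (\<alpha> * m + \<alpha>) t"
  have "0 \<le> N" using \<eta>(3)[of x x] by simp
  then have "0 \<le> K" by (auto simp: K_def le_max_iff_disj)
  show "ennreal (flux \<alpha> p \<Phi> \<eta> x y) \<le> ennreal (M powr (p - 1 - m) * (N * max (Q powr m) (H powr m))) *
      ((indicator B x + indicator B y) * ennreal (radial_weight (\<alpha> / 2) (\<alpha> * m + \<alpha>) (norm (y - x))))"
  proof (cases "flux \<alpha> p \<Phi> \<eta> x y \<le> 0")
    case True
    then show ?thesis by (simp add: ennreal_neg)
  next
    case False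
    define d where "d = \<bar>\<Phi> y - \<Phi> x\<bar>"
    define e where "e = \<bar>\<eta> y - \<eta> x\<bar>"
    have "x \<noteq> y" using False by (auto simp: flux_def)
    then have t: "0 < t" by (simp add: t_def)
    have sgn: "0 < (\<Phi> y - \<Phi> x) * (\<eta> y - \<eta> x)"
    proof (rule ccontr)
      assume "\<not> ?thesis"
      then have "signed_powr (p - 1) (\<Phi> y - \<Phi> x) * (\<eta> y - \<eta> x) \<le> 0"
        by (auto simp: signed_powr_def sgn_real_def mult_le_0_iff not_less zero_less_mult_iff)
      then show False using False by (simp add: flux_def divide_nonpos_nonneg)
    qed
    have eq: "flux \<alpha> p \<Phi> \<eta> x y = d powr (p - 1) * e / t powr (\<alpha> * p)"
      using sgn by (auto simp: flux_def signed_powr_def d_def e_def t_def zero_less_mult_iff)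
    have d: "0 < d" using sgn by (auto simp: d_def)
    have xB: "x \<in> B \<or> y \<in> B"
    proof (rule ccontr)
      assume "\<not> ?thesis"
      then show False using sgn \<eta>(2)[of x] \<eta>(2)[of y] by simp
    qed
    have dM: "d \<le> M * t powr \<alpha>"
    proof (cases "\<Phi> x < \<Phi> y")
      case True
      then have "\<eta> x < \<eta> y" using sgn by (simp add: zero_less_mult_iff)
      then have "y \<in> B" using \<eta>(1)[of x] \<eta>(2)[of y] by (cases "y \<in> B") auto
      then show ?thesis using \<Phi>(3)[of y x] True by (simp add: d_def t_def norm_minus_commute)
    next
      case False
      then have "\<eta> y < \<eta> x" using sgn by (auto simp: zero_less_mult_iff)
      then have "x \<in> B" using \<eta>(1)[of y] \<eta>(2)[of x] by (cases "x \<in> B") auto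
      then show ?thesis using \<Phi>(3)[of x y] False by (simp add: d_def t_def)
    qed
    define q where "q = d / t powr \<alpha>"
    have q: "0 < q" "q \<le> M" using d t dM by (auto simp: q_def field_simps)
    have "flux \<alpha> p \<Phi> \<eta> x y = q powr (p - 1) * (e / t powr \<alpha>)"
    proof -
      \<comment> \<open>One factor t^\<alpha> remains after p - 1 of them have gone into the
        quotient of \<open>\<Phi>\<close>; it is paired with the increment of
        \<open>\<eta>\<close>.\<close>
      have "t powr (\<alpha> * p) = (t powr \<alpha>) powr (p - 1) * t powr \<alpha>"
        by (simp add: powr_powr algebra_simps flip: powr_add)
      then show ?thesis using d t by (simp add: eq q_def powr_divide)
    qed
    also have "q powr (p - 1) = q powr (p - 1 - m) * q powr m" by (simp flip: powr_add)
    also have "q powr (p - 1 - m) * q powr m * (e / t powr \<alpha>)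
        = q powr (p - 1 - m) * (q powr m * (e / t powr \<alpha>))" by simp
    also have "\<dots> \<le> M powr (p - 1 - m) * (K * a)"
    proof (rule mult_mono)
      show "q powr (p - 1 - m) \<le> M powr (p - 1 - m)" using q m by (intro powr_mono2) auto
      show "q powr m * (e / t powr \<alpha>) \<le> K * a"
      proof (cases "t \<le> 1")
        case True
        have "q \<le> Q" using \<Phi>(2)[of y x] t by (simp add: q_def d_def t_def field_simps)
        then have 1: "q powr m \<le> max (Q powr m) (H powr m)" using q m
            by (simp add: le_max_iff_disj powr_mono2)
        have "e / t powr \<alpha> \<le> N * t powr (\<alpha> / 2) / t powr \<alpha>"
          using \<eta>(4)[of y x] True by (intro divide_right_mono) (auto simp: e_def t_def)
        also have "\<dots> = N * t powr (- (\<alpha> / 2))"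
          using powr_diff[of t "\<alpha> / 2" \<alpha>] t by simp
        finally have 2: "e / t powr \<alpha> \<le> N * t powr (- (\<alpha> / 2))" .
        have "q powr m * (e / t powr \<alpha>) \<le> max (Q powr m) (H powr m) * (N * t powr (- (\<alpha> / 2)))"
          using 1 2 by (intro mult_mono) (auto simp: e_def le_max_iff_disj)
        then show ?thesis using True by (simp add: K_def a_def radial_weight_def mult_ac)
      next
        case False
        have "q powr m = d powr m / t powr (\<alpha> * m)" using d t by (simp add: q_def powr_divide powr_powr)
        also have "\<dots> \<le> max (Q powr m) (H powr m) / t powr (\<alpha> * m)"
          using \<Phi>(1)[of y x] d m by (intro divide_right_mono) (auto simp: d_def le_max_iff_disj powr_mono2)
        finally have "q powr m * (e / t powr \<alpha>) \<le> (max (Q powr m) (H powr m) / t powr (\<alpha> * m)) * (N / t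
            powr \<alpha>)"
          using \<eta>(3)[of y x] by (intro mult_mono divide_right_mono) (auto simp: e_def le_max_iff_disj)
        also have "\<dots> = K * t powr (- (\<alpha> * m + \<alpha>))"
          by (subst powr_minus) (simp add: K_def powr_add divide_inverse mult_ac)
        finally show ?thesis using False by (simp add: a_def radial_weight_def)
      qed
    qed (auto simp: e_def)
    finally have "ennreal (flux \<alpha> p \<Phi> \<eta> x y) \<le> ennreal (M powr (p - 1 - m) * (K * a))" by (rule ennreal_leI)
    also have "\<dots> = ennreal (M powr (p - 1 - m) * K) * (1 * ennreal a)"
      using \<open>0 \<le> K\<close> by (simp add: a_def mult.assoc flip: ennreal_mult)
    also have "\<dots> \<le> ennreal (M powr (p - 1 - m) * K) * ((indicator B x + indicator B y) * ennreal a)"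
    proof (intro mult_left_mono mult_right_mono)
      show "(1::ennreal) \<le> indicator B x + indicator B y" using xB by (auto simp: indicator_def)
    qed auto
    finally show ?thesis by (simp add: K_def a_def t_def)
  qed
qed measurable

text \<open>Pairs from a ball where \<open>\<eta>\<close> is bounded below and a ball where it
  vanishes: \<open>\<eta>\<close> drops while \<open>\<Phi>\<close> rises, so the flux is negative
  and carries the full quotient to the power p - 1. The bound \<open>D\<close> on the distance takes
  care of the left-over factor t^\<alpha>.\<close>

lemma flux_neg_ge:
  fixes \<Phi> \<eta> :: "'a::euclidean_space \<Rightarrow> real"
  assumes "1 \<le> p" "0 < \<alpha>" "0 < b" "0 < c"
    and \<Phi>: "\<And>x y. x \<in> ball x0 \<rho> \<Longrightarrow> y \<in> ball y0 \<rho> \<Longrightarrow> b * norm (y - x) powr \<alpha> < \<Phi> y - \<Phi> x \<and> norm (y - x) \<le> D"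
    and \<eta>: "\<And>x. x \<in> ball x0 \<rho> \<Longrightarrow> c \<le> \<eta> x" "\<And>y. y \<in> ball y0 \<rho> \<Longrightarrow> \<eta> y = 0"
  shows "ennreal (b powr (p - 1) * c * D powr (- \<alpha>)) * (emeasure lborel (ball x0 \<rho>) * emeasure lborel
      (ball y0 \<rho>)) \<le> flux_neg \<alpha> p \<Phi> \<eta>"
  unfolding flux_neg_def
proof (rule double_integral_balls_ge, rule ennreal_leI)
  fix x y assume xy: "x \<in> ball x0 \<rho>" "y \<in> ball y0 \<rho>"
  define t where "t = norm (y - x)"
  define d where "d = \<Phi> y - \<Phi> x"
  have "x \<noteq> y" using \<Phi>[OF xy] by auto
  then have t: "0 < t" "t \<le> D" using \<Phi>[OF xy] by (auto simp: t_def)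
  have bd: "b * t powr \<alpha> < d" using \<Phi>[OF xy] by (simp add: t_def d_def)
  moreover have "0 < b * t powr \<alpha>" using t \<open>0 < b\<close> by simp
  ultimately have "0 < d" by linarith
  have "b powr (p - 1) * c * D powr (- \<alpha>) \<le> (d / t powr \<alpha>) powr (p - 1) * \<eta> x * t powr (- \<alpha>)"
  proof (intro mult_mono)
    show "b powr (p - 1) \<le> (d / t powr \<alpha>) powr (p - 1)"
      using bd t \<open>0 < b\<close> \<open>1 \<le> p\<close> by (intro powr_mono2) (auto simp: field_simps)
    show "D powr (- \<alpha>) \<le> t powr (- \<alpha>)" using t \<open>0 < \<alpha>\<close> by (intro powr_mono2') auto
  qed (use \<eta>(1)[OF xy(1)] \<open>0 < c\<close> in auto)
  also have "\<dots> = - flux \<alpha> p \<Phi> \<eta> x y"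
  proof -
    have "t powr (\<alpha> * p) = (t powr \<alpha>) powr (p - 1) * t powr \<alpha>"
      by (simp add: powr_powr algebra_simps flip: powr_add)
    then show ?thesis using \<open>0 < d\<close> t \<eta>(2)[OF xy(2)]
      by (simp add: flux_def signed_powr_def powr_divide powr_minus flip: t_def d_def) (simp add:
          divide_inverse)
  qed
  finally show "b powr (p - 1) * c * D powr (- \<alpha>) \<le> - flux \<alpha> p \<Phi> \<eta> x y" .
qed

section \<open>Difference quotients of test functions\<close>

lemma Cc1_has_derivative:
  assumes "\<phi> \<in> Cc1"
  obtains D where "\<And>x. (\<phi> has_derivative D x) (at x)" "\<And>v. continuous_on UNIV (\<lambda>x. D x v)"
    "\<And>x v. x \<notin> supp \<phi> \<Longrightarrow> D x v = 0"
proof -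
  have phi: "\<And>x. \<phi> differentiable (at x)" "\<And>v. continuous_on UNIV (\<lambda>x. frechet_derivative \<phi> (at x) v)"
    using assms by (auto simp: Cc1_def)
  have D: "(\<phi> has_derivative frechet_derivative \<phi> (at x)) (at x)" for x
    using phi(1) frechet_derivative_works by blast
  show ?thesis
  proof (rule that[OF D phi(2)])
    fix x v assume x: "x \<notin> supp \<phi>"
    have "((\<lambda>_. 0) has_derivative (\<lambda>_. 0)) (at x)" by simp
    then have "(\<phi> has_derivative (\<lambda>_. 0)) (at x)"
    proof (rule has_derivative_transform_within_open)
      show "open (- supp \<phi>)" by (simp add: supp_def open_Compl)
      show "0 = \<phi> y" if "y \<in> - supp \<phi>" for y
        using that closure_subset[of "{x. \<phi> x \<noteq> 0}"] by (auto simp: supp_def)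
    qed (use x in auto)
    then have "frechet_derivative \<phi> (at x) = (\<lambda>_. 0)" by (rule frechet_derivative_at[symmetric])
    then show "frechet_derivative \<phi> (at x) v = 0" by simp
  qed
qed

lemma Cc1_uminus:
  assumes "\<phi> \<in> Cc1"
  shows "(\<lambda>x. - \<phi> x) \<in> Cc1"
proof -
  obtain D where D: "\<And>x. (\<phi> has_derivative D x) (at x)" "\<And>v. continuous_on UNIV (\<lambda>x. D x v)"
    by (rule Cc1_has_derivative[OF assms]) blast
  have d: "((\<lambda>x. - \<phi> x) has_derivative (\<lambda>v. - D x v)) (at x)" for x
    by (intro has_derivative_minus D)
  have "frechet_derivative (\<lambda>x. - \<phi> x) (at x) = (\<lambda>v. - D x v)" for x
    by (rule frechet_derivative_at[OF d, symmetric])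
  then show ?thesis
    using assms d D(2) by (auto simp: Cc1_def supp_def differentiable_def intro!: continuous_intros)
qed

lemma Cc1_bounds:
  fixes \<phi> :: "'a::euclidean_space \<Rightarrow> real"
  assumes "\<phi> \<in> Cc1"
  obtains H where "0 < H" "\<And>x. \<bar>\<phi> x\<bar> \<le> H" "\<And>x y. \<bar>\<phi> y - \<phi> x\<bar> \<le> H * norm (y - x)"
proof -
  obtain D where D: "\<And>x. (\<phi> has_derivative D x) (at x)" "\<And>v. continuous_on UNIV (\<lambda>x. D x v)"
    "\<And>x v. x \<notin> supp \<phi> \<Longrightarrow> D x v = 0"
    by (rule Cc1_has_derivative[OF assms]) blast
  have K: "compact (supp \<phi>)" using assms by (simp add: Cc1_def)
  have bound: "\<exists>C>0. \<forall>x. \<bar>f x\<bar> \<le> C" if f: "continuous_on UNIV f" "\<And>x. x \<notin> supp \<phi> \<Longrightarrow> f x = 0"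
      for f :: "'a \<Rightarrow> real"
  proof -
    have "bounded (f ` supp \<phi>)"
      using K continuous_on_subset[OF f(1)] by (intro compact_imp_bounded compact_continuous_image) auto
    then obtain C where C: "0 < C" "\<And>x. x \<in> supp \<phi> \<Longrightarrow> \<bar>f x\<bar> \<le> C"
      by (auto simp: bounded_pos)
    then have "\<bar>f x\<bar> \<le> C" for x using f(2)[of x] by (cases "x \<in> supp \<phi>") auto
    then show ?thesis using C by blast
  qed
  have "continuous_on UNIV \<phi>"
    using D(1) by (auto intro!: continuous_at_imp_continuous_on has_derivative_continuous)
  moreover have "\<phi> x = 0" if "x \<notin> supp \<phi>" for x
    using that closure_subset[of "{x. \<phi> x \<noteq> 0}"] by (auto simp: supp_def)
  ultimately have "\<exists>C>0. \<forall>x. \<bar>\<phi> x\<bar> \<le> C" by (rule bound)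
  then obtain C0 where C0: "0 < C0" "\<And>x. \<bar>\<phi> x\<bar> \<le> C0" by blast
  have "\<forall>i. \<exists>C>0. \<forall>x. \<bar>D x i\<bar> \<le> C" by (intro allI bound D(2) D(3))
  then obtain C where C: "\<And>i. 0 < C i" "\<And>i x. \<bar>D x i\<bar> \<le> C i" by metis
  have onorm: "onorm (D x) \<le> (\<Sum>i\<in>Basis. C i)" for x
  proof (rule onorm_le)
    fix v
    have "D x v = (\<Sum>i\<in>Basis. (v \<bullet> i) * D x i)"
      by (rule linear_eq_sum_Basis[OF has_derivative_linear[OF D(1)]])
    then have "norm (D x v) \<le> (\<Sum>i\<in>Basis. \<bar>v \<bullet> i\<bar> * \<bar>D x i\<bar>)"
      using sum_abs[of "\<lambda>i. (v \<bullet> i) * D x i" Basis] by (simp add: abs_mult)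
    also have "\<dots> \<le> (\<Sum>i\<in>Basis. norm v * C i)"
      by (intro sum_mono mult_mono Basis_le_norm C) auto
    finally show "norm (D x v) \<le> (\<Sum>i\<in>Basis. C i) * norm v" by (simp add: sum_distrib_left mult.commute)
  qed
  have Lip: "\<bar>\<phi> y - \<phi> x\<bar> \<le> (\<Sum>i\<in>Basis. C i) * norm (y - x)" for x y
    using differentiable_bound[of UNIV \<phi> D "\<Sum>i\<in>Basis. C i" y x] D(1) onorm by simp
  show ?thesis
  proof (rule that[of "max C0 (\<Sum>i\<in>Basis. C i)"])
    show "\<bar>\<phi> y - \<phi> x\<bar> \<le> max C0 (\<Sum>i\<in>Basis. C i) * norm (y - x)" for x y
      by (rule order_trans[OF Lip mult_right_mono]) auto
    show "\<bar>\<phi> x\<bar> \<le> max C0 (\<Sum>i\<in>Basis. C i)" for x using C0(2)[of x] by simp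
  qed (use C0 in auto)
qed

lemma Lipschitz_bounded_imp_Hoelder:
  fixes \<phi> :: "'a::euclidean_space \<Rightarrow> real"
  assumes "0 < \<alpha>" "\<alpha> \<le> 1" "0 \<le> H" "\<bar>\<phi> y - \<phi> x\<bar> \<le> H" "\<bar>\<phi> y - \<phi> x\<bar> \<le> H * norm (y - x)"
  shows "\<bar>\<phi> y - \<phi> x\<bar> \<le> H * norm (y - x) powr \<alpha>"
proof (cases "norm (y - x) \<le> 1")
  case True
  have "norm (y - x) \<le> norm (y - x) powr \<alpha>"
    using powr_mono'[of \<alpha> 1 "norm (y - x)"] assms(2) True by (cases "x = y") auto
  then show ?thesis using assms(3,5) by (meson mult_left_mono order_trans)
next
  case False
  then have "1 \<le> norm (y - x) powr \<alpha>" using assms(1) by (intro ge_one_powr_ge_zero) auto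
  then have "H * 1 \<le> H * norm (y - x) powr \<alpha>" using assms(3) by (intro mult_left_mono) auto
  then show ?thesis using assms(4) by simp
qed

lemma Cc1_Hoelder:
  fixes \<phi> :: "'a::euclidean_space \<Rightarrow> real"
  assumes "\<phi> \<in> Cc1" "0 < \<alpha>" "\<alpha> \<le> 1"
  obtains H where "0 < H" "\<And>x. \<bar>\<phi> x\<bar> \<le> H" "\<And>x y. \<bar>\<phi> y - \<phi> x\<bar> \<le> H * norm (y - x)"
    "\<And>x y. \<bar>\<phi> y - \<phi> x\<bar> \<le> H * norm (y - x) powr \<alpha>"
proof -
  obtain H where H: "0 < H" "\<And>x. \<bar>\<phi> x\<bar> \<le> H" "\<And>x y. \<bar>\<phi> y - \<phi> x\<bar> \<le> H * norm (y - x)"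
    by (rule Cc1_bounds[OF assms(1)]) blast
  show ?thesis
  proof (rule that[of "2 * H"])
    fix x y
    show "\<bar>\<phi> x\<bar> \<le> 2 * H" using H(1) H(2)[of x] by linarith
    show L: "\<bar>\<phi> y - \<phi> x\<bar> \<le> 2 * H * norm (y - x)"
      using H(3)[of y x] mult_right_mono[of H "2 * H" "norm (y - x)"] H(1) by linarith
    show "\<bar>\<phi> y - \<phi> x\<bar> \<le> 2 * H * norm (y - x) powr \<alpha>"
      using H(1) H(2)[of x] H(2)[of y] L assms by (intro Lipschitz_bounded_imp_Hoelder) auto
  qed (use H in simp)
qed

context
  fixes \<phi> :: "'a::euclidean_space \<Rightarrow> real" and \<alpha> :: real
  assumes phi: "\<phi> \<in> Cc1" and \<alpha>: "0 < \<alpha>" "\<alpha> \<le> 1"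
begin

lemma bdd_above_quotient: "bdd_above ((\<lambda>y. (\<phi> y - \<phi> x) / norm (y - x) powr \<alpha>) ` {y. y \<noteq> x})"
proof -
  obtain H where H: "0 < H" "\<And>x y. \<bar>\<phi> y - \<phi> x\<bar> \<le> H * norm (y - x) powr \<alpha>"
    by (rule Cc1_Hoelder[OF phi \<alpha>]) blast
  have "(\<phi> y - \<phi> x) / norm (y - x) powr \<alpha> \<le> H" if "y \<noteq> x" for y
    using H(2)[of y x] that by (simp add: field_simps abs_le_iff)
  then show ?thesis by (intro bdd_aboveI2) auto
qed

lemma le_L_plus: "\<phi> y - \<phi> x \<le> L_plus \<alpha> \<phi> x * norm (y - x) powr \<alpha>"
proof (cases "y = x")
  case False
  then have "(\<phi> y - \<phi> x) / norm (y - x) powr \<alpha> \<le> L_plus \<alpha> \<phi> x"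
    unfolding L_plus_def by (intro cSUP_upper bdd_above_quotient) simp
  then show ?thesis using False by (simp add: field_simps)
qed simp

lemma less_L_plusD:
  assumes "b < L_plus \<alpha> \<phi> x"
  obtains y where "y \<noteq> x" "b * norm (y - x) powr \<alpha> < \<phi> y - \<phi> x"
proof -
  obtain i :: 'a where "i \<in> Basis" using nonempty_Basis by blast
  then have "x + i \<in> {y. y \<noteq> x}" using nonzero_Basis by auto
  then have "{y. y \<noteq> x} \<noteq> {}" by blast
  then obtain y where "y \<noteq> x" "b < (\<phi> y - \<phi> x) / norm (y - x) powr \<alpha>"
    using assms less_cSUP_iff[OF _ bdd_above_quotient] unfolding L_plus_def by blast
  then show ?thesis by (intro that[of y]) (auto simp: field_simps)
qed

text \<open>Far away a bounded function has quotients close to 0, so the supremum cannot be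
  negative: at a distance t with |L| t^\<alpha> = 2 H + 1 it would force a drop larger than the
  oscillation 2 H.\<close>

lemma L_plus_nonneg: "0 \<le> L_plus \<alpha> \<phi> x"
proof (rule ccontr)
  assume neg: "\<not> 0 \<le> L_plus \<alpha> \<phi> x"
  define a where "a = - L_plus \<alpha> \<phi> x"
  have a: "0 < a" using neg by (simp add: a_def)
  obtain H where H: "0 < H" "\<And>x. \<bar>\<phi> x\<bar> \<le> H" by (rule Cc1_bounds[OF phi]) blast
  obtain i :: 'a where i: "i \<in> Basis" using nonempty_Basis by blast
  define t where "t = ((2 * H + 1) / a) powr (1 / \<alpha>)"
  have "\<phi> (x + t *\<^sub>R i) - \<phi> x \<le> L_plus \<alpha> \<phi> x * norm (x + t *\<^sub>R i - x) powr \<alpha>" by (rule le_L_plus)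
  also have "norm (x + t *\<^sub>R i - x) = t" using i by (simp add: t_def)
  also have "t powr \<alpha> = (2 * H + 1) / a" using \<alpha> a H by (simp add: t_def powr_powr)
  also have "L_plus \<alpha> \<phi> x * ((2 * H + 1) / a) = - (2 * H + 1)" using a by (simp add: a_def)
  finally show False using H(2)[of x] H(2)[of "x + t *\<^sub>R i"] H(1) by (simp add: abs_le_iff)
qed

text \<open>For \<alpha> < 1 a Lipschitz function has small quotients at short range, and A > 0 is
  enough. For \<alpha> = 1 quotients between two nearby points are not seen by the supremum at
  \<open>x0\<close>; they are reached through the derivative, which is bounded by that supremum at
  \<open>x0\<close>, by continuity near it, and which controls increments by the mean value
  theorem.\<close>

lemma quotient_near:
  assumes A: "L_plus \<alpha> \<phi> x0 < A"
  shows "\<exists>d>0. \<forall>x\<in>ball x0 d. \<forall>y\<in>ball x0 d. \<phi> y - \<phi> x \<le> A * norm (y - x) powr \<alpha>"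
proof -
  have "0 < A" using A L_plus_nonneg[of x0] by linarith
  show ?thesis
  proof (cases "\<alpha> = 1")
    case False
    then have "\<alpha> < 1" using \<alpha> by simp
    obtain H where H: "0 < H" "\<And>x y. \<bar>\<phi> y - \<phi> x\<bar> \<le> H * norm (y - x)" by (rule Cc1_bounds[OF phi]) blast
    define d where "d = (A / H) powr (1 / (1 - \<alpha>)) / 2"
    have "\<phi> y - \<phi> x \<le> A * norm (y - x) powr \<alpha>" if "x \<in> ball x0 d" "y \<in> ball x0 d" for x y
    proof (cases "x = y")
      case False
      define t where "t = norm (y - x)"
      have t: "0 < t" "t \<le> 2 * d"
        using that False dist_triangle2[of y x x0] by (auto simp: t_def dist_norm[symmetric] dist_commute)
      have "t powr (1 - \<alpha>) \<le> ((A / H) powr (1 / (1 - \<alpha>))) powr (1 - \<alpha>)"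
        using t \<open>\<alpha> < 1\<close> by (intro powr_mono2) (auto simp: d_def)
      also have "\<dots> = A / H" using \<open>\<alpha> < 1\<close> \<open>0 < A\<close> H by (simp add: powr_powr)
      finally have "H * t powr (1 - \<alpha>) \<le> A" using H by (simp add: field_simps)
      then have "H * t powr (1 - \<alpha>) * t powr \<alpha> \<le> A * t powr \<alpha>" by (intro mult_right_mono) auto
      moreover have "H * t powr (1 - \<alpha>) * t powr \<alpha> = H * t" using t by (simp flip: powr_add)
      moreover have "\<phi> y - \<phi> x \<le> H * t" using H(2)[of y x] by (simp add: t_def abs_le_iff)
      ultimately show ?thesis unfolding t_def[symmetric] by linarith
    qed simp
    moreover have "0 < d" using \<open>0 < A\<close> H by (simp add: d_def)
    ultimately show ?thesis by blast
  next
    case True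
    obtain D where D: "\<And>x. (\<phi> has_derivative D x) (at x)" "\<And>v. continuous_on UNIV (\<lambda>x. D x v)"
      by (rule Cc1_has_derivative[OF phi]) blast
    define L where "L = L_plus \<alpha> \<phi> x0"
    have D_le: "D x0 e \<le> L * norm e" for e
    proof -
      have "((\<lambda>h. \<phi> (x0 + h *\<^sub>R e)) has_real_derivative D x0 e) (at 0)"
      proof -
        have "((\<lambda>h. \<phi> (x0 + h *\<^sub>R e)) has_derivative (\<lambda>h. D (x0 + 0 *\<^sub>R e) (h *\<^sub>R e))) (at 0)"
          by (rule has_derivative_compose[OF _ D(1)]) (auto intro!: derivative_eq_intros)
        moreover have "(\<lambda>h. D (x0 + 0 *\<^sub>R e) (h *\<^sub>R e)) = (*) (D x0 e)"
          using linear_scale[OF has_derivative_linear[OF D(1)], of x0 _ e] by (auto simp: fun_eq_iff)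
        ultimately show ?thesis by (simp add: has_field_derivative_def)
      qed
      then have "((\<lambda>h. (\<phi> (x0 + h *\<^sub>R e) - \<phi> x0) / h) \<longlongrightarrow> D x0 e) (at 0)"
        by (simp add: has_field_derivative_iff)
      then have "((\<lambda>h. (\<phi> (x0 + h *\<^sub>R e) - \<phi> x0) / h) \<longlongrightarrow> D x0 e) (at_right 0)"
        by (rule tendsto_mono[rotated]) (simp add: at_le)
      moreover have "\<forall>\<^sub>F h in at_right 0. (\<phi> (x0 + h *\<^sub>R e) - \<phi> x0) / h \<le> L * norm e"
        using eventually_at_right_less[of "0::real"]
      proof eventually_elim
        case (elim h)
        then show ?case using le_L_plus[of "x0 + h *\<^sub>R e" x0] True by (simp add: L_def field_simps)
      qed
      ultimately show ?thesis by (rule tendsto_upperbound) simp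
    qed
    define n where "n = real DIM('a)"
    have n: "0 < n" by (simp add: n_def)
    \<comment> \<open>Each of the n coordinates may use an equal share of the slack A - L.\<close>
    have "\<exists>d>0. \<forall>\<xi>\<in>ball x0 d. \<forall>i\<in>Basis. \<bar>D \<xi> i - D x0 i\<bar> < (A - L) / n"
    proof -
      have "\<forall>\<^sub>F \<xi> in nhds x0. \<forall>i\<in>Basis. \<bar>D \<xi> i - D x0 i\<bar> < (A - L) / n"
      proof (rule eventually_ball_finite)
        show "\<forall>i\<in>Basis. \<forall>\<^sub>F \<xi> in nhds x0. \<bar>D \<xi> i - D x0 i\<bar> < (A - L) / n"
        proof
          fix i :: 'a
          have "((\<lambda>\<xi>. D \<xi> i) \<longlongrightarrow> D x0 i) (nhds x0)"
            using D(2)[of i] tendsto_at_iff_tendsto_nhds[of "\<lambda>\<xi>. D \<xi> i" x0]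
            by (simp add: continuous_on_eq_continuous_at isCont_def)
          moreover have "0 < (A - L) / n" using A n by (simp add: L_def)
          ultimately show "\<forall>\<^sub>F \<xi> in nhds x0. \<bar>D \<xi> i - D x0 i\<bar> < (A - L) / n"
            by (auto dest: tendstoD simp: dist_real_def)
        qed
      qed simp
      then show ?thesis by (auto simp: eventually_nhds_metric dist_commute)
    qed
    then obtain d where d: "0 < d" "\<And>\<xi> i. \<xi> \<in> ball x0 d \<Longrightarrow> i \<in> Basis \<Longrightarrow> \<bar>D \<xi> i - D x0 i\<bar> < (A - L) / n"
      by blast
    have D_near: "D \<xi> e \<le> A * norm e" if "\<xi> \<in> ball x0 d" for \<xi> e
    proof -
      have expand: "D z e = (\<Sum>i\<in>Basis. (e \<bullet> i) * D z i)" for z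
        by (rule linear_eq_sum_Basis[OF has_derivative_linear[OF D(1)]])
      have "D \<xi> e - D x0 e = (\<Sum>i\<in>Basis. (e \<bullet> i) * (D \<xi> i - D x0 i))"
        by (simp add: expand[of \<xi>] expand[of x0] sum_subtractf algebra_simps)
      also have "\<dots> \<le> (\<Sum>i\<in>(Basis::'a set). norm e * ((A - L) / n))"
      proof (rule sum_mono)
        fix i :: 'a assume i: "i \<in> Basis"
        have "(e \<bullet> i) * (D \<xi> i - D x0 i) \<le> \<bar>e \<bullet> i\<bar> * \<bar>D \<xi> i - D x0 i\<bar>"
          by (simp flip: abs_mult)
        also have "\<dots> \<le> norm e * ((A - L) / n)"
          using d(2)[OF that i] Basis_le_norm[OF i, of e] by (intro mult_mono) auto
        finally show "(e \<bullet> i) * (D \<xi> i - D x0 i) \<le> norm e * ((A - L) / n)" .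
      qed
      also have "\<dots> = norm e * (A - L)" using n by (simp add: n_def)
      finally show ?thesis using D_le[of e] by (simp add: algebra_simps)
    qed
    have "\<phi> y - \<phi> x \<le> A * norm (y - x) powr \<alpha>" if xy: "x \<in> ball x0 d" "y \<in> ball x0 d" for x y
    proof -
      define g where "g t = \<phi> (x + t *\<^sub>R (y - x))" for t
      have g: "(g has_derivative (\<lambda>h. D (x + t *\<^sub>R (y - x)) (h *\<^sub>R (y - x)))) (at t)" for t
        unfolding g_def by (rule has_derivative_compose[OF _ D(1)]) (auto intro!: derivative_eq_intros)
      obtain t where t: "t \<in> {0..1}" "g 1 - g 0 = D (x + t *\<^sub>R (y - x)) ((1 - 0) *\<^sub>R (y - x))"
        using mvt_very_simple[of 0 1 g "\<lambda>t h. D (x + t *\<^sub>R (y - x)) (h *\<^sub>R (y - x))"]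
            has_derivative_at_withinI[OF g] by force
      have "x + t *\<^sub>R (y - x) = (1 - t) *\<^sub>R x + t *\<^sub>R y" by (simp add: algebra_simps)
      moreover have "(1 - t) *\<^sub>R x + t *\<^sub>R y \<in> ball x0 d"
        using t(1) xy by (intro convexD[OF convex_ball]) auto
      ultimately have "x + t *\<^sub>R (y - x) \<in> ball x0 d" by simp
      from D_near[OF this, of "y - x"] t(2) True show ?thesis by (simp add: g_def)
    qed
    then show ?thesis using d(1) by blast
  qed
qed

text \<open>Points y near \<open>x0\<close> are covered by the preceding local bound. A distant y is
  compared with \<open>x0\<close> first; moving the base point from \<open>x0\<close> to x costs at
  most (L + Q) r^\<alpha>, which the slack A - L absorbs because y stays at distance at least d/2
  from x.\<close>

lemma L_plus_upper_semicontinuous: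
  assumes A: "L_plus \<alpha> \<phi> x0 < A"
  obtains r where "0 < r" "\<And>x y. x \<in> ball x0 r \<Longrightarrow> \<phi> y - \<phi> x \<le> A * norm (y - x) powr \<alpha>"
proof -
  obtain d where d: "0 < d" "\<And>x y. x \<in> ball x0 d \<Longrightarrow> y \<in> ball x0 d \<Longrightarrow> \<phi> y - \<phi> x \<le> A * norm (y - x) powr \<alpha>"
    using quotient_near[OF A] by blast
  define L where "L = L_plus \<alpha> \<phi> x0"
  have L: "0 \<le> L" "L < A" using L_plus_nonneg A by (auto simp: L_def)
  obtain Q where Q: "0 < Q" "\<And>x y. \<bar>\<phi> y - \<phi> x\<bar> \<le> Q * norm (y - x) powr \<alpha>"
    by (rule Cc1_Hoelder[OF phi \<alpha>]) blast
  define s where "s = (A - L) * (d / 2) powr \<alpha> / (L + Q)"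
  have s: "0 < s" using L Q d by (simp add: s_def)
  define r where "r = min (d / 2) (s powr (1 / \<alpha>))"
  have r: "0 < r" "r \<le> d / 2" using d s by (auto simp: r_def)
  have "r powr \<alpha> \<le> (s powr (1 / \<alpha>)) powr \<alpha>" using r \<alpha> by (intro powr_mono2) (auto simp: r_def)
  also have "\<dots> = s" using s \<alpha> by (simp add: powr_powr)
  finally have rs: "(L + Q) * r powr \<alpha> \<le> (A - L) * (d / 2) powr \<alpha>" using L Q
      by (simp add: s_def field_simps)
  have "\<phi> y - \<phi> x \<le> A * norm (y - x) powr \<alpha>" if x: "x \<in> ball x0 r" for x y
  proof (cases "y \<in> ball x0 d")
    case True
    then show ?thesis using x r d(1) by (intro d(2)) auto
  next
    case False
    have xr: "norm (x - x0) \<le> r" using x by (simp add: dist_norm norm_minus_commute)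
    then have xra: "norm (x - x0) powr \<alpha> \<le> r powr \<alpha>" using \<alpha> by (intro powr_mono2) auto
    have far: "d / 2 \<le> norm (y - x)"
      using False x r dist_triangle[of x0 y x] by (auto simp: dist_norm norm_minus_commute)
    have "norm (y - x0) powr \<alpha> \<le> (norm (y - x) + norm (x - x0)) powr \<alpha>"
      using \<alpha> norm_triangle_ineq[of "y - x" "x - x0"] by (intro powr_mono2) auto
    also have "\<dots> \<le> norm (y - x) powr \<alpha> + norm (x - x0) powr \<alpha>"
      using \<alpha> by (intro powr_subadditive) auto
    finally have "L * norm (y - x0) powr \<alpha> \<le> L * (norm (y - x) powr \<alpha> + r powr \<alpha>)"
      using xra L by (intro mult_left_mono) auto
    moreover have "\<phi> y - \<phi> x0 \<le> L * norm (y - x0) powr \<alpha>" unfolding L_def by (rule le_L_plus)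
    moreover have "\<phi> x0 - \<phi> x \<le> Q * norm (x - x0) powr \<alpha>"
      using Q(2)[of x0 x] by (simp add: norm_minus_commute abs_le_iff)
    then have "\<phi> x0 - \<phi> x \<le> Q * r powr \<alpha>"
      using mult_left_mono[OF xra less_imp_le[OF Q(1)]] by linarith
    moreover have "(A - L) * (d / 2) powr \<alpha> \<le> (A - L) * norm (y - x) powr \<alpha>"
      using far d L \<alpha> by (intro mult_left_mono powr_mono2) auto
    ultimately show ?thesis using rs by (simp add: algebra_simps)
  qed
  then show ?thesis using r(1) that by blast
qed

end

text \<open>Lets everything be proved for \<open>L_plus\<close> alone, with negated
  functions.\<close>

lemma L_minus_eq: "L_minus \<alpha> \<phi> x = - L_plus \<alpha> (\<lambda>x. - \<phi> x) x"
proof -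
  have "(\<lambda>y. (\<phi> y - \<phi> x) / norm (y - x) powr \<alpha>) ` {y. y \<noteq> x}
      = uminus ` (\<lambda>y. (- \<phi> y - - \<phi> x) / norm (y - x) powr \<alpha>) ` {y. y \<noteq> x}"
    unfolding image_image by (intro image_cong) (auto simp: minus_divide_left)
  then show ?thesis
    by (simp add: L_minus_def L_plus_def Inf_real_def image_image)
qed

section \<open>Perturbed test functions\<close>

text \<open>\<open>f\<close> is the sequence of eigenfunctions when testing the supersolution property, and its negative
  when testing the subsolution property.\<close>

locale flux_test =
  fixes f :: "nat \<Rightarrow> 'a::euclidean_space \<Rightarrow> real" and F \<Phi> :: "'a \<Rightarrow> real" and p :: "nat \<Rightarrow> real"
    and \<alpha> N M r \<rho> \<kappa> H :: real and x0 :: 'a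
  assumes p: "filterlim p at_top sequentially" and \<alpha>: "0 < \<alpha>" "\<alpha> \<le> 1" and M: "0 < M"
    and lim: "uniform_limit UNIV f F sequentially" and f_cont: "\<And>k. continuous_on UNIV (f k)"
    and f_bound: "\<And>k x. \<bar>f k x\<bar> \<le> N"
    and f_Hoelder: "\<And>k x y. norm (y - x) \<le> 1 \<Longrightarrow> \<bar>f k y - f k x\<bar> \<le> N * norm (y - x) powr (\<alpha> / 2)"
    and \<Phi>_cont: "continuous_on UNIV \<Phi>" and pos: "0 < r" "0 < \<rho>" "0 < \<kappa>"
    and \<Phi>_bound: "\<And>x y. \<bar>\<Phi> y - \<Phi> x\<bar> \<le> H" "\<And>x y. \<bar>\<Phi> y - \<Phi> x\<bar> \<le> H * norm (y - x) powr \<alpha>"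
    and \<Phi>_M: "\<And>x y. x \<in> ball x0 r \<Longrightarrow> \<Phi> x - \<Phi> y \<le> M * norm (y - x) powr \<alpha>"
    and \<Phi>_F: "\<And>x. x \<notin> ball x0 r \<Longrightarrow> \<Phi> x + \<kappa> \<le> F x" "\<And>x. x \<in> ball x0 \<rho> \<Longrightarrow> F x + \<kappa> \<le> \<Phi> x"
begin

definition \<eta> :: "nat \<Rightarrow> 'a \<Rightarrow> real" where "\<eta> k x = max (\<Phi> x - f k x) 0"

text \<open>The weight is an argument of its own, since in the subsolution case \<open>f\<close> is
  the negative of the eigenfunctions whereas the mass is always weighted by the eigenfunctions
  themselves.\<close>

abbreviation mass :: "(nat \<Rightarrow> 'a \<Rightarrow> real) \<Rightarrow> nat \<Rightarrow> ennreal" where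
  "mass w k \<equiv> \<integral>\<^sup>+ x. ennreal (w k x powr (p k - 1) * \<eta> k x) \<partial>lborel"

lemma \<eta>_nonneg: "0 \<le> \<eta> k x"
  by (simp add: \<eta>_def)

lemma eventually_p_ge: "\<forall>\<^sub>F k in sequentially. c \<le> p k"
  using p by (simp add: filterlim_at_top)

lemma eventually_mult_powr_less_seq:
  assumes "0 < a" "a < b" "0 < c"
  shows "\<forall>\<^sub>F k in sequentially. K * a powr p k < c * b powr p k"
  using eventually_mult_powr_less[OF assms] p by (auto simp: filterlim_iff)

text \<open>The margin \<open>\<kappa>\<close> in the comparison of \<open>\<Phi>\<close> with the
  limit \<open>F\<close> outlasts a uniform error below \<open>\<kappa> / 2\<close>.\<close>

lemma eventually_\<eta>:
  "\<forall>\<^sub>F k in sequentially. (\<forall>x. x \<notin> ball x0 r \<longrightarrow> \<eta> k x = 0) \<and> (\<forall>x\<in>ball x0 \<rho>. \<kappa> / 2 \<le> \<eta> k x)"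
proof -
  have "\<forall>\<^sub>F k in sequentially. \<forall>x. \<bar>f k x - F x\<bar> < \<kappa> / 2"
    using pos by (intro uniform_limit_abs_lt[OF lim]) auto
  then show ?thesis
  proof eventually_elim
    case (elim k)
    have "\<eta> k x = 0" if "x \<notin> ball x0 r" for x
    proof -
      have "\<Phi> x - f k x \<le> 0"
        using elim[rule_format, of x] \<Phi>_F(1)[OF that] pos unfolding abs_less_iff by linarith
      then show ?thesis by (simp add: \<eta>_def)
    qed
    moreover have "\<kappa> / 2 \<le> \<eta> k x" if "x \<in> ball x0 \<rho>" for x
    proof -
      have "\<kappa> / 2 \<le> \<Phi> x - f k x"
        using elim[rule_format, of x] \<Phi>_F(2)[OF that] unfolding abs_less_iff by linarith
      then show ?thesis unfolding \<eta>_def by linarith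
    qed
    ultimately show ?case by blast
  qed
qed

lemma \<eta>_diff: "\<bar>\<eta> k y - \<eta> k x\<bar> \<le> H + 2 * N"
  "norm (y - x) \<le> 1 \<Longrightarrow> \<bar>\<eta> k y - \<eta> k x\<bar> \<le> (H + 2 * N) * norm (y - x) powr (\<alpha> / 2)"
proof -
  have le: "\<bar>\<eta> k y - \<eta> k x\<bar> \<le> \<bar>\<Phi> y - \<Phi> x\<bar> + \<bar>f k y - f k x\<bar>" by (auto simp: \<eta>_def max_def)
  then show "\<bar>\<eta> k y - \<eta> k x\<bar> \<le> H + 2 * N"
    using \<Phi>_bound(1)[of y x] f_bound[of k x] f_bound[of k y] by linarith
  assume t: "norm (y - x) \<le> 1"
  have "0 \<le> H" using \<Phi>_bound(1)[of x x] by simp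
  have "norm (y - x) powr \<alpha> \<le> norm (y - x) powr (\<alpha> / 2)"
    using t \<alpha> by (cases "x = y") (auto intro!: powr_mono')
  then have "\<bar>\<Phi> y - \<Phi> x\<bar> \<le> H * norm (y - x) powr (\<alpha> / 2)"
    using \<Phi>_bound(2)[of y x] \<open>0 \<le> H\<close> by (meson mult_left_mono order_trans)
  moreover have "0 \<le> N * norm (y - x) powr (\<alpha> / 2)" using f_Hoelder[OF t, of k] by linarith
  ultimately show "\<bar>\<eta> k y - \<eta> k x\<bar> \<le> (H + 2 * N) * norm (y - x) powr (\<alpha> / 2)"
    using le f_Hoelder[OF t, of k] by (simp add: algebra_simps)
qed

lemma flux_pos_upper:
  "\<exists>C\<ge>0. \<forall>\<^sub>F k in sequentially. flux_pos \<alpha> (p k) \<Phi> (\<eta> k) \<le> ennreal (C * M powr p k)"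
proof -
  define n where "n = real DIM('a)"
  \<comment> \<open>Puts the decay exponent \<alpha> m + \<alpha> above the dimension, with the same
    m for all p.\<close>
  define m where "m = (n + 1) / \<alpha>"
  have n: "1 \<le> n" using DIM_positive[where 'a='a] by (simp add: n_def)
  have m: "0 \<le> m" "\<alpha> * m = n + 1" using \<alpha> n by (auto simp: m_def)
  define I where "I = 2 * emeasure lborel (ball x0 r) * (\<integral>\<^sup>+ z. ennreal (radial_weight (\<alpha> / 2) (\<alpha> * m +
      \<alpha>) (norm (z::'a))) \<partial>lborel)"
  have "(\<integral>\<^sup>+ z. ennreal (radial_weight (\<alpha> / 2) (\<alpha> * m + \<alpha>) (norm (z::'a))) \<partial>lborel) < \<infinity>"
    using n \<alpha> unfolding m(2) n_def by (intro integral_radial_weight_finite) linarith+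
  then have "I < \<infinity>"
    unfolding I_def using emeasure_lborel_ball_finite[of x0 r] by (simp add: ennreal_mult_less_top)
  then obtain i where i: "I = ennreal i" "0 \<le> i" by (cases I) auto
  define K where "K = (H + 2 * N) * max (H powr m) (H powr m)"
  have "0 \<le> H + 2 * N" using \<eta>_diff(1)[of 0 x0 x0] by simp
  then have "0 \<le> K" by (simp add: K_def)
  have "\<forall>\<^sub>F k in sequentially. flux_pos \<alpha> (p k) \<Phi> (\<eta> k) \<le> ennreal ((M powr (- 1 - m) * K * i) * M powr p k)"
    using eventually_\<eta> eventually_p_ge[of "m + 1"]
  proof eventually_elim
    case (elim k)
    have "flux_pos \<alpha> (p k) \<Phi> (\<eta> k) \<le> ennreal (M powr (p k - 1 - m) * K) * I"
      unfolding K_def I_def using elim m(1) M \<eta>_nonneg \<eta>_diff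
      by (intro flux_pos_le \<alpha> \<Phi>_bound \<Phi>_M) auto
    also have "\<dots> = ennreal ((M powr (- 1 - m) * K * i) * M powr p k)"
    proof -
      have "M powr (p k - 1 - m) = M powr (- 1 - m) * M powr p k"
        unfolding powr_add[symmetric] by (simp add: algebra_simps)
      then show ?thesis using i \<open>0 \<le> K\<close> by (simp add: mult_ac flip: ennreal_mult)
    qed
    finally show ?case .
  qed
  moreover have "0 \<le> M powr (- 1 - m) * K * i" using i \<open>0 \<le> K\<close> by simp
  ultimately show ?thesis by blast
qed

lemma flux_neg_lower:
  assumes "0 < b" and y0: "2 * r \<le> dist x0 y0" "b * norm (y0 - x0) powr \<alpha> < \<Phi> y0 - \<Phi> x0"
  shows "\<exists>c>0. \<forall>\<^sub>F k in sequentially. ennreal (c * b powr p k) \<le> flux_neg \<alpha> (p k) \<Phi> (\<eta> k)"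
proof -
  define G where "G z = \<Phi> (snd z) - \<Phi> (fst z) - b * norm (snd z - fst z) powr \<alpha>" for z :: "'a \<times> 'a"
  have "continuous_on UNIV G"
    unfolding G_def using \<alpha> by (auto intro!: continuous_intros continuous_on_compose2[OF \<Phi>_cont]
        continuous_on_powr')
  then have "open {z. 0 < G z}" by (intro open_Collect_less continuous_intros)
  moreover have "(x0, y0) \<in> {z. 0 < G z}" using y0(2) by (simp add: G_def)
  ultimately obtain A B where AB: "open A" "open B" "(x0, y0) \<in> A \<times> B" "A \<times> B \<subseteq> {z. 0 < G z}"
    by (rule open_prod_elim)
  obtain r1 r2 where r12: "0 < r1" "ball x0 r1 \<subseteq> A" "0 < r2" "ball y0 r2 \<subseteq> B"
    using AB open_contains_ball by (metis mem_Sigma_iff)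
  \<comment> \<open>A radius at most \<open>r\<close> keeps the ball around \<open>y0\<close>, which
    is at least 2 r away from \<open>x0\<close>, off the set where \<open>\<eta>\<close> can be
    positive; a radius at most \<open>\<rho>\<close> keeps \<open>\<eta>\<close> bounded below
    around \<open>x0\<close>. Both hold for all large k.\<close>
  define s where "s = min (min r1 r2) (min r \<rho>)"
  have s: "0 < s" "s \<le> r1" "s \<le> r2" "s \<le> r" "s \<le> \<rho>" using r12 pos by (auto simp: s_def)
  define D where "D = norm (y0 - x0) + 2 * s"
  have "x0 \<noteq> y0" using y0 pos by auto
  then have "0 < D" using s by (simp add: D_def add_nonneg_pos)
  have prod: "b * norm (y - x) powr \<alpha> < \<Phi> y - \<Phi> x \<and> norm (y - x) \<le> D" if "x \<in> ball x0 s" "y \<in> ball y0 s"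
      for x y
  proof
    have "(x, y) \<in> A \<times> B" using that r12 s by auto
    then show "b * norm (y - x) powr \<alpha> < \<Phi> y - \<Phi> x" using AB(4) by (auto simp: G_def)
    show "norm (y - x) \<le> D"
      using that dist_triangle[of y x y0] dist_triangle[of y0 x x0]
          by (auto simp: D_def dist_norm norm_minus_commute)
  qed
  define m where "m = measure lborel (ball x0 s) * measure lborel (ball y0 s)"
  have m: "0 < m" "emeasure lborel (ball x0 s) * emeasure lborel (ball y0 s) = ennreal m"
    using s emeasure_lborel_ball_finite[of x0 s] emeasure_lborel_ball_finite[of y0 s]
    by (auto simp: m_def emeasure_eq_ennreal_measure ennreal_mult)
  define c where "c = b powr (- 1) * (\<kappa> / 2) * D powr (- \<alpha>) * m"
  have "0 < c" using \<open>0 < b\<close> pos \<open>0 < D\<close> m by (simp add: c_def)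
  moreover have "\<forall>\<^sub>F k in sequentially. ennreal (c * b powr p k) \<le> flux_neg \<alpha> (p k) \<Phi> (\<eta> k)"
    using eventually_\<eta> eventually_p_ge[of 1]
  proof eventually_elim
    case (elim k)
    have "ennreal (c * b powr p k) = ennreal (b powr (p k - 1) * (\<kappa> / 2) * D powr (- \<alpha>)) * ennreal m"
    proof -
      have "b powr (p k - 1) = b powr (- 1) * b powr p k"
        by (simp only: powr_add[symmetric] uminus_add_conv_diff)
      then show ?thesis using pos m by (simp add: c_def mult_ac flip: ennreal_mult)
    qed
    also have "\<dots> \<le> flux_neg \<alpha> (p k) \<Phi> (\<eta> k)"
      unfolding m(2)[symmetric]
    proof (rule flux_neg_ge[OF elim(2) \<alpha>(1) \<open>0 < b\<close> _ prod])
      show "\<kappa> / 2 \<le> \<eta> k x" if "x \<in> ball x0 s" for x using elim(1) that s by auto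
      show "\<eta> k y = 0" if "y \<in> ball y0 s" for y
      proof -
        have "y \<notin> ball x0 r" using that y0(1) s dist_triangle[of x0 y0 y] by (auto simp: dist_commute)
        then show ?thesis using elim(1) by blast
      qed
    qed (use pos in auto)
    finally show ?case .
  qed
  ultimately show ?thesis by blast
qed

lemma weighted_mass_lower:
  assumes w: "uniform_limit UNIV w W sequentially" and W: "continuous_on UNIV W" and s: "0 < s" "s < W x0"
  shows "\<exists>c>0. \<forall>\<^sub>F k in sequentially. ennreal (c * s powr p k) \<le> mass w k"
proof -
  define s' where "s' = (s + W x0) / 2"
  have s': "s < s'" "s' < W x0" using s by (auto simp: s'_def)
  have "open {x. s' < W x}" by (intro open_Collect_less continuous_intros W)
  then obtain t where t: "0 < t" "ball x0 t \<subseteq> {x. s' < W x}"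
    using s' by (metis mem_Collect_eq open_contains_ball)
  define d where "d = min t \<rho>"
  have d: "0 < d" "d \<le> t" "d \<le> \<rho>" using t pos by (auto simp: d_def)
  define m where "m = measure lborel (ball x0 d)"
  have m: "0 < m" "emeasure lborel (ball x0 d) = ennreal m"
    using d emeasure_lborel_ball_finite[of x0 d] by (auto simp: m_def emeasure_eq_ennreal_measure)
  define c where "c = s powr (- 1) * (\<kappa> / 2) * m"
  have "0 < c" using s pos m by (simp add: c_def)
  moreover have "\<forall>\<^sub>F k in sequentially. \<forall>x. \<bar>w k x - W x\<bar> < s' - s"
    using s' by (intro uniform_limit_abs_lt[OF w]) auto
  then have "\<forall>\<^sub>F k in sequentially. ennreal (c * s powr p k) \<le> mass w k"
    using eventually_\<eta> eventually_p_ge[of 1]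
  proof eventually_elim
    case (elim k)
    have "ennreal (c * s powr p k) = ennreal (s powr (p k - 1) * (\<kappa> / 2)) * emeasure lborel (ball x0 d)"
    proof -
      have "s powr (p k - 1) = s powr (- 1) * s powr p k"
        by (simp only: powr_add[symmetric] uminus_add_conv_diff)
      then show ?thesis using pos m by (simp add: c_def mult_ac flip: ennreal_mult)
    qed
    also have "\<dots> = (\<integral>\<^sup>+ x. ennreal (s powr (p k - 1) * (\<kappa> / 2)) * indicator (ball x0 d) x \<partial>lborel)"
      by (subst nn_integral_cmult_indicator) auto
    also have "\<dots> \<le> mass w k"
    proof (intro nn_integral_mono)
      fix x
      have "s powr (p k - 1) * (\<kappa> / 2) \<le> w k x powr (p k - 1) * \<eta> k x" if x: "x \<in> ball x0 d"
      proof (rule mult_mono)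
        have "x \<in> ball x0 t" using x d by simp
        then have "s' < W x" using t(2) by blast
        then have "s \<le> w k x" using elim(1)[rule_format, of x] by (simp add: abs_less_iff)
        then show "s powr (p k - 1) \<le> w k x powr (p k - 1)" using s elim(3) by (intro powr_mono2) auto
        show "\<kappa> / 2 \<le> \<eta> k x" using elim(2) x d by auto
      qed (use pos in auto)
      then show "ennreal (s powr (p k - 1) * (\<kappa> / 2)) * indicator (ball x0 d) x
          \<le> ennreal (w k x powr (p k - 1) * \<eta> k x)"
        by (auto simp: indicator_def intro: ennreal_leI)
    qed
    finally show ?case .
  qed
  ultimately show ?thesis by blast
qed

lemma weighted_mass_upper:
  assumes w: "uniform_limit UNIV w W sequentially" and s: "0 < s" "s' < s" "\<And>x. x \<in> ball x0 r \<Longrightarrow> W x \<le> s'"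
    and w_nonneg: "\<And>k x. 0 \<le> w k x"
  shows "\<exists>C\<ge>0. \<forall>\<^sub>F k in sequentially. mass w k \<le> ennreal (C * s powr p k)"
proof -
  define m where "m = measure lborel (ball x0 r)"
  have m: "0 \<le> m" "emeasure lborel (ball x0 r) = ennreal m"
    using emeasure_lborel_ball_finite[of x0 r] by (auto simp: m_def emeasure_eq_ennreal_measure)
  have HN: "0 \<le> H + 2 * N" using \<eta>_diff(1)[of 0 x0 x0] by simp
  \<comment> \<open>At a point outside the ball \<open>\<eta>\<close> is 0 for large k, so the
    oscillation bound becomes a bound on \<open>\<eta>\<close> itself.\<close>
  obtain z where z: "z \<notin> ball x0 r"
    using bounded_ball not_bounded_UNIV by (metis UNIV_eq_I)
  define C where "C = s powr (- 1) * (H + 2 * N) * m"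
  have "0 \<le> C" using HN m by (simp add: C_def)
  moreover have "\<forall>\<^sub>F k in sequentially. \<forall>x. \<bar>w k x - W x\<bar> < s - s'"
    using s by (intro uniform_limit_abs_lt[OF w]) auto
  then have "\<forall>\<^sub>F k in sequentially. mass w k \<le> ennreal (C * s powr p k)"
    using eventually_\<eta> eventually_p_ge[of 1]
  proof eventually_elim
    case (elim k)
    have "mass w k
        \<le> (\<integral>\<^sup>+ x. ennreal (s powr (p k - 1) * (H + 2 * N)) * indicator (ball x0 r) x \<partial>lborel)"
    proof (intro nn_integral_mono)
      fix x
      have "w k x powr (p k - 1) * \<eta> k x \<le> s powr (p k - 1) * (H + 2 * N)" if x: "x \<in> ball x0 r"
      proof (rule mult_mono)
        have "w k x \<le> s" using elim(1)[rule_format, of x] s(3)[OF x] by (simp add: abs_less_iff)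
        then show "w k x powr (p k - 1) \<le> s powr (p k - 1)" using w_nonneg elim(3)
            by (intro powr_mono2) auto
        show "\<eta> k x \<le> H + 2 * N" using \<eta>_diff(1)[of k x z] elim(2) z \<eta>_nonneg[of k x] by simp
      qed (auto simp: \<eta>_nonneg)
      then show "ennreal (w k x powr (p k - 1) * \<eta> k x)
          \<le> ennreal (s powr (p k - 1) * (H + 2 * N)) * indicator (ball x0 r) x"
        using elim(2) by (cases "x \<in> ball x0 r") (auto intro: ennreal_leI simp del: mem_ball)
    qed
    also have "\<dots> = ennreal (s powr (p k - 1) * (H + 2 * N)) * ennreal m"
      using m by (subst nn_integral_cmult_indicator) auto
    also have "\<dots> = ennreal (C * s powr p k)"
    proof -
      have "s powr (p k - 1) = s powr (- 1) * s powr p k"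
        by (simp only: powr_add[symmetric] uminus_add_conv_diff)
      then show ?thesis using HN m by (simp add: C_def mult_ac flip: ennreal_mult)
    qed
    finally show ?case .
  qed
  ultimately show ?thesis by blast
qed

end

text \<open>The lowering term is a multiple of the truncated distance to \<open>x0\<close>. For
  every \<alpha> \<le> 1 that distance has Hoelder constant 1, so all quotients change by at most
  the chosen multiple, and it separates \<open>\<Phi>\<close> from \<open>F\<close> outside the
  ball. It is not differentiable at \<open>x0\<close>, which is harmless as only quotients of
  \<open>\<Phi>\<close> are used. Upper semicontinuity extends the quotient bound from
  \<open>x0\<close> to all base points in a ball.\<close>

lemma perturbed_test_function:
  fixes \<phi> F :: "'a::euclidean_space \<Rightarrow> real"
  assumes phi: "\<phi> \<in> Cc1" and touch: "touches_below \<phi> F x0"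
    and M: "- L_minus \<alpha> \<phi> x0 < M" "0 < M" and pos: "0 < \<epsilon>" "0 < r0" "0 < \<kappa>0"
    and F: "continuous_on UNIV F" and \<alpha>: "0 < \<alpha>" "\<alpha> \<le> 1" and p: "filterlim p at_top sequentially"
    and f: "uniform_limit UNIV f F sequentially" "\<And>k. continuous_on UNIV (f k)" "\<And>k x. \<bar>f k x\<bar> \<le> N"
      "\<And>k x y. norm (y - x) \<le> 1 \<Longrightarrow> \<bar>f k y - f k x\<bar> \<le> N * norm (y - x) powr (\<alpha> / 2)"
  obtains \<Phi> r \<rho> \<kappa> H where "flux_test f F \<Phi> p \<alpha> N M r \<rho> \<kappa> H x0" "r \<le> r0"
    "\<And>x y. \<phi> y - \<phi> x - \<epsilon> * norm (y - x) powr \<alpha> \<le> \<Phi> y - \<Phi> x" "\<And>x. \<Phi> x \<le> \<phi> x + \<kappa>0"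
proof -
  have M': "L_plus \<alpha> (\<lambda>x. - \<phi> x) x0 < M" using M(1) by (simp add: L_minus_eq)
  then obtain M1 where M1: "L_plus \<alpha> (\<lambda>x. - \<phi> x) x0 < M1" "M1 < M" by (meson dense)
  obtain r1 where r1: "0 < r1" "\<And>x y. x \<in> ball x0 r1 \<Longrightarrow> - \<phi> y - - \<phi> x \<le> M1 * norm (y - x) powr \<alpha>"
    by (rule L_plus_upper_semicontinuous[OF Cc1_uminus[OF phi] \<alpha> M1(1)]) blast
  obtain H where H: "0 < H" "\<And>x. \<bar>\<phi> x\<bar> \<le> H" "\<And>x y. \<bar>\<phi> y - \<phi> x\<bar> \<le> H * norm (y - x)"
    "\<And>x y. \<bar>\<phi> y - \<phi> x\<bar> \<le> H * norm (y - x) powr \<alpha>"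
    by (rule Cc1_Hoelder[OF phi \<alpha>]) blast
  \<comment> \<open>\<open>M - M1\<close> is what the strict inequality for M leaves for the
    penalty, \<open>\<epsilon>\<close> is what the caller tolerates.\<close>
  define \<epsilon>' where "\<epsilon>' = min \<epsilon> (M - M1)"
  have \<epsilon>': "0 < \<epsilon>'" "\<epsilon>' \<le> \<epsilon>" "\<epsilon>' \<le> M - M1" using pos M1 by (auto simp: \<epsilon>'_def)
  define r where "r = min (min r0 r1) 1"
  have r: "0 < r" "r \<le> r0" "r \<le> r1" "r \<le> 1" using pos r1 by (auto simp: r_def)
  \<comment> \<open>Outside the ball the penalty is at least \<epsilon>' r. Raising by at most half
    of it leaves the other half for the margin \<open>\<kappa>\<close>.\<close>
  define c where "c = min (\<epsilon>' * r / 2) \<kappa>0"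
  have c: "0 < c" "c \<le> \<epsilon>' * r / 2" "c \<le> \<kappa>0" using \<epsilon>' r pos by (auto simp: c_def)
  define \<theta> where "\<theta> x = min 1 (dist x x0)" for x
  define \<Phi> where "\<Phi> x = \<phi> x - \<epsilon>' * \<theta> x + c" for x
  have \<theta>: "\<bar>\<theta> y - \<theta> x\<bar> \<le> 1 * norm (y - x) powr \<alpha>" "\<bar>\<theta> y - \<theta> x\<bar> \<le> 1" for x y
  proof -
    have "0 \<le> \<theta> z" "\<theta> z \<le> 1" for z by (auto simp: \<theta>_def)
    from this[of x] this[of y] show 1: "\<bar>\<theta> y - \<theta> x\<bar> \<le> 1" by linarith
    have "\<bar>\<theta> y - \<theta> x\<bar> \<le> 1 * norm (y - x)"
      using dist_triangle[of x x0 y] dist_triangle[of y x0 x]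
          by (auto simp: \<theta>_def min_def dist_norm[of y x, symmetric] dist_commute)
    then show "\<bar>\<theta> y - \<theta> x\<bar> \<le> 1 * norm (y - x) powr \<alpha>"
      using 1 by (intro Lipschitz_bounded_imp_Hoelder \<alpha>) auto
  qed
  have diff: "\<Phi> y - \<Phi> x = (\<phi> y - \<phi> x) - \<epsilon>' * (\<theta> y - \<theta> x)" for x y
    by (simp add: \<Phi>_def algebra_simps)
  have \<epsilon>\<theta>: "\<bar>\<epsilon>' * (\<theta> y - \<theta> x)\<bar> \<le> \<epsilon>' * norm (y - x) powr \<alpha>" "\<bar>\<epsilon>' * (\<theta> y - \<theta> x)\<bar> \<le> \<epsilon>'" for x y
    using mult_left_mono[OF \<theta>(1)[of y x], of \<epsilon>'] mult_left_mono[OF \<theta>(2)[of y x], of \<epsilon>'] \<epsilon>'(1)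
        by (simp_all add: abs_mult)
  have "continuous_on UNIV \<phi>"
  proof -
    have "\<phi> differentiable (at x)" for x using phi by (simp add: Cc1_def)
    then show ?thesis by (intro continuous_at_imp_continuous_on ballI differentiable_imp_continuous_within)
  qed
  then have cont: "continuous_on UNIV \<Phi>" unfolding \<Phi>_def \<theta>_def by (intro continuous_intros)
  have "F x0 + c / 2 < \<Phi> x0"
    using touch c by (simp add: touches_below_def \<Phi>_def \<theta>_def)
  moreover have "open {x. F x + c / 2 < \<Phi> x}" by (intro open_Collect_less continuous_intros F cont)
  ultimately obtain \<rho> where \<rho>: "0 < \<rho>" "ball x0 \<rho> \<subseteq> {x. F x + c / 2 < \<Phi> x}"
    by (metis mem_Collect_eq open_contains_ball)
  define \<kappa> where "\<kappa> = min (\<epsilon>' * r / 2) (c / 2)"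
  have \<kappa>: "0 < \<kappa>" "\<kappa> \<le> \<epsilon>' * r / 2" "\<kappa> \<le> c / 2" using \<epsilon>' r c by (auto simp: \<kappa>_def)
  have "flux_test f F \<Phi> p \<alpha> N M r \<rho> \<kappa> (2 * H + \<epsilon>') x0"
  proof (unfold_locales)
    fix x y
    show "\<bar>\<Phi> y - \<Phi> x\<bar> \<le> 2 * H + \<epsilon>'"
      using H(2)[of x] H(2)[of y] \<epsilon>\<theta>(2)[of y x] unfolding diff by linarith
    show "\<bar>\<Phi> y - \<Phi> x\<bar> \<le> (2 * H + \<epsilon>') * norm (y - x) powr \<alpha>"
    proof -
      have "\<bar>\<Phi> y - \<Phi> x\<bar> \<le> H * norm (y - x) powr \<alpha> + \<epsilon>' * norm (y - x) powr \<alpha>"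
        using H(4)[of y x] \<epsilon>\<theta>(1)[of y x] unfolding diff by linarith
      also have "\<dots> \<le> (2 * H + \<epsilon>') * norm (y - x) powr \<alpha>"
        using H(1) by (simp add: distrib_right)
      finally show ?thesis .
    qed
    show "\<Phi> x - \<Phi> y \<le> M * norm (y - x) powr \<alpha>" if "x \<in> ball x0 r"
    proof -
      have "\<phi> x - \<phi> y \<le> M1 * norm (y - x) powr \<alpha>" using r1(2)[of x y] that r by simp
      moreover have "\<epsilon>' * norm (y - x) powr \<alpha> \<le> (M - M1) * norm (y - x) powr \<alpha>"
        using \<epsilon>'(3) by (intro mult_right_mono) auto
      ultimately show ?thesis using \<epsilon>\<theta>(1)[of x y] diff[of x y]
          by (simp add: norm_minus_commute algebra_simps)
    qed
    show "\<Phi> x + \<kappa> \<le> F x" if "x \<notin> ball x0 r"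
    proof -
      have "r \<le> \<theta> x" using that r by (simp add: \<theta>_def dist_commute)
      then have "\<epsilon>' * r \<le> \<epsilon>' * \<theta> x" using \<epsilon>' by simp
      moreover have "\<phi> x \<le> F x" using touch by (simp add: touches_below_def)
      ultimately show ?thesis using c \<kappa> by (simp add: \<Phi>_def)
    qed
    show "F x + \<kappa> \<le> \<Phi> x" if "x \<in> ball x0 \<rho>" using \<rho>(2) that \<kappa> by force
  qed (use p \<alpha> M(2) f cont r \<rho>(1) \<kappa>(1) in auto)
  moreover have "\<phi> y - \<phi> x - \<epsilon> * norm (y - x) powr \<alpha> \<le> \<Phi> y - \<Phi> x" for x y
    using \<epsilon>\<theta>(1)[of y x] mult_right_mono[OF \<epsilon>'(2), of "norm (y - x) powr \<alpha>"] unfolding diff by simp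
  moreover have "\<Phi> x \<le> \<phi> x + \<kappa>0" for x
  proof -
    have "0 \<le> \<epsilon>' * \<theta> x" using \<epsilon>' by (simp add: \<theta>_def)
    then show ?thesis using c unfolding \<Phi>_def by linarith
  qed
  ultimately show ?thesis using r(2) that by blast
qed

section \<open>Passage to the limit\<close>

lemma Lambda_infty_pow_pos:
  assumes "open \<Omega>" "bounded \<Omega>" "\<Omega> \<noteq> {}"
  shows "0 < Lambda_infty_pow \<alpha> \<Omega>"
  using inradius_pos[OF assms] by (simp add: Lambda_infty_pow_def)

lemma product_margin_below:
  fixes a b M :: real
  assumes "0 < a" "0 < b" "0 \<le> M" "M < a * b"
  obtains s t where "0 < s" "s < a" "0 < t" "t < b" "M < s * t"
proof -
  have "M / b < a" using assms by (simp add: field_simps)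
  then obtain s where s: "M / b < s" "s < a" by (meson dense)
  have "0 \<le> M / b" using assms by simp
  then have "0 < s" using s by linarith
  have "M / s < b" using s assms \<open>0 < s\<close> by (simp add: field_simps)
  then obtain t where t: "M / s < t" "t < b" by (meson dense)
  have "0 \<le> M / s" using assms \<open>0 < s\<close> by simp
  then have "0 < t" using t by linarith
  moreover have "M < s * t" using t \<open>0 < s\<close> by (simp add: field_simps)
  ultimately show ?thesis using that s t \<open>0 < s\<close> by blast
qed

lemma product_margin_above:
  fixes a b M :: real
  assumes "0 < a" "0 < b" "a * b < M"
  obtains s t where "a < s" "b < t" "s * t < M"
proof -
  have "a < M / b" using assms by (simp add: field_simps)
  then obtain s where s: "a < s" "s < M / b" by (meson dense)
  have "b < M / s" using s assms by (simp add: field_simps)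
  then obtain t where t: "b < t" "t < M / s" by (meson dense)
  have "s * t < M" using t s assms by (simp add: field_simps)
  then show ?thesis using that s t by blast
qed

locale eigenfunction_limit =
  fixes \<Omega> :: "'a::euclidean_space set" and \<alpha> N :: real and p :: "nat \<Rightarrow> real"
    and v :: "nat \<Rightarrow> 'a \<Rightarrow> real" and U :: "'a \<Rightarrow> real"
  assumes \<Omega>: "open \<Omega>" "bounded \<Omega>" "\<Omega> \<noteq> {}" and \<alpha>: "0 < \<alpha>" "\<alpha> \<le> 1"
    and p: "filterlim p at_top sequentially"
    and v: "\<And>k. continuous_on UNIV (v k)" "\<And>k x. x \<notin> \<Omega> \<Longrightarrow> v k x = 0" "\<And>k x. 0 \<le> v k x"
      "\<And>k. Lp_power (p k) (v k) = 1" "\<And>k. frac_energy (\<alpha> * p k) (p k) (v k) = first_eigenvalue \<alpha> (p k) \<Omega>"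
    and v_bound: "\<And>k x. \<bar>v k x\<bar> \<le> N"
    and v_Hoelder: "\<And>k x y. norm (y - x) \<le> 1 \<Longrightarrow> \<bar>v k y - v k x\<bar> \<le> N * norm (y - x) powr (\<alpha> / 2)"
    and lim: "uniform_limit UNIV v U sequentially"
begin

abbreviation "\<Lambda> \<equiv> Lambda_infty_pow \<alpha> \<Omega>"

lemma U_cont: "continuous_on UNIV U"
  by (rule uniform_limit_theorem[OF _ lim]) (auto simp: v)

lemma v_tendsto: "(\<lambda>k. v k x) \<longlonglongrightarrow> U x"
  by (rule tendsto_uniform_limitI[OF lim]) simp

lemma U_off: "x \<notin> \<Omega> \<Longrightarrow> U x = 0"
  using v_tendsto[of x] v(2)[of x] LIMSEQ_unique[of "\<lambda>k. v k x" "U x" 0] by simp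

lemma U_nonneg: "0 \<le> U x"
  by (rule LIMSEQ_le_const[OF v_tendsto]) (use v(3) in auto)

lemma U_C0_closure: "U \<in> C0_closure \<Omega>"
proof -
  have "U x = 0" if "x \<in> frontier \<Omega>" for x
    using that \<Omega>(1) U_off[of x] by (auto simp: frontier_def interior_open)
  moreover have "U x = 0" if "x \<notin> closure \<Omega>" for x
    using that closure_subset[of \<Omega>] by (intro U_off) blast
  ultimately show ?thesis
    using continuous_on_subset[OF U_cont] by (auto simp: C0_closure_def)
qed

lemma U_Cc: "U \<in> Cc"
proof -
  have "{x. U x \<noteq> 0} \<subseteq> \<Omega>" using U_off by blast
  then have "bounded {x. U x \<noteq> 0}" using \<Omega>(2) bounded_subset by blast
  then show ?thesis using U_cont by (simp add: Cc_def supp_def)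
qed

lemma Lambda_pos: "0 < \<Lambda>"
  by (rule Lambda_infty_pow_pos[OF \<Omega>])

lemma eventually_eigenvalue_le:
  assumes "\<Lambda> < L"
  shows "\<forall>\<^sub>F k in sequentially. first_eigenvalue \<alpha> (p k) \<Omega> \<le> ennreal (L powr p k)"
  using first_eigenvalue_upper_bound[OF \<Omega> \<alpha> assms] p by (auto simp: filterlim_iff)

lemma eventually_eigenvalue_ge:
  assumes "0 < L" "L < \<Lambda>"
  shows "\<forall>\<^sub>F k in sequentially. ennreal (L powr p k) \<le> first_eigenvalue \<alpha> (p k) \<Omega>"
proof -
  obtain x where x: "x \<in> \<Omega>" "1 \<le> U x"
    using limit_attains_one[OF \<Omega>(2,1) lim U_cont U_off v(2,3,4) p] by blast
  show ?thesis
    using eventually_energy_ge_Lambda[OF \<Omega>(2,1,3) \<alpha>(1) lim U_cont U_off p x assms] by (simp add: v(5))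
qed

lemma eventually_eigenvalue_finite:
  "\<forall>\<^sub>F k in sequentially. \<exists>l\<ge>0. first_eigenvalue \<alpha> (p k) \<Omega> = ennreal l"
proof -
  have "\<forall>\<^sub>F k in sequentially. first_eigenvalue \<alpha> (p k) \<Omega> \<le> ennreal ((\<Lambda> + 1) powr p k)"
    by (rule eventually_eigenvalue_le) simp
  then show ?thesis
  proof eventually_elim
    case (elim k)
    then have "first_eigenvalue \<alpha> (p k) \<Omega> < \<infinity>" by (rule order_le_less_trans) simp
    then show ?case by (cases "first_eigenvalue \<alpha> (p k) \<Omega>") auto
  qed
qed

lemma eventually_p_gt: "\<forall>\<^sub>F k in sequentially. c < p k"
  using p by (simp add: filterlim_at_top_dense)

text \<open>If the largest upward quotient at \<open>x0\<close> exceeded the largest downward one,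
  some \<open>y0\<close> would have a rising quotient above \<open>b\<close>, giving the negative
  flux a rate of at least b against a rate of at most M < b for the positive flux. The eigenvalue
  term is nonnegative and is simply dropped.\<close>

lemma supersolution_gradient:
  assumes x0: "x0 \<in> \<Omega>" and phi: "\<phi> \<in> Cc1" and touch: "touches_below \<phi> U x0"
  shows "L_infty \<alpha> \<phi> x0 \<le> 0"
proof (rule ccontr)
  assume "\<not> ?thesis"
  then have "- L_minus \<alpha> \<phi> x0 < L_plus \<alpha> \<phi> x0" by (simp add: L_infty_def)
  then obtain M where M: "- L_minus \<alpha> \<phi> x0 < M" "M < L_plus \<alpha> \<phi> x0" by (meson dense)
  obtain b where b: "M < b" "b < L_plus \<alpha> \<phi> x0" using M by (meson dense)
  \<comment> \<open>The gap from \<open>b\<close> to \<open>b'\<close> pays for the perturbation of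
    the test function, the gap from \<open>M\<close> to \<open>b\<close> for the constants.\<close>
  obtain b' where b': "b < b'" "b' < L_plus \<alpha> \<phi> x0" using b by (meson dense)
  have "0 \<le> - L_minus \<alpha> \<phi> x0"
    using L_plus_nonneg[OF Cc1_uminus[OF phi] \<alpha>] by (simp add: L_minus_eq)
  then have "0 < M" using M by linarith
  obtain y0 where y0: "y0 \<noteq> x0" "b' * norm (y0 - x0) powr \<alpha> < \<phi> y0 - \<phi> x0"
    by (rule less_L_plusD[OF phi \<alpha> b'(2)])
  obtain r1 where r1: "0 < r1" "ball x0 r1 \<subseteq> \<Omega>" using \<Omega>(1) x0 open_contains_ball by metis
  \<comment> \<open>Half the distance keeps \<open>y0\<close> at least 2 r away from
    \<open>x0\<close>; \<open>r1\<close> keeps the ball, and with it the positive part of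
    \<open>\<Phi>\<close>, inside \<open>\<Omega>\<close>.\<close>
  define r0 where "r0 = min r1 (dist x0 y0 / 2)"
  have r0: "0 < r0" using r1 y0 by (simp add: r0_def)
  have "0 < b' - b" using b' by simp
  obtain \<Phi> r \<rho> \<kappa> H where test: "flux_test v U \<Phi> p \<alpha> N M r \<rho> \<kappa> H x0" and r: "r \<le> r0"
    and \<Phi>: "\<And>x y. \<phi> y - \<phi> x - (b' - b) * norm (y - x) powr \<alpha> \<le> \<Phi> y - \<Phi> x" "\<And>x. \<Phi> x \<le> \<phi> x + 1"
    by (rule perturbed_test_function[OF phi touch M(1) \<open>0 < M\<close> \<open>0
        < b' - b\<close> r0 zero_less_one U_cont \<alpha> p lim v(1) v_bound v_Hoelder], assumption) (rule that)
  interpret flux_test v U \<Phi> p \<alpha> N M r \<rho> \<kappa> H x0 by (rule test)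
  have off: "\<Phi> x \<le> 0" if "x \<notin> \<Omega>" for x
  proof -
    have "x \<notin> ball x0 r" using that subsetD[OF r1(2), of x] r by (auto simp: r0_def)
    then show ?thesis using \<Phi>_F(1)[of x] U_off[OF that] pos(3) by linarith
  qed
  have "b * norm (y0 - x0) powr \<alpha> < \<Phi> y0 - \<Phi> x0"
    using y0(2) \<Phi>(1)[of y0 x0] by (simp add: algebra_simps)
  moreover have "2 * r \<le> dist x0 y0" using r by (simp add: r0_def)
  ultimately obtain c where c: "0 < c" "\<forall>\<^sub>F k in sequentially. ennreal (c * b powr p k)
      \<le> flux_neg \<alpha> (p k) \<Phi> (\<eta> k)"
    using flux_neg_lower[of b y0] b \<open>0 < M\<close> by auto
  obtain C where C: "0 \<le> C" "\<forall>\<^sub>F k in sequentially. flux_pos \<alpha> (p k) \<Phi> (\<eta> k) \<le> ennreal (C * M powr p k)"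
    using flux_pos_upper by blast
  have "\<forall>\<^sub>F k in sequentially. C * M powr p k < c * b powr p k"
    using \<open>0 < M\<close> b c by (intro eventually_mult_powr_less_seq) auto
  with c(2) C(2) eventually_eigenvalue_finite eventually_p_gt[of 1] have "\<forall>\<^sub>F k in sequentially. False"
  proof eventually_elim
    case (elim k)
    then obtain l where l: "0 \<le> l" "first_eigenvalue \<alpha> (p k) \<Omega> = ennreal l" by blast
    have "flux_neg \<alpha> (p k) \<Phi> (\<eta> k) \<le> ennreal l * mass v k + flux_neg \<alpha> (p k) \<Phi> (\<eta> k)"
      by simp
    also have "\<dots> \<le> flux_pos \<alpha> (p k) \<Phi> (\<eta> k)"
      by (rule supersolution_flux_inequality[OF \<Omega>(1,2) elim(4) l v \<Phi>_cont off \<eta>_def])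
    finally have "ennreal (c * b powr p k) \<le> ennreal (C * M powr p k)" using elim by (meson order_trans)
    then have "c * b powr p k \<le> C * M powr p k" using C(1) by (simp add: ennreal_le_iff)
    then show False using elim by simp
  qed
  then show False by simp
qed

text \<open>Here the negative flux is dropped and the eigenvalue term kept: it has rate at least L s
  for suitable L < \<open>\<Lambda>\<close> and s < U x0 with L s > M, whereas the positive flux has
  rate at most M.\<close>

lemma supersolution_eigenvalue:
  assumes x0: "x0 \<in> \<Omega>" and phi: "\<phi> \<in> Cc1" and touch: "touches_below \<phi> U x0"
  shows "L_minus \<alpha> \<phi> x0 + \<Lambda> * \<phi> x0 \<le> 0"
proof (rule ccontr)
  assume "\<not> ?thesis"
  moreover have \<phi>U: "\<phi> x0 = U x0" using touch by (simp add: touches_below_def)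
  ultimately have "- L_minus \<alpha> \<phi> x0 < \<Lambda> * U x0" by simp
  then obtain M where M: "- L_minus \<alpha> \<phi> x0 < M" "M < \<Lambda> * U x0" by (meson dense)
  have "0 \<le> - L_minus \<alpha> \<phi> x0"
    using L_plus_nonneg[OF Cc1_uminus[OF phi] \<alpha>] by (simp add: L_minus_eq)
  then have "0 < M" using M by linarith
  then have "0 < \<Lambda> * U x0" using M by linarith
  then have "0 < U x0" by (rule zero_less_mult_pos[OF _ Lambda_pos])
  obtain L s where Ls: "0 < L" "L < \<Lambda>" "0 < s" "s < U x0" "M < L * s"
    using product_margin_below[OF Lambda_pos \<open>0 < U x0\<close> _ M(2)] \<open>0 < M\<close> by auto
  obtain r0 where r0: "0 < r0" "ball x0 r0 \<subseteq> \<Omega>" using \<Omega>(1) x0 open_contains_ball by metis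
  obtain \<Phi> r \<rho> \<kappa> H where test: "flux_test v U \<Phi> p \<alpha> N M r \<rho> \<kappa> H x0" and r: "r \<le> r0"
    by (rule perturbed_test_function[OF phi touch M(1) \<open>0
        < M\<close> zero_less_one r0(1) zero_less_one U_cont \<alpha> p lim v(1) v_bound v_Hoelder], assumption) (rule
        that)
  interpret flux_test v U \<Phi> p \<alpha> N M r \<rho> \<kappa> H x0 by (rule test)
  have off: "\<Phi> x \<le> 0" if "x \<notin> \<Omega>" for x
  proof -
    have "x \<notin> ball x0 r" using that subsetD[OF r0(2), of x] r by auto
    then show ?thesis using \<Phi>_F(1)[of x] U_off[OF that] pos(3) by linarith
  qed
  obtain c where c: "0 < c" "\<forall>\<^sub>F k in sequentially. ennreal (c * s powr p k) \<le> mass v k"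
    using weighted_mass_lower[OF lim U_cont Ls(3,4)] by blast
  obtain C where C: "0 \<le> C" "\<forall>\<^sub>F k in sequentially. flux_pos \<alpha> (p k) \<Phi> (\<eta> k) \<le> ennreal (C * M powr p k)"
    using flux_pos_upper by blast
  have "\<forall>\<^sub>F k in sequentially. C * M powr p k < c * (L * s) powr p k"
    using \<open>0 < M\<close> Ls c by (intro eventually_mult_powr_less_seq) auto
  with c(2) C(2) eventually_eigenvalue_finite eventually_p_gt[of 1] eventually_eigenvalue_ge[OF Ls(1,2)]
  have "\<forall>\<^sub>F k in sequentially. False"
  proof eventually_elim
    case (elim k)
    then obtain l where l: "0 \<le> l" "first_eigenvalue \<alpha> (p k) \<Omega> = ennreal l" by blast
    have "ennreal (c * (L * s) powr p k) = ennreal (L powr p k) * ennreal (c * s powr p k)"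
      using c Ls by (simp add: powr_mult mult_ac flip: ennreal_mult)
    also have "\<dots> \<le> ennreal l * mass v k"
      using elim l by (intro mult_mono) auto
    also have "\<dots> \<le> ennreal l * mass v k + flux_neg \<alpha> (p k) \<Phi> (\<eta> k)"
      by simp
    also have "\<dots> \<le> flux_pos \<alpha> (p k) \<Phi> (\<eta> k)"
      by (rule supersolution_flux_inequality[OF \<Omega>(1,2) elim(4) l v \<Phi>_cont off \<eta>_def])
    also have "\<dots> \<le> ennreal (C * M powr p k)" by (rule elim)
    finally have "c * (L * s) powr p k \<le> C * M powr p k" using C(1) by (simp add: ennreal_le_iff)
    then show False using elim by simp
  qed
  then show False by simp
qed

text \<open>Failure of both alternatives means that the largest downward quotient of
  \<open>\<psi>\<close> strictly exceeds both its largest upward quotient and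
  \<open>\<Lambda> * U x0\<close>. After the change of sign the first is the rate of the negative
  flux, the other two are those of the positive flux and of the eigenvalue term, so one base M
  separates them.\<close>

lemma subsolution_alternative:
  assumes x0: "x0 \<in> \<Omega>" and psi: "\<psi> \<in> Cc1" and touch: "touches_above \<psi> U x0"
  shows "L_infty \<alpha> \<psi> x0 \<ge> 0 \<or> L_minus \<alpha> \<psi> x0 + \<Lambda> * \<psi> x0 \<ge> 0"
proof (rule ccontr)
  assume neg: "\<not> ?thesis"
  define \<phi> where "\<phi> x = - \<psi> x" for x
  have phi: "\<phi> \<in> Cc1" unfolding \<phi>_def[abs_def] by (rule Cc1_uminus[OF psi])
  have minus: "- L_minus \<alpha> \<phi> x0 = L_plus \<alpha> \<psi> x0" "L_plus \<alpha> \<phi> x0 = - L_minus \<alpha> \<psi> x0"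
    by (simp_all add: L_minus_eq \<phi>_def[abs_def])
  have \<psi>U: "\<psi> x0 = U x0" and \<psi>_ge: "\<And>x. U x \<le> \<psi> x" using touch by (auto simp: touches_above_def)
  have touch': "touches_below \<phi> (\<lambda>x. - U x) x0" using touch
      by (simp add: touches_below_def touches_above_def \<phi>_def)
  define P where "P = L_plus \<alpha> \<phi> x0"
  have P1: "- L_minus \<alpha> \<phi> x0 < P" and P2: "\<Lambda> * U x0 < P"
    using neg by (auto simp: P_def minus L_infty_def \<psi>U)
  \<comment> \<open>At a zero of \<open>U\<close> the nonnegative \<open>\<psi>\<close> would have a
    minimum, so no quotient could fall. Positivity provides the room U x0 / 2 by which
    \<open>\<Phi>\<close> may be raised and allows the product \<open>\<Lambda> * U x0\<close> to be
    split.\<close>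
  have U0: "0 < U x0"
  proof (rule ccontr)
    assume "\<not> 0 < U x0"
    then have "U x0 = 0" using U_nonneg[of x0] by simp
    then have "0 < L_plus \<alpha> \<phi> x0" using P2 by (simp add: P_def)
    then obtain y where "0 * norm (y - x0) powr \<alpha> < \<phi> y - \<phi> x0"
      by (rule less_L_plusD[OF phi \<alpha>])
    then have "\<psi> y < 0" using \<open>U x0 = 0\<close> \<psi>U by (simp add: \<phi>_def)
    then show False using \<psi>_ge[of y] U_nonneg[of y] by simp
  qed
  define M0 where "M0 = max (- L_minus \<alpha> \<phi> x0) (\<Lambda> * U x0)"
  have "M0 < P" using P1 P2 by (simp add: M0_def)
  then obtain M where M: "M0 < M" "M < P" by (meson dense)
  obtain b where b: "M < b" "b < P" using M by (meson dense)
  obtain b' where b': "b < b'" "b' < P" using b by (meson dense)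
  have M1: "- L_minus \<alpha> \<phi> x0 < M" and M2: "\<Lambda> * U x0 < M" using M by (auto simp: M0_def)
  have "0 < M" using M2 Lambda_pos U0 mult_pos_pos by (meson order_less_trans)
  obtain L s where Ls: "\<Lambda> < L" "U x0 < s" "L * s < M"
    using product_margin_above[OF Lambda_pos U0 M2] by metis
  have "0 < L" "0 < s" using Ls Lambda_pos U0 by auto
  obtain s' where s': "U x0 < s'" "s' < s" using Ls by (meson dense)
  obtain y0 where y0: "y0 \<noteq> x0" "b' * norm (y0 - x0) powr \<alpha> < \<phi> y0 - \<phi> x0"
    using b'(2) unfolding P_def by (rule less_L_plusD[OF phi \<alpha>])
  \<comment> \<open>On this neighbourhood a raise by at most U x0 / 2 keeps \<open>\<Phi>\<close>
    below 0, as the competitor requires, and \<open>U < s'\<close> controls the mass.\<close>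
  have "open {x. U x0 / 2 < U x \<and> U x < s'}"
    by (intro open_Collect_conj open_Collect_less continuous_intros U_cont)
  moreover have "x0 \<in> {x. U x0 / 2 < U x \<and> U x < s'}" using s' U0 by simp
  ultimately obtain r1 where r1: "0 < r1" "ball x0 r1 \<subseteq> {x. U x0 / 2 < U x \<and> U x < s'}"
    using open_contains_ball by metis
  define r0 where "r0 = min r1 (dist x0 y0 / 2)"
  have r0: "0 < r0" using r1 y0 by (simp add: r0_def)
  have U2: "0 < U x0 / 2" using U0 by simp
  have "0 < b' - b" using b' by simp
  have minus_v: "uniform_limit UNIV (\<lambda>k x. - v k x) (\<lambda>x. - U x) sequentially"
      "\<And>k. continuous_on UNIV (\<lambda>x. - v k x)"
      "\<And>k x. \<bar>- v k x\<bar> \<le> N"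
      "\<And>k x y. norm (y - x) \<le> 1 \<Longrightarrow> \<bar>- v k y - - v k x\<bar> \<le> N * norm (y - x) powr (\<alpha> / 2)"
  proof -
    show "\<bar>- v k y - - v k x\<bar> \<le> N * norm (y - x) powr (\<alpha> / 2)" if "norm (y - x) \<le> 1" for k x y
      using v_Hoelder[where x = y and y = x and k = k] that by (simp add: norm_minus_commute)
  qed (use v(1) v_bound in \<open>auto intro!: uniform_limit_uminus lim continuous_intros\<close>)
  obtain \<Phi> r \<rho> \<kappa> H where test: "flux_test (\<lambda>k x. - v k x) (\<lambda>x. - U x) \<Phi> p \<alpha> N M r \<rho> \<kappa> H x0" and r: "r \<le> r0"
    and \<Phi>: "\<And>x y. \<phi> y - \<phi> x - (b' - b) * norm (y - x) powr \<alpha> \<le> \<Phi> y - \<Phi> x" "\<And>x. \<Phi> x \<le> \<phi> x + U x0 / 2"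
    by (rule perturbed_test_function[OF phi touch' M1 \<open>0 < M\<close> \<open>0
        < b' - b\<close> r0 U2 continuous_on_minus[OF U_cont] \<alpha> p minus_v], assumption) (rule that)
  \<comment> \<open>The interpretation that follows rebinds \<open>lim\<close> to the convergence of
    the negated sequence.\<close>
  note v_lim = lim
  interpret flux_test "\<lambda>k x. - v k x" "\<lambda>x. - U x" \<Phi> p \<alpha> N M r \<rho> \<kappa> H x0 by (rule test)
  have near: "U x0 / 2 < U x \<and> U x < s'" if "x \<in> ball x0 r" for x
  proof -
    have "x \<in> ball x0 r1" using that r by (simp add: r0_def)
    then show ?thesis using r1(2) by blast
  qed
  have \<Phi>_neg: "\<Phi> x \<le> 0" for x
  proof (cases "x \<in> ball x0 r")
    case True
    then show ?thesis using near[OF True] \<Phi>(2)[of x] \<psi>_ge[of x] by (simp add: \<phi>_def)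
  next
    case False
    then show ?thesis using \<Phi>_F(1)[OF False] U_nonneg[of x] pos(3) by linarith
  qed
  have "b * norm (y0 - x0) powr \<alpha> < \<Phi> y0 - \<Phi> x0"
    using y0(2) \<Phi>(1)[of y0 x0] by (simp add: algebra_simps)
  moreover have "2 * r \<le> dist x0 y0" using r by (simp add: r0_def)
  ultimately obtain c where c: "0 < c" "\<forall>\<^sub>F k in sequentially. ennreal (c * b powr p k)
      \<le> flux_neg \<alpha> (p k) \<Phi> (\<eta> k)"
    using flux_neg_lower[of b y0] b \<open>0 < M\<close> by auto
  obtain C where C: "0 \<le> C" "\<forall>\<^sub>F k in sequentially. flux_pos \<alpha> (p k) \<Phi> (\<eta> k) \<le> ennreal (C * M powr p k)"
    using flux_pos_upper by blast
  obtain C' where C': "0 \<le> C'" "\<forall>\<^sub>F k in sequentially. mass v k \<le> ennreal (C' * s powr p k)"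
    using weighted_mass_upper[OF v_lim \<open>0 < s\<close> s'(2) less_imp_le[OF conjunct2[OF near]] v(3)] by blast
  \<comment> \<open>Positive flux and eigenvalue term are both bounded with the base M, so their
    constants simply add.\<close>
  have "\<forall>\<^sub>F k in sequentially. (C + C') * M powr p k < c * b powr p k"
    using \<open>0 < M\<close> b c by (intro eventually_mult_powr_less_seq) auto
  with c(2) C(2) C'(2) eventually_eigenvalue_finite eventually_p_gt[of 1] eventually_eigenvalue_le[OF Ls(1)]
  have "\<forall>\<^sub>F k in sequentially. False"
  proof eventually_elim
    case (elim k)
    then obtain l where l: "0 \<le> l" "first_eigenvalue \<alpha> (p k) \<Omega> = ennreal l" by blast
    have "ennreal (c * b powr p k) \<le> flux_neg \<alpha> (p k) \<Phi> (\<eta> k)" by (rule elim)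
    also have "\<dots> \<le> flux_pos \<alpha> (p k) \<Phi> (\<eta> k) + ennreal l * mass v k"
      by (rule subsolution_flux_inequality[OF \<Omega>(1,2) elim(5) l v \<Phi>_cont \<Phi>_neg \<eta>_def])
    also have "\<dots> \<le> ennreal (C * M powr p k) + ennreal (L powr p k) * ennreal (C' * s powr p k)"
      using elim l by (intro add_mono mult_mono) auto
    also have "\<dots> = ennreal (C * M powr p k + C' * (L * s) powr p k)"
      using C(1) C'(1) \<open>0 < L\<close> \<open>0 < s\<close> by (simp add: powr_mult mult_ac flip: ennreal_mult ennreal_plus)
    also have "\<dots> \<le> ennreal ((C + C') * M powr p k)"
    proof (rule ennreal_leI)
      have "(L * s) powr p k \<le> M powr p k" using Ls \<open>0 < L\<close> \<open>0 < s\<close> elim(5) by (intro powr_mono2) auto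
      then have "C' * (L * s) powr p k \<le> C' * M powr p k" using C'(1) by (rule mult_left_mono)
      then show "C * M powr p k + C' * (L * s) powr p k \<le> (C + C') * M powr p k"
          by (simp add: distrib_right)
    qed
    finally have "c * b powr p k \<le> (C + C') * M powr p k" using C(1) C'(1) by (simp add: ennreal_le_iff)
    then show False using elim by simp
  qed
  then show False by simp
qed

lemma viscosity_solution_U: "viscosity_solution \<alpha> \<Omega> U"
  unfolding viscosity_solution_def viscosity_supersolution_def viscosity_subsolution_def
  using U_Cc U_nonneg supersolution_gradient supersolution_eigenvalue subsolution_alternative by blast

end

theorem theorem23:
  fixes \<Omega> :: "'a::euclidean_space set"
    and \<alpha> :: real
    and p :: "nat \<Rightarrow> real"
    and u_seq :: "nat \<Rightarrow> 'a \<Rightarrow> real"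
  assumes domain: "open \<Omega>" "connected \<Omega>" "\<Omega> \<noteq> {}" "bounded \<Omega>"
    and alpha: "0 < \<alpha>" "\<alpha> \<le> 1"
    and p_to_infinity: "filterlim p at_top sequentially"
    and p_range: "\<And>k. p k \<ge> 2" "\<And>k. \<alpha> * p k > 2 * real DIM('a)"
    and eigenfunctions: "\<And>k. first_eigenfunction \<alpha> (p k) \<Omega> (u_seq k)"
    and normalised: "\<And>k. Lp_power (p k) (u_seq k) = 1"
  shows "\<exists>(r :: nat \<Rightarrow> nat) (v :: nat \<Rightarrow> 'a \<Rightarrow> real) (u :: 'a \<Rightarrow> real).
           strict_mono r \<and>
           (\<forall>k. continuous_rep (v k) (u_seq (r k))) \<and>
           uniform_limit \<Omega> v u sequentially \<and>
           u \<in> C0_closure \<Omega> \<and>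
           viscosity_solution \<alpha> \<Omega> u"
proof -
  \<comment> \<open>Any number above the asymptotic bound would do: this L only serves compactness,
    and the sharp rate is recovered afterwards for the limit.\<close>
  define L where "L = Lambda_infty_pow \<alpha> \<Omega> + 1"
  have L: "Lambda_infty_pow \<alpha> \<Omega> < L" "0 < L"
    using Lambda_infty_pow_pos[OF domain(1,4,3), of \<alpha>] by (simp_all add: L_def)
  have "\<forall>\<^sub>F q in at_top. first_eigenvalue \<alpha> q \<Omega> \<le> ennreal (L powr q)"
    by (rule first_eigenvalue_upper_bound[OF domain(1,4,3) alpha L(1)])
  then have "\<forall>\<^sub>F k in sequentially. first_eigenvalue \<alpha> (p k) \<Omega> \<le> ennreal (L powr p k)"
    using p_to_infinity by (auto simp: filterlim_iff)
  moreover have "\<forall>\<^sub>F k in sequentially. 4 * real DIM('a) / \<alpha> \<le> p k"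
    using p_to_infinity by (simp add: filterlim_at_top)
  ultimately have "\<forall>\<^sub>F k in sequentially. first_eigenvalue \<alpha> (p k) \<Omega> \<le> ennreal (L powr p k)
      \<and> 4 * real DIM('a) / \<alpha> \<le> p k"
    by eventually_elim simp
  \<comment> \<open>Dropping the first \<open>K\<close> indices secures both the energy bound and
    the Morrey threshold, which is stricter than the assumed range of p; hence the final subsequence
    sends k to K + r k.\<close>
  then obtain K where K: "\<And>k. K \<le> k \<Longrightarrow> first_eigenvalue \<alpha> (p k) \<Omega> \<le> ennreal (L powr p k)"
      "\<And>k. K \<le> k \<Longrightarrow> 4 * real DIM('a) \<le> \<alpha> * p k"
    using alpha by (auto simp: eventually_sequentially field_simps)
  have p_pos: "0 < p k" for k using p_range(1)[of k] by linarith
  have "\<exists>v. continuous_rep v (u_seq (K + k)) \<and> (\<forall>x. x \<notin> \<Omega> \<longrightarrow> v x = 0) \<and> (\<forall>x. 0 \<le> v x)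
      \<and> Lp_power (p (K + k)) v = 1 \<and>
      frac_energy (\<alpha> * p (K + k)) (p (K + k)) v = first_eigenvalue \<alpha> (p (K + k)) \<Omega>" for k
    using eigenfunction_representative[OF domain(4) alpha p_pos K(2) eigenfunctions normalised, of "K +
        k"] by (metis le_add1)
  then obtain v where v: "\<And>k. continuous_rep (v k) (u_seq (K + k))" "\<And>k x. x \<notin> \<Omega> \<Longrightarrow> v k x = 0" "\<And>k x. 0
      \<le> v k x"
      "\<And>k. Lp_power (p (K + k)) (v k) = 1"
      "\<And>k. frac_energy (\<alpha> * p (K + k)) (p (K + k)) (v k) = first_eigenvalue \<alpha> (p (K + k)) \<Omega>"
    by metis
  have cont: "continuous_on UNIV (v k)" for k using v(1) by (simp add: continuous_rep_def)
  obtain N where N: "0 < N" "\<And>(v :: 'a \<Rightarrow> real) p x y. continuous_on UNIV v \<Longrightarrow> (\<And>x. x \<notin> \<Omega> \<Longrightarrow> v x = 0) \<Longrightarrow> 0 < p \<Longrightarrow>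
     4 * real DIM('a) \<le> \<alpha> * p \<Longrightarrow> frac_energy (\<alpha> * p) p v \<le> ennreal (L powr p) \<Longrightarrow>
     \<bar>v x\<bar> \<le> N \<and> (norm (x - y) \<le> 1 \<longrightarrow> \<bar>v x - v y\<bar> \<le> N * norm (x - y) powr (\<alpha> / 2))"
    by (rule equi_Hoelder[OF domain(4) alpha L(2)]) blast
  have vN: "\<bar>v k x\<bar> \<le> N \<and> (norm (x - y) \<le> 1 \<longrightarrow> \<bar>v k x - v k y\<bar> \<le> N * norm (x - y) powr (\<alpha> / 2))" for k x y
    by (rule N(2)[of "v k" "p (K + k)", OF cont v(2) p_pos K(2)]) (use K(1) in \<open>auto simp: v(5)\<close>)
  obtain r :: "nat \<Rightarrow> nat" and u where r: "strict_mono r"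
      and u: "uniform_limit UNIV (\<lambda>k. v (r k)) u sequentially"
    by (rule equi_Hoelder_convergent_subsequence[of \<Omega> \<alpha> N v]) (use domain(4) alpha N(1) v(2) vN in auto)
  have rep: "\<forall>k. continuous_rep (v (r k)) (u_seq (K + r k))" using v(1) by blast
  have "filterlim (\<lambda>k. p (K + r k)) at_top sequentially"
  proof (rule filterlim_compose[OF p_to_infinity])
    have "strict_mono (\<lambda>k. K + r k)" using r by (simp add: strict_mono_def)
    then show "filterlim (\<lambda>k. K + r k) sequentially sequentially" by (rule filterlim_subseq)
  qed
  then interpret eigenfunction_limit \<Omega> \<alpha> N "\<lambda>k. p (K + r k)" "\<lambda>k. v (r k)" u
    by unfold_locales (use domain alpha cont v(2-5) vN u in auto)
  have "strict_mono (\<lambda>k. K + r k)" using r by (simp add: strict_mono_def)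
  moreover have "uniform_limit \<Omega> (\<lambda>k. v (r k)) u sequentially"
    by (rule uniform_limit_on_subset[OF u]) simp
  ultimately show ?thesis
    using rep U_C0_closure viscosity_solution_U
    by (intro exI[of _ "\<lambda>k. K + r k"] exI[of _ "\<lambda>k. v (r k)"] exI[of _ u]) blast
qed

end
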